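(* Let $\mu$ be a nondegenerate Borel probability measure on $\mathbb{R}$. Then the following assertions are equivalent: (1) There exists a sequence $B_n>0$ such that the measures $D_{1/B_n}\mu^{\triangleright n}$ converge weakly to the standard arc-sine law $\gamma$ as $n\to\infty$. (2) The function $H_\mu$ is slowly varying and the mean of the measure $\mu$ is zero.
   Context: Let $\mathbb{C}^{+}=\{z\in\mathbb{C}:\Im z>0\}$ and let $\mathcal{M}$ be the set of all Borel probability measures on $\mathbb{R}$. For $\mu\in\mathcal{M}$ the Cauchy transform is $G_\mu(z)=\int_{-\infty}^{\infty}\frac{1}{z-t}\,d\mu(t)$, $z\in\mathbb{C}^{+}$, and the reciprocal Cauchy transform is $F_\mu=1/G_\mu:\mathbb{C}^{+}\to\mathbb{C}^{+}$; it determines $\mu$. The monotone convolution $\mu\triangleright\nu\in\mathcal{M}$ of $\mu,\nu\in\mathcal{M}$ is the measure determined by $F_{\mu\triangleright\nu}(z)=F_\mu(F_\nu(z))$, $z\in\mathbb{C}^{+}$. It is associative; $\mu^{\triangleright n}$ denotes the $n$-fold monotone convolution power of $\mu$. A measure in $\mathcal{M}$ is degenerate if it is a point mass, and nondegenerate otherwise. For $b>0$, $D_b\mu$ is the dilation $D_b\mu(A)=\mu(b^{-1}A)$ for Borel sets $A$. The standard arc-sine law $\gamma$ has density $\pi^{-1}(2-x^2)^{-1/2}$ on $(-\sqrt2,\sqrt2)$; $F_\gamma(z)=\sqrt{z^2-2}$, where the square root is analytic on $\mathbb{C}\setminus[0,+\infty)$ with $\sqrt{-1}=i$. $H_\mu(x)=\int_{-x}^{x}t^2\,d\mu(t)$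 for $x\ge 0$. A positive Borel function $f$ is slowly varying if $\lim_{x\to\infty}f(cx)/f(x)=1$ for every constant $c>0$ (for functions such as $H_\mu$, positivity is needed only for large $x$). The mean of $\mu$ is $m(\mu)=\int t\,d\mu(t)$, provided the integral converges absolutely; if $H_\mu$ is slowly varying, the mean exists. *)

theory Defs
  imports "HOL-Probability.Probability"
begin

definition cauchy_transform :: "real measure \<Rightarrow> complex \<Rightarrow> complex" where
  "cauchy_transform \<mu> z = (LINT t|\<mu>. 1 / (z - complex_of_real t))"

definition recip_cauchy_transform :: "real measure \<Rightarrow> complex \<Rightarrow> complex" where
  "recip_cauchy_transform \<mu> z = 1 / cauchy_transform \<mu> z"

definition monotone_conv :: "real measure \<Rightarrow> real measure \<Rightarrow> real measure" where
  "monotone_conv \<mu> \<nu> =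
    (THE \<rho>. real_distribution \<rho> \<and>
      (\<forall>z. Im z > 0 \<longrightarrow>
        recip_cauchy_transform \<rho> z = recip_cauchy_transform \<mu> (recip_cauchy_transform \<nu> z)))"

(* The point mass at 0 is the unit of monotone convolution: its reciprocal Cauchy transform
   is the identity. *)
primrec monotone_conv_power :: "real measure \<Rightarrow> nat \<Rightarrow> real measure" where
  "monotone_conv_power \<mu> 0 = return borel 0"
| "monotone_conv_power \<mu> (Suc n) = monotone_conv \<mu> (monotone_conv_power \<mu> n)"

definition degenerate :: "real measure \<Rightarrow> bool" where
  "degenerate \<mu> \<longleftrightarrow> (\<exists>a. \<mu> = return borel a)"

(* For b > 0 the preimage of A under multiplication by b is A scaled by 1/b. *)
definition dilation :: "real \<Rightarrow> real measure \<Rightarrow> real measure" where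
  "dilation b \<mu> = distr \<mu> borel (\<lambda>x. b * x)"

definition arcsine_law :: "real measure" where
  "arcsine_law = density lborel
    (\<lambda>x. ennreal (indicator {- sqrt 2<..<sqrt 2} x * (1 / (pi * sqrt (2 - x\<^sup>2)))))"

definition truncated_second_moment :: "real measure \<Rightarrow> real \<Rightarrow> real" where
  "truncated_second_moment \<mu> x = (LINT t:{-x..x}|\<mu>. t\<^sup>2)"

(* Only the values on the half-line [0,\<infinity>) matter, and positivity is required only near
   infinity. *)
definition slowly_varying :: "(real \<Rightarrow> real) \<Rightarrow> bool" where
  "slowly_varying f \<longleftrightarrow>
    set_borel_measurable borel {0..} f \<and>
    (\<forall>\<^sub>F x in at_top. f x > 0) \<and>
    (\<forall>c>0. ((\<lambda>x. f (c * x) / f x) \<longlongrightarrow> 1) at_top)"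

(* The mean exists only if the integral converges absolutely, whereas the Bochner integral of
   a non-integrable function is 0. *)
definition has_mean :: "real measure \<Rightarrow> real \<Rightarrow> bool" where
  "has_mean \<mu> m \<longleftrightarrow> integrable \<mu> (\<lambda>t. t) \<and> (LINT t|\<mu>. t) = m"

end

theory Submission
  imports Defs "HOL-Complex_Analysis.Complex_Analysis"
begin

text \<open>
  Write $F = F_\mu$ and $A = F - \mathrm{id}$. The difference quotients of $A$ are normalised
  covariances of resolvents. Hence $A$ satisfies a two-point Schwarz--Pick inequality and Harnack's
  inequality, with constants independent of $\mu$.

  If $H_\mu$ is slowly varying and the mean is zero, then $F(z) = z - (1 + o(1)) H_\mu(|z|)/z$
  in every cone. With $B_n^2 \sim n H_\mu(B_n)$ the map $f_n(w) = F(B_n w)/B_n$ satisfies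
  $f_n(w)^2 = w^2 - 2/n + o(1/n)$, so its $n$-th iterate tends to $\sqrt{w^2 - 2}$.

  Conversely, let $g_n = f_n^{\circ n} \to f = F_\gamma$. Because $f_n$ commutes with $g_n$, the small
  displacement $A_n = f_n - \mathrm{id}$ satisfies $A_n \circ f \approx f' A_n$, and the only solutions of
  this functional equation with nonnegative imaginary part are the multiples of $-1/z$. Counting
  iterations gives $n A_n(z) \to -1/z$, whence $n B_n^{-2} H_\mu(\lambda B_n) \to 1$ for every
  $\lambda > 0$, and the mean vanishes.
\<close>

section \<open>Resolvents and the Schwarz--Pick inequality\<close>

text \<open>Uniformity is the obstacle: both directions iterate maps f_n that change with n, and
  each is applied n times, so pointwise asymptotics of A_n = f_n - id are too weak. The two-point
  inequality does the work of a normal-family argument: control of A_n at one point gives a bound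
  and a Lipschitz constant on every half-disc at positive height, whatever the measure. Squares
  enter because w - e/w squares to w^2 - 2e + O(e^2), so in the variable w^2 the iteration is nearly
  a translation and errors merely add up. Two constructions have other origins. The convolution is
  defined by description, so that G_mu o F_nu is a Cauchy transform has to be proved, via Herglotz
  measures on the circle. And H_mu may jump, so the constants B_n come from psi(y) = integral of
  t^2/(t^2 + y^2): it equals 1 + y Im G(iy), is continuous and nonincreasing for y > 0, and y^2
  psi(y) is asymptotic to H_mu(y) when H_mu varies slowly. In the converse direction only B_n > 0 is
  given; that B_n tends to infinity has to be extracted from the convergence.\<close>

lemma norm_integral_mult_square_le:
  fixes f g :: "'a \<Rightarrow> complex"
  assumes [measurable]: "f \<in> borel_measurable M" "g \<in> borel_measurable M"
    and f: "integrable M (\<lambda>x. (norm (f x))\<^sup>2)" and g: "integrable M (\<lambda>x. (norm (g x))\<^sup>2)"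
  shows "(norm (\<integral>x. f x * g x \<partial>M))\<^sup>2 \<le> (\<integral>x. (norm (f x))\<^sup>2 \<partial>M) * (\<integral>x. (norm (g x))\<^sup>2 \<partial>M)"
proof -
  have fg: "integrable M (\<lambda>x. norm (f x) * norm (g x))"
  proof (rule Bochner_Integration.integrable_bound[OF Bochner_Integration.integrable_add[OF f g]])
    have "norm (f x) * norm (g x) \<le> (norm (f x))\<^sup>2 + (norm (g x))\<^sup>2" for x
      using sum_squares_bound[of "norm (f x)" "norm (g x)"]
        mult_nonneg_nonneg[OF norm_ge_zero norm_ge_zero, of "f x" "g x"] by linarith
    then show "AE x in M. norm (norm (f x) * norm (g x)) \<le> norm ((norm (f x))\<^sup>2 + (norm (g x))\<^sup>2)"
      by auto
  qed simp
  have "norm (\<integral>x. f x * g x \<partial>M) \<le> (\<integral>x. norm (f x) * norm (g x) \<partial>M)"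
    using integral_norm_bound[of M "\<lambda>x. f x * g x"] by (simp add: norm_mult)
  then have "(norm (\<integral>x. f x * g x \<partial>M))\<^sup>2 \<le> (\<integral>x. norm (f x) * norm (g x) \<partial>M)\<^sup>2"
    by (simp add: power_mono)
  also have "\<dots> \<le> (\<integral>x. (norm (f x))\<^sup>2 \<partial>M) * (\<integral>x. (norm (g x))\<^sup>2 \<partial>M)"
  proof -
    have "ennreal ((\<integral>x. norm (f x) * norm (g x) \<partial>M)\<^sup>2) = (\<integral>\<^sup>+x. ennreal (norm (f x))
      * ennreal (norm (g x)) \<partial>M)\<^sup>2"
      using nn_integral_eq_integral[OF fg] by (simp add: ennreal_mult ennreal_power[symmetric] integral_nonneg_AE)
    also have "\<dots> \<le> (\<integral>\<^sup>+x. ennreal (norm (f x)) ^ 2 \<partial>M) * (\<integral>\<^sup>+x. ennreal (norm (g x)) ^ 2 \<partial>M)"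
      by (rule Cauchy_Schwarz_nn_integral) auto
    also have "\<dots> = ennreal ((\<integral>x. (norm (f x))\<^sup>2 \<partial>M) * (\<integral>x. (norm (g x))\<^sup>2 \<partial>M))"
      using nn_integral_eq_integral[OF f] nn_integral_eq_integral[OF g]
      by (simp add: ennreal_mult ennreal_power[symmetric] integral_nonneg_AE)
    finally show ?thesis
      by (subst (asm) ennreal_le_iff) (auto intro!: mult_nonneg_nonneg integral_nonneg_AE)
  qed
  finally show ?thesis .
qed

definition cauchy_kernel :: "complex \<Rightarrow> real \<Rightarrow> complex" where
  "cauchy_kernel z t = 1 / (z - complex_of_real t)"

lemma Im_pos_diff_of_real [simp]: "Im z > 0 \<Longrightarrow> z - complex_of_real t \<noteq> 0"
  by (auto simp: complex_eq_iff)

lemma cauchy_kernel_nonzero: "Im z > 0 \<Longrightarrow> cauchy_kernel z t \<noteq> 0"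
  by (simp add: cauchy_kernel_def del: right_minus_eq)

lemma norm_cauchy_kernel_le: "Im z > 0 \<Longrightarrow> norm (cauchy_kernel z t) \<le> 1 / Im z"
  using abs_Im_le_cmod[of "z - complex_of_real t"]
  by (simp add: cauchy_kernel_def norm_divide frac_le)

lemma norm_cauchy_kernel_mult_le:
  "Im z > 0 \<Longrightarrow> Im w > 0 \<Longrightarrow> norm (cauchy_kernel z t * cauchy_kernel w t) \<le> 1 / Im z * (1 / Im w)"
  unfolding norm_mult by (intro mult_mono norm_cauchy_kernel_le) auto

lemma isCont_cauchy_kernel: "Im z > 0 \<Longrightarrow> isCont (cauchy_kernel z) t"
  unfolding cauchy_kernel_def by (intro continuous_intros) (auto simp del: right_minus_eq)

lemma continuous_on_cauchy_kernel: "Im z > 0 \<Longrightarrow> continuous_on A (cauchy_kernel z)"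
  by (simp add: continuous_at_imp_continuous_on isCont_cauchy_kernel)

lemma borel_measurable_cauchy_kernel [measurable]: "cauchy_kernel z \<in> borel_measurable borel"
  unfolding cauchy_kernel_def[abs_def] by measurable

lemma cauchy_kernel_diff:
  assumes "Im z > 0" "Im w > 0"
  shows "cauchy_kernel z t - cauchy_kernel w t = (w - z) * (cauchy_kernel z t * cauchy_kernel w t)"
  using Im_pos_diff_of_real[OF assms(1), of t] Im_pos_diff_of_real[OF assms(2), of t]
  by (simp add: cauchy_kernel_def divide_simps del: right_minus_eq) 

lemma Im_cauchy_kernel: "Im (cauchy_kernel z t) = - Im z * (norm (cauchy_kernel z t))\<^sup>2"
  by (simp add: cauchy_kernel_def Im_divide norm_divide power_divide cmod_power2)

lemma cauchy_transform_kernel: "cauchy_transform M z = (\<integral>t. cauchy_kernel z t \<partial>M)"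
  by (simp add: cauchy_transform_def cauchy_kernel_def)

text \<open>The displacement A of the overview. Since Im F >= Im z, it takes values in the closed
  upper half-plane.\<close>

definition recip_shift :: "real measure \<Rightarrow> complex \<Rightarrow> complex" where
  "recip_shift M z = recip_cauchy_transform M z - z"

text \<open>Equals 2 sinh(d/2) for the hyperbolic distance d of the upper half-plane. This is the
  quantity that Cauchy-Schwarz produces directly.\<close>

definition hyp_gap :: "complex \<Rightarrow> complex \<Rightarrow> real" where
  "hyp_gap z w = norm (z - w) / sqrt (Im z * Im w)"

context real_distribution
begin

lemma prob_UNIV [simp]: "prob UNIV = 1" "emeasure M UNIV = 1"
  using prob_space emeasure_space_1 by simp_all

lemma integrable_bounded_cont:
  fixes f :: "real \<Rightarrow> 'b::{banach, second_countable_topology}"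
  assumes "\<And>t. norm (f t) \<le> B" "f \<in> borel_measurable borel"
  shows "integrable M f"
  using assms by (intro integrable_const_bound[where B=B]) auto

lemma integrable_cauchy_kernel: "Im z > 0 \<Longrightarrow> integrable M (cauchy_kernel z)"
  by (intro integrable_bounded_cont[OF norm_cauchy_kernel_le]) auto

lemma integrable_cauchy_kernel_mult:
  "Im z > 0 \<Longrightarrow> Im w > 0 \<Longrightarrow> integrable M (\<lambda>t. cauchy_kernel z t * cauchy_kernel w t)"
  by (intro integrable_bounded_cont[OF norm_cauchy_kernel_mult_le]) auto

lemma integrable_norm_cauchy_kernel:
  assumes "Im z > 0" shows "integrable M (\<lambda>t. (norm (cauchy_kernel z t))\<^sup>2)"
  using norm_cauchy_kernel_mult_le[OF assms assms]
  by (intro integrable_bounded_cont[where B="1 / Im z * (1 / Im z)"])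
    (auto simp: norm_mult power2_eq_square)

lemma cauchy_transform_diff:
  assumes "Im z > 0" "Im w > 0"
  shows "cauchy_transform M z - cauchy_transform M w = (w - z) * (\<integral>t. cauchy_kernel z t * cauchy_kernel w t \<partial>M)"
proof -
  have "cauchy_transform M z - cauchy_transform M w = (\<integral>t. cauchy_kernel z t - cauchy_kernel w t \<partial>M)"
    unfolding cauchy_transform_kernel
    by (rule Bochner_Integration.integral_diff[symmetric]) (auto intro: integrable_cauchy_kernel assms)
  then show ?thesis using assms by (simp add: cauchy_kernel_diff)
qed

text \<open>The bound involves the distance and the heights of the points but not the measure, so it
  stays usable when measure and point vary together.\<close>

lemma norm_integral_cauchy_kernel_mult_diff_le:
  assumes z: "Im z > 0" and w: "Im w > 0" and v: "Im v > 0"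
  shows "norm ((\<integral>t. cauchy_kernel w t * cauchy_kernel v t \<partial>M) - (\<integral>t. cauchy_kernel z t * cauchy_kernel v t \<partial>M))
    \<le> norm (w - z) * (1 / Im w * (1 / Im z * (1 / Im v)))"
proof -
  have "(\<integral>t. cauchy_kernel w t * cauchy_kernel v t \<partial>M) - (\<integral>t. cauchy_kernel z t * cauchy_kernel v t \<partial>M)
    = (\<integral>t. cauchy_kernel w t * cauchy_kernel v t - cauchy_kernel z t * cauchy_kernel v t \<partial>M)"
    by (intro Bochner_Integration.integral_diff[symmetric] integrable_cauchy_kernel_mult z w v)
  also have "norm \<dots> \<le> (\<integral>t. norm (w - z) * (1 / Im w * (1 / Im z * (1 / Im v))) \<partial>M)"
  proof (intro order_trans[OF integral_norm_bound] integral_mono)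
    show "integrable M (\<lambda>t. norm (cauchy_kernel w t * cauchy_kernel v t
      - cauchy_kernel z t * cauchy_kernel v t))"
      by (intro integrable_norm Bochner_Integration.integrable_diff integrable_cauchy_kernel_mult z w v)
    fix t
    have "norm (cauchy_kernel w t * cauchy_kernel v t - cauchy_kernel z t * cauchy_kernel v t)
      = norm (z - w) * (norm (cauchy_kernel w t) * (norm (cauchy_kernel z t) * norm (cauchy_kernel v t)))"
      using cauchy_kernel_diff[OF w z, of t]
      by (simp add: left_diff_distrib[symmetric] norm_mult mult.assoc)
    also have "\<dots> \<le> norm (z - w) * (1 / Im w * (1 / Im z * (1 / Im v)))"
      using w z v by (intro mult_mono norm_cauchy_kernel_le mult_nonneg_nonneg) auto
    finally show "norm (cauchy_kernel w t * cauchy_kernel v t - cauchy_kernel z t * cauchy_kernel v t)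
      \<le> norm (w - z) * (1 / Im w * (1 / Im z * (1 / Im v)))" by (simp add: norm_minus_commute)
  qed simp
  finally show ?thesis by simp
qed

lemma Im_cauchy_transform:
  assumes "Im z > 0"
  shows "Im (cauchy_transform M z) = - Im z * (\<integral>t. (norm (cauchy_kernel z t))\<^sup>2 \<partial>M)"
proof -
  have "Im (cauchy_transform M z) = (\<integral>t. Im (cauchy_kernel z t) \<partial>M)"
    unfolding cauchy_transform_kernel by (rule integral_Im[symmetric]) (rule integrable_cauchy_kernel[OF assms])
  then show ?thesis by (simp add: Im_cauchy_kernel)
qed

lemma integral_norm_cauchy_kernel_pos:
  assumes "Im z > 0" shows "(\<integral>t. (norm (cauchy_kernel z t))\<^sup>2 \<partial>M) > 0"
proof -
  have "(\<integral>t. (norm (cauchy_kernel z t))\<^sup>2 \<partial>M) \<noteq> 0"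
    using integral_nonneg_eq_0_iff_AE[OF integrable_norm_cauchy_kernel[OF assms]]
      cauchy_kernel_nonzero[OF assms] by simp
  then show ?thesis by (simp add: less_le integral_nonneg_AE)
qed

lemma Im_cauchy_transform_neg: "Im z > 0 \<Longrightarrow> Im (cauchy_transform M z) < 0"
  by (simp add: Im_cauchy_transform integral_norm_cauchy_kernel_pos mult_pos_pos)

lemma cauchy_transform_nonzero: "Im z > 0 \<Longrightarrow> cauchy_transform M z \<noteq> 0"
  using Im_cauchy_transform_neg[of z] by auto

lemma integral_cauchy_kernel_centered:
  assumes z: "Im z > 0" and w: "Im w > 0"
  shows "(\<integral>t. (cauchy_kernel z t - cauchy_transform M z) * (cauchy_kernel w t - cauchy_transform M w) \<partial>M)
    = (\<integral>t. cauchy_kernel z t * cauchy_kernel w t \<partial>M) - cauchy_transform M z * cauchy_transform M w"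
  using integrable_cauchy_kernel_mult[OF z w] integrable_cauchy_kernel[OF z] integrable_cauchy_kernel[OF w]
  by (simp add: algebra_simps cauchy_transform_kernel[symmetric] prob_space)

lemma integrable_norm_cauchy_kernel_centered:
  assumes z: "Im z > 0"
  shows "integrable M (\<lambda>t. (norm (cauchy_kernel z t - c))\<^sup>2)"
proof (rule integrable_bounded_cont[where B="(1 / Im z + norm c)\<^sup>2"])
  show "norm ((norm (cauchy_kernel z t - c))\<^sup>2) \<le> (1 / Im z + norm c)\<^sup>2" for t
    using norm_triangle_ineq4[of "cauchy_kernel z t" c] norm_cauchy_kernel_le[OF z, of t]
    by (simp add: power_mono)
qed auto

lemma integral_norm_cauchy_kernel_centered:
  assumes z: "Im z > 0"
  shows "(\<integral>t. (norm (cauchy_kernel z t - cauchy_transform M z))\<^sup>2 \<partial>M)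
    = (\<integral>t. (norm (cauchy_kernel z t))\<^sup>2 \<partial>M) - (norm (cauchy_transform M z))\<^sup>2"
proof -
  define c where "c = cauchy_transform M z"
  have Re: "(\<integral>t. Re (cauchy_kernel z t) \<partial>M) = Re c" and Im: "(\<integral>t. Im (cauchy_kernel z t) \<partial>M) = Im c"
    using integrable_cauchy_kernel[OF z] by (simp_all add: c_def cauchy_transform_kernel)
  have *: "(norm (cauchy_kernel z t - c))\<^sup>2 = (norm (cauchy_kernel z t))\<^sup>2 
      - 2 * Re c * Re (cauchy_kernel z t) - 2 * Im c * Im (cauchy_kernel z t) + (norm c)\<^sup>2" for t
    by (simp only: cmod_power2 minus_complex.sel) (simp add: power2_eq_square algebra_simps)
  have "(\<integral>t. (norm (cauchy_kernel z t - c))\<^sup>2 \<partial>M) = (\<integral>t. (norm (cauchy_kernel z t))\<^sup>2 \<partial>M) 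
      - 2 * Re c * Re c - 2 * Im c * Im c + (norm c)\<^sup>2"
    unfolding * Re[symmetric] Im[symmetric]
    using integrable_cauchy_kernel[OF z] integrable_norm_cauchy_kernel[OF z]
    by (simp add: prob_space integrable_Re integrable_Im)
  then show ?thesis
    using cmod_power2[of c] by (simp add: c_def power2_eq_square algebra_simps)
qed

lemma Im_recip_cauchy_transform:
  assumes "Im z > 0"
  shows "Im (recip_cauchy_transform M z)
    = Im z * (\<integral>t. (norm (cauchy_kernel z t))\<^sup>2 \<partial>M) / (norm (cauchy_transform M z))\<^sup>2"
  by (simp add: recip_cauchy_transform_def Im_divide Im_cauchy_transform[OF assms] cmod_power2)

text \<open>The integral is the variance of the resolvent, so nonnegativity of Im A and its equality
  case can both be read off from this form.\<close>

lemma Im_recip_shift: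
  assumes "Im z > 0"
  shows "Im (recip_shift M z) = Im z * (\<integral>t. (norm (cauchy_kernel z t - cauchy_transform M z))\<^sup>2 \<partial>M)
     / (norm (cauchy_transform M z))\<^sup>2"
  using cauchy_transform_nonzero[OF assms] assms
  by (simp add: recip_shift_def Im_recip_cauchy_transform integral_norm_cauchy_kernel_centered field_simps)

lemma Im_recip_shift_nonneg: "Im z > 0 \<Longrightarrow> Im (recip_shift M z) \<ge> 0"
  by (simp add: Im_recip_shift integral_nonneg_AE)

lemma Im_recip_cauchy_transform_ge: "Im z > 0 \<Longrightarrow> Im (recip_cauchy_transform M z) \<ge> Im z"
  using Im_recip_shift_nonneg[of z] by (simp add: recip_shift_def)

lemma Im_recip_cauchy_transform_pos: "Im z > 0 \<Longrightarrow> Im (recip_cauchy_transform M z) > 0"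
  using Im_recip_cauchy_transform_ge[of z] by simp

lemma recip_cauchy_transform_diff:
  assumes z: "Im z > 0" and w: "Im w > 0"
  shows "recip_cauchy_transform M z - recip_cauchy_transform M w
    = (z - w) * ((\<integral>t. cauchy_kernel z t * cauchy_kernel w t \<partial>M) / (cauchy_transform M z
      * cauchy_transform M w))"
proof -
  have "recip_cauchy_transform M z - recip_cauchy_transform M w
      = - (cauchy_transform M z - cauchy_transform M w) / (cauchy_transform M z * cauchy_transform M w)"
    using cauchy_transform_nonzero[OF z] cauchy_transform_nonzero[OF w]
    by (simp add: recip_cauchy_transform_def field_simps)
  also have "\<dots> = (z - w) * ((\<integral>t. cauchy_kernel z t * cauchy_kernel w t \<partial>M) / (cauchy_transform M z
    * cauchy_transform M w))"
    unfolding cauchy_transform_diff[OF z w] by (simp add: field_simps)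
  finally show ?thesis .
qed

text \<open>A two-point form of the Schwarz--Pick inequality: the difference quotient of $F_\mu - \mathrm{id}$
  is a normalised covariance of two resolvents.\<close>

lemma recip_shift_diff_le:
  assumes z: "Im z > 0" and w: "Im w > 0"
  shows "(norm (recip_shift M z - recip_shift M w))\<^sup>2 * (Im z * Im w)
    \<le> (norm (z - w))\<^sup>2 * (Im (recip_shift M z) * Im (recip_shift M w))"
proof -
  define c d where "c = cauchy_transform M z" and "d = cauchy_transform M w"
  define V where "V = (\<integral>t. (cauchy_kernel z t - c) * (cauchy_kernel w t - d) \<partial>M)"
  define P where "P = (\<integral>t. (norm (cauchy_kernel z t - c))\<^sup>2 \<partial>M)"
  define Q where "Q = (\<integral>t. (norm (cauchy_kernel w t - d))\<^sup>2 \<partial>M)"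
  have nz: "c \<noteq> 0" "d \<noteq> 0"
    using cauchy_transform_nonzero[OF z] cauchy_transform_nonzero[OF w] by (auto simp: c_def d_def)
  \<comment> \<open>Subtracting the identity from F turns the mixed second moment of the kernels
    into their covariance V.\<close>
  have "recip_shift M z - recip_shift M w = (z - w) * V / (c * d)"
    using recip_cauchy_transform_diff[OF z w] nz
    unfolding V_def c_def d_def integral_cauchy_kernel_centered[OF z w]
    by (simp add: recip_shift_def field_simps)
  then have 1: "(norm (recip_shift M z - recip_shift M w))\<^sup>2
      = (norm (z - w))\<^sup>2 * (norm V)\<^sup>2 / ((norm c)\<^sup>2 * (norm d)\<^sup>2)"
    by (simp add: norm_mult norm_divide power_mult_distrib power_divide)
  have "(norm V)\<^sup>2 \<le> P * Q"
    unfolding V_def P_def Q_def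
    by (rule norm_integral_mult_square_le)
      (auto intro: integrable_norm_cauchy_kernel_centered z w)
  then have "(norm (z - w))\<^sup>2 * (norm V)\<^sup>2 / ((norm c)\<^sup>2 * (norm d)\<^sup>2) * (Im z * Im w) 
    \<le> (norm (z - w))\<^sup>2 * (P * Q) / ((norm c)\<^sup>2 * (norm d)\<^sup>2) * (Im z * Im w)"
    using z w by (intro mult_right_mono divide_right_mono mult_left_mono) auto
  also have "\<dots> = (norm (z - w))\<^sup>2 * (Im (recip_shift M z) * Im (recip_shift M w))"
    unfolding Im_recip_shift[OF z] Im_recip_shift[OF w] by (simp add: P_def Q_def c_def d_def)
  finally show ?thesis unfolding 1 .
qed

text \<open>The variance of the resolvent vanishes only if the kernel is almost surely constant, and
  the value of the kernel at z determines t.\<close>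

lemma recip_shift_strict:
  assumes z: "Im z > 0" and nd: "\<not> degenerate M"
  shows "Im (recip_shift M z) > 0"
proof (rule ccontr)
  define c where "c = cauchy_transform M z"
  assume "\<not> Im (recip_shift M z) > 0"
  then have "Im (recip_shift M z) = 0" using Im_recip_shift_nonneg[OF z] by simp
  then have "(\<integral>t. (norm (cauchy_kernel z t - c))\<^sup>2 \<partial>M) = 0"
    using z cauchy_transform_nonzero[OF z] by (auto simp: Im_recip_shift c_def)
  then have "AE t in M. cauchy_kernel z t = c"
    using integral_nonneg_eq_0_iff_AE[OF integrable_norm_cauchy_kernel_centered[OF z, of c]] by simp
  moreover have "t = Re (z - 1 / c)" if "cauchy_kernel z t = c" for t
    unfolding that[symmetric] using z by (simp add: cauchy_kernel_def)
  ultimately have ae: "AE t in M. t = Re (z - 1 / c)" by auto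
  define a where "a = Re (z - 1 / c)"
  have "M = return borel a"
  proof (rule measure_eqI)
    fix A assume "A \<in> sets M"
    then have [measurable]: "A \<in> sets borel" by simp
    have "emeasure M A = emeasure M (if a \<in> A then UNIV else {})"
    proof (rule emeasure_eq_AE)
      show "AE t in M. (t \<in> A) = (t \<in> (if a \<in> A then UNIV else {}))"
        using ae[folded a_def] by eventually_elim simp
    qed auto
    then show "emeasure M A = emeasure (return borel a) A"
      by simp
  qed simp
  with nd show False by (auto simp: degenerate_def)
qed


section \<open>Harnack's inequality and bounds from one reference point\<close>

lemma norm_recip_shift_diff_le:
  assumes z: "Im z > 0" and w: "Im w > 0"
  shows "norm (recip_shift M z - recip_shift M w)
    \<le> hyp_gap z w * sqrt (Im (recip_shift M z) * Im (recip_shift M w))"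
proof -
  have "(norm (recip_shift M z - recip_shift M w))\<^sup>2
      \<le> (norm (z - w))\<^sup>2 * (Im (recip_shift M z) * Im (recip_shift M w)) / (Im z * Im w)"
    using recip_shift_diff_le[OF z w] z w by (simp add: pos_le_divide_eq)
  also have "\<dots> = (hyp_gap z w * sqrt (Im (recip_shift M z) * Im (recip_shift M w)))\<^sup>2"
    using z w Im_recip_shift_nonneg by (simp add: hyp_gap_def power_mult_distrib power_divide)
  finally show ?thesis
    by (rule power2_le_imp_le)
      (use z w Im_recip_shift_nonneg in \<open>auto simp: hyp_gap_def intro!: mult_nonneg_nonneg divide_nonneg_nonneg\<close>)
qed

text \<open>With \<alpha> and \<beta> the square roots of Im A at z and w, the two-point inequality
  gives \<beta>^2 - \<alpha>^2 <= d \<alpha> \<beta>. If \<beta> exceeded (1 + d) \<alpha>, then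
  \<beta> (\<beta> - d \<alpha>) would exceed \<alpha>^2. The resulting factor is not sharp, but it
  is free of the measure.\<close>

lemma recip_shift_harnack:
  assumes z: "Im z > 0" and w: "Im w > 0"
  shows "Im (recip_shift M w) \<le> (1 + hyp_gap z w)\<^sup>2 * Im (recip_shift M z)"
proof -
  define \<alpha> \<beta> d where "\<alpha> = sqrt (Im (recip_shift M z))" and "\<beta> = sqrt (Im (recip_shift M w))"
    and "d = hyp_gap z w"
  have nn: "\<alpha> \<ge> 0" "\<beta> \<ge> 0" "d \<ge> 0"
    using z w by (auto simp: \<alpha>_def \<beta>_def d_def hyp_gap_def Im_recip_shift_nonneg)
  have sq: "\<alpha>\<^sup>2 = Im (recip_shift M z)" "\<beta>\<^sup>2 = Im (recip_shift M w)"
    using z w by (auto simp: \<alpha>_def \<beta>_def Im_recip_shift_nonneg)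
  have "\<beta>\<^sup>2 - \<alpha>\<^sup>2 \<le> norm (recip_shift M z - recip_shift M w)"
    unfolding sq using abs_Im_le_cmod[of "recip_shift M z - recip_shift M w"] by simp
  also have "\<dots> \<le> d * (\<alpha> * \<beta>)"
    using norm_recip_shift_diff_le[OF z w] by (simp add: \<alpha>_def \<beta>_def d_def real_sqrt_mult)
  finally have *: "\<beta>\<^sup>2 - \<alpha>\<^sup>2 \<le> d * (\<alpha> * \<beta>)" .
  have "\<beta> \<le> (1 + d) * \<alpha>"
  proof (rule ccontr)
    assume "\<not> \<beta> \<le> (1 + d) * \<alpha>"
    then have c: "\<beta> - d * \<alpha> > \<alpha>" by (simp add: algebra_simps)
    moreover have "\<beta> > \<alpha>" using c nn mult_nonneg_nonneg[of d \<alpha>] by linarith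
    ultimately have "\<beta> * (\<beta> - d * \<alpha>) > \<beta> * \<alpha>" "\<beta> * \<alpha> \<ge> \<alpha> * \<alpha>"
      using nn by (auto intro!: mult_right_mono mult_strict_left_mono)
    with * show False by (simp add: power2_eq_square algebra_simps)
  qed
  then have "\<beta>\<^sup>2 \<le> ((1 + d) * \<alpha>)\<^sup>2" using nn by (intro power_mono)
  then show ?thesis by (simp add: power_mult_distrib sq d_def)
qed

text \<open>Harnack removes the second point from the right-hand side: Im A at z alone controls the
  variation of A around z.\<close>

lemma norm_recip_shift_diff_le':
  assumes z: "Im z > 0" and w: "Im w > 0"
  shows "norm (recip_shift M w - recip_shift M z)
    \<le> hyp_gap z w * (1 + hyp_gap z w) * Im (recip_shift M z)"
proof -
  have "Im (recip_shift M z) * Im (recip_shift M w) \<le> ((1 + hyp_gap z w) * Im (recip_shift M z))\<^sup>2"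
    using mult_left_mono[OF recip_shift_harnack[OF z w] Im_recip_shift_nonneg[OF z]]
    by (simp add: power2_eq_square algebra_simps)
  then have "sqrt (Im (recip_shift M z) * Im (recip_shift M w)) \<le> (1 + hyp_gap z w) * Im (recip_shift M z)"
    using z w Im_recip_shift_nonneg
    by (intro real_le_lsqrt) (auto simp: hyp_gap_def intro!: mult_nonneg_nonneg add_nonneg_nonneg)
  then have "hyp_gap z w * sqrt (Im (recip_shift M z) * Im (recip_shift M w))
    \<le> hyp_gap z w * ((1 + hyp_gap z w) * Im (recip_shift M z))"
    using z w by (intro mult_left_mono) (auto simp: hyp_gap_def)
  with norm_recip_shift_diff_le[OF z w] show ?thesis
    by (simp add: norm_minus_commute mult.assoc)
qed

text \<open>Reduces the size of A anywhere to its size at one reference point, which makes it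
  possible to normalise displacements at \<i>.\<close>

lemma norm_recip_shift_le:
  assumes z: "Im z > 0" and w: "Im w > 0"
  shows "norm (recip_shift M w) \<le> (1 + hyp_gap z w)\<^sup>2 * norm (recip_shift M z)"
proof -
  have d: "hyp_gap z w \<ge> 0" using z w by (simp add: hyp_gap_def)
  have "norm (recip_shift M w) \<le> norm (recip_shift M z) + norm (recip_shift M w - recip_shift M z)"
    using norm_triangle_ineq[of "recip_shift M z" "recip_shift M w - recip_shift M z"] by simp
  also have "\<dots> \<le> norm (recip_shift M z) + hyp_gap z w * (1 + hyp_gap z w) * norm (recip_shift M z)"
    using d abs_Im_le_cmod[of "recip_shift M z"]
    by (intro add_left_mono order_trans[OF norm_recip_shift_diff_le'[OF z w]] mult_left_mono) auto
  also have "\<dots> \<le> (1 + hyp_gap z w)\<^sup>2 * norm (recip_shift M z)"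
    using mult_nonneg_nonneg[OF d norm_ge_zero[of "recip_shift M z"]]
    by (simp add: power2_eq_square algebra_simps)
  finally show ?thesis .
qed

end

section \<open>Weak convergence and Cauchy transforms\<close>

lemma weak_conv_cauchy_transform:
  assumes "\<And>n. real_distribution (N n)" "real_distribution M" "weak_conv_m N M" "Im z > 0"
  shows "(\<lambda>n. cauchy_transform (N n) z) \<longlonglongrightarrow> cauchy_transform M z"
  unfolding cauchy_transform_kernel
  by (rule weak_conv_imp_integral_bdd_continuous_conv[OF assms(1-3) isCont_cauchy_kernel norm_cauchy_kernel_le])
    (use assms in auto)

lemma weak_conv_cauchy_kernel_mult:
  assumes "\<And>n. real_distribution (N n)" "real_distribution M" "weak_conv_m N M" "Im z > 0" "Im w > 0"
  shows "(\<lambda>n. \<integral>t. cauchy_kernel z t * cauchy_kernel w t \<partial>N n)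
    \<longlonglongrightarrow> (\<integral>t. cauchy_kernel z t * cauchy_kernel w t \<partial>M)"
  by (rule weak_conv_imp_integral_bdd_continuous_conv[OF assms(1-3) _ norm_cauchy_kernel_mult_le[OF assms(4,5)]])
    (intro isCont_mult isCont_cauchy_kernel assms)

context real_distribution
begin

text \<open>Dominated convergence, with the bound 1 supplied by Im w >= y. The curve w is kept
  general because the existence of the monotone convolution needs w(y) = F_nu(iy).\<close>

lemma cauchy_transform_at_top_nontangential:
  assumes "\<And>y. y > 0 \<Longrightarrow> Im (w y) \<ge> y" and lim: "((\<lambda>y. w y / (\<i> * of_real y)) \<longlongrightarrow> 1) at_top"
  shows "((\<lambda>y. (\<i> * of_real y) * cauchy_transform M (w y)) \<longlongrightarrow> 1) at_top"
proof -
  have "((\<lambda>y. \<integral>t. (\<i> * of_real y) * cauchy_kernel (w y) t \<partial>M) \<longlongrightarrow> (\<integral>t. 1 \<partial>M)) at_top"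
  proof (rule integral_dominated_convergence_at_top[where w="\<lambda>_. 1"])
    show "\<forall>\<^sub>F y in at_top. AE t in M. norm ((\<i> * of_real y) * cauchy_kernel (w y) t) \<le> 1"
      using eventually_gt_at_top[of 0]
    proof eventually_elim
      case (elim y)
      have "norm ((\<i> * of_real y) * cauchy_kernel (w y) t) \<le> 1" for t
      proof -
        have "norm (cauchy_kernel (w y) t) \<le> 1 / Im (w y)"
          using assms(1)[OF elim] elim by (intro norm_cauchy_kernel_le) auto
        also have "\<dots> \<le> 1 / y" using assms(1)[OF elim] elim by (intro divide_left_mono) auto
        finally have "y * norm (cauchy_kernel (w y) t) \<le> 1"
          using elim by (simp add: pos_le_divide_eq mult.commute)
        then show ?thesis using elim by (simp add: norm_mult)
      qed
      then show ?case by simp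
    qed
    show "AE t in M. ((\<lambda>y. (\<i> * of_real y) * cauchy_kernel (w y) t) \<longlongrightarrow> 1) at_top"
    proof (intro AE_I2)
      fix t :: real
      have "((\<lambda>y. t / y) \<longlongrightarrow> 0) at_top" by real_asymp
      from tendsto_of_real[OF this]
      have *: "((\<lambda>y. complex_of_real (t / y)) \<longlongrightarrow> of_real 0) at_top" .
      \<comment> \<open>The quotient iy/(w - t) is rewritten as 1/(w/(iy) + i t/y), in which only
        ratios with known limits occur.\<close>
      have lim1: "((\<lambda>y. 1 / (w y / (\<i> * of_real y) + \<i> * of_real (t / y))) \<longlongrightarrow> 1 / (1 + \<i> * of_real 0)) at_top"
        by (intro tendsto_divide tendsto_add tendsto_mult tendsto_const lim *) auto
      have ev: "\<forall>\<^sub>F y in at_top. 1 / (w y / (\<i> * of_real y) + \<i> * of_real (t / y))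
          = (\<i> * of_real y) * cauchy_kernel (w y) t"
        using eventually_gt_at_top[of 0]
      proof eventually_elim
        case (elim y)
        have "complex_of_real t / (\<i> * of_real y) = - \<i> * of_real (t / y)"
          using elim by (simp add: complex_eq_iff Re_divide Im_divide power2_eq_square)
        then have "w y / (\<i> * of_real y) + \<i> * of_real (t / y) = (w y - of_real t) / (\<i> * of_real y)"
          by (simp only: diff_divide_distrib) simp
        then show ?case by (simp add: cauchy_kernel_def)
      qed
      from Lim_transform_eventually[OF lim1 ev]
      show "((\<lambda>y. (\<i> * of_real y) * cauchy_kernel (w y) t) \<longlongrightarrow> 1) at_top" by simp
    qed
  qed auto
  then show ?thesis by (simp add: cauchy_transform_kernel)
qed

lemma cauchy_transform_at_top:
  "((\<lambda>y. (\<i> * of_real y) * cauchy_transform M (\<i> * of_real y)) \<longlongrightarrow> 1) at_top"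
proof (rule cauchy_transform_at_top_nontangential)
  have "\<forall>\<^sub>F y in at_top. 1 = (\<i> * complex_of_real y) / (\<i> * of_real y)"
    using eventually_gt_at_top[of 0] by eventually_elim simp
  then show "((\<lambda>y. (\<i> * complex_of_real y) / (\<i> * of_real y)) \<longlongrightarrow> 1) at_top"
    by (rule Lim_transform_eventually[OF tendsto_const])
qed simp

text \<open>Stieltjes inversion before the limit: -Im G(x + ie) integrates the Poisson kernel e/((x
  - t)^2 + e^2), whose primitive in x is an arctangent. Nonnegative integrals allow the order of
  integration to be exchanged at once.\<close>

lemma nn_integral_Im_cauchy_transform:
  assumes e: "e > 0" and ab: "a \<le> b"
  shows "(\<integral>\<^sup>+x. ennreal (- Im (cauchy_transform M (Complex x e))) * indicator {a..b} x \<partial>lborel)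
    = ennreal (\<integral>t. arctan ((b - t) / e) - arctan ((a - t) / e) \<partial>M)"
proof -
  define p where "p x t = e / ((x - t)\<^sup>2 + e\<^sup>2)" for x t :: real
  have p0: "p x t \<ge> 0" for x t using e by (simp add: p_def)
  have [measurable]: "(\<lambda>x. p (fst x) (snd x)) \<in> borel_measurable (borel \<Otimes>\<^sub>M borel)"
    unfolding p_def by measurable
  have p: "- Im (cauchy_kernel (Complex x e) t) = p x t" for x t
    by (simp add: cauchy_kernel_def Im_divide p_def power2_eq_square)
  have int_p: "integrable M (p x)" for x
  proof -
    have "p x = (\<lambda>t. - Im (cauchy_kernel (Complex x e) t))" by (simp only: p)
    then show ?thesis
      using integrable_Im[OF integrable_cauchy_kernel[of "Complex x e"]] e by simp
  qed
  have "- Im (cauchy_transform M (Complex x e)) = (\<integral>t. p x t \<partial>M)" for x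
    using integrable_cauchy_kernel[of "Complex x e"] e by (simp add: cauchy_transform_kernel p[symmetric])
  then have "ennreal (- Im (cauchy_transform M (Complex x e))) * indicator {a..b} x
      = (\<integral>\<^sup>+t. ennreal (p x t) * indicator {a..b} x \<partial>M)" for x
    using nn_integral_eq_integral[OF int_p] p0 by (cases "x \<in> {a..b}") simp_all
  then have "(\<integral>\<^sup>+x. ennreal (- Im (cauchy_transform M (Complex x e))) * indicator {a..b} x \<partial>lborel)
    = (\<integral>\<^sup>+x. \<integral>\<^sup>+t. ennreal (p x t) * indicator {a..b} x \<partial>M \<partial>lborel)" by simp
  also have "\<dots> = (\<integral>\<^sup>+t. \<integral>\<^sup>+x. ennreal (p x t) * indicator {a..b} x \<partial>lborel \<partial>M)"
  proof -
    interpret P: pair_sigma_finite lborel M ..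
    show ?thesis
      by (rule P.Fubini'[symmetric]) (simp add: split_beta', measurable)
  qed
  also have "\<dots> = (\<integral>\<^sup>+t. ennreal (arctan ((b - t) / e) - arctan ((a - t) / e)) \<partial>M)"
  proof (intro nn_integral_cong nn_integral_FTC_Icc[OF _ _ _ ab])
    fix t x :: real
    show "((\<lambda>x. arctan ((x - t) / e)) has_real_derivative p x t) (at x)"
      unfolding p_def using e
      by (auto intro!: derivative_eq_intros simp: divide_simps power2_eq_square sum_power2_eq_zero_iff)
    show "(\<lambda>x. p x t) \<in> borel_measurable borel"
      unfolding p_def by measurable
  qed (rule p0)
  also have "\<dots> = ennreal (\<integral>t. arctan ((b - t) / e) - arctan ((a - t) / e) \<partial>M)"
  proof (rule nn_integral_eq_integral)
    show "integrable M (\<lambda>t. arctan ((b - t) / e) - arctan ((a - t) / e))"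
    proof (rule integrable_bounded_cont[where B="pi"])
      show "norm (arctan ((b - t) / e) - arctan ((a - t) / e)) \<le> pi" for t
        using arctan_bounded[of "(b - t) / e"] arctan_bounded[of "(a - t) / e"] by auto
    qed auto
    show "AE t in M. 0 \<le> arctan ((b - t) / e) - arctan ((a - t) / e)"
      using ab e by (auto simp: arctan_le_iff divide_right_mono)
  qed
  finally show ?thesis .
qed

end

lemma tendsto_arctan_scaled: "(\<lambda>n. arctan (c / (1 / real (Suc n)))) \<longlonglongrightarrow> pi / 2 * sgn c"
proof -
  consider "c > 0" | "c = 0" | "c < 0" by linarith
  then show ?thesis
  proof cases
    case 1
    then have "(\<lambda>n. arctan (c * real (Suc n))) \<longlonglongrightarrow> pi / 2" by real_asymp
    with 1 show ?thesis by simp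
  next
    case 3
    then have "(\<lambda>n. arctan (c * real (Suc n))) \<longlonglongrightarrow> - pi / 2" by real_asymp
    with 3 show ?thesis by simp
  qed simp
qed

text \<open>As e tends to 0 the arctangents tend to pi/2 times a sign, so G determines the integrals
  of sgn(b - t) - sgn(a - t). A sign function treats an atom at the endpoint as half inside, hence
  two further limits lead to the distribution function.\<close>

theorem cauchy_transform_unique:
  assumes "real_distribution M" "real_distribution N"
    and eq: "\<And>z. Im z > 0 \<Longrightarrow> cauchy_transform M z = cauchy_transform N z"
  shows "M = N"
proof -
  have lim_sgn: "(\<lambda>n. \<integral>t. arctan ((b - t) / (1 / real (Suc n))) - arctan ((a - t) / (1 / real (Suc n))) \<partial>K)
      \<longlonglongrightarrow> (\<integral>t. pi / 2 * sgn (b - t) - pi / 2 * sgn (a - t) \<partial>K)" 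
    if "real_distribution K" for K a b
  proof -
    interpret real_distribution K by fact
    show ?thesis
    proof (rule integral_dominated_convergence[where w="\<lambda>_. pi"])
      show "AE t in K. norm (arctan ((b - t) / (1 / real (Suc n))) - arctan ((a - t) / (1 / real (Suc n))))
        \<le> pi" for n
      proof (intro AE_I2)
        fix t
        show "norm (arctan ((b - t) / (1 / real (Suc n))) - arctan ((a - t) / (1 / real (Suc n)))) \<le> pi"
          using arctan_bounded[of "(b - t) / (1 / real (Suc n))"] arctan_bounded[of "(a
            - t) / (1 / real (Suc n))"]
          unfolding real_norm_def by linarith
      qed
      show "AE t in K. (\<lambda>n. arctan ((b - t) / (1 / real (Suc n))) - arctan ((a - t) / (1 / real (Suc n))))
          \<longlonglongrightarrow> pi / 2 * sgn (b - t) - pi / 2 * sgn (a - t)"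
        by (intro AE_I2 tendsto_diff tendsto_arctan_scaled)
    qed auto
  qed
  have int_sgn: "integrable K (\<lambda>t. sgn (b - t))" if "real_distribution K" for K and b :: real
  proof -
    interpret real_distribution K by fact
    show ?thesis by (rule integrable_bounded_cont[where B=1]) (auto simp: sgn_if)
  qed
  have arctan_eq: "(\<integral>t. arctan ((b - t) / e) - arctan ((a - t) / e) \<partial>M)
    = (\<integral>t. arctan ((b - t) / e) - arctan ((a - t) / e) \<partial>N)"
    if "e > 0" "a \<le> b" for a b e
  proof -
    have nn: "(\<integral>t. arctan ((b - t) / e) - arctan ((a - t) / e) \<partial>K) \<ge> 0" for K
      using that by (intro integral_nonneg_AE) (auto simp: arctan_le_iff divide_right_mono)
    have "ennreal (\<integral>t. arctan ((b - t) / e) - arctan ((a - t) / e) \<partial>M)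
        = ennreal (\<integral>t. arctan ((b - t) / e) - arctan ((a - t) / e) \<partial>N)"
      using eq that
      by (simp add: real_distribution.nn_integral_Im_cauchy_transform[OF assms(1) that, symmetric]
          real_distribution.nn_integral_Im_cauchy_transform[OF assms(2) that, symmetric])
    then show ?thesis using nn by simp
  qed
  have sgn_diff: "(\<integral>t. sgn (b - t) \<partial>M) - (\<integral>t. sgn (a - t) \<partial>M) = (\<integral>t. sgn (b - t) \<partial>N) - (\<integral>t. sgn (a - t) \<partial>N)"
    if "a \<le> b" for a b :: real
  proof -
    have "(\<integral>t. pi / 2 * sgn (b - t) - pi / 2 * sgn (a - t) \<partial>M)
      = (\<integral>t. pi / 2 * sgn (b - t) - pi / 2 * sgn (a - t) \<partial>N)"
    proof (rule LIMSEQ_unique[OF lim_sgn[OF assms(1)]])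
      have "(\<integral>t. arctan ((b - t) / (1 / real (Suc n))) - arctan ((a - t) / (1 / real (Suc n))) \<partial>M)
        = (\<integral>t. arctan ((b - t) / (1 / real (Suc n))) - arctan ((a - t) / (1 / real (Suc n))) \<partial>N)" for n
        by (rule arctan_eq) (use that in auto)
      then show "(\<lambda>n. \<integral>t. arctan ((b - t) / (1 / real (Suc n))) - arctan ((a - t) / (1 / real (Suc n))) \<partial>M)
        \<longlonglongrightarrow> (\<integral>t. pi / 2 * sgn (b - t) - pi / 2 * sgn (a - t) \<partial>N)"
        using lim_sgn[OF assms(2), of b a] by presburger
    qed
    then have "pi / 2 * ((\<integral>t. sgn (b - t) \<partial>M) - (\<integral>t. sgn (a - t) \<partial>M))
        = pi / 2 * ((\<integral>t. sgn (b - t) \<partial>N) - (\<integral>t. sgn (a - t) \<partial>N))"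
      using int_sgn[OF assms(1)] int_sgn[OF assms(2)] by (simp add: right_diff_distrib)
    then show ?thesis by simp
  qed
  \<comment> \<open>Sending the left endpoint to minus infinity isolates the right one.\<close>
  have lim_minus: "(\<lambda>n. \<integral>t. sgn (- real n - t) \<partial>K) \<longlonglongrightarrow> -1" if "real_distribution K" for K
  proof -
    interpret real_distribution K by fact
    have "(\<lambda>n. \<integral>t. sgn (- real n - t) \<partial>K) \<longlonglongrightarrow> (\<integral>t. -1 \<partial>K)"
    proof (rule integral_dominated_convergence[where w="\<lambda>_. 1"])
      show "AE t in K. (\<lambda>n. sgn (- real n - t)) \<longlonglongrightarrow> -1"
      proof (intro AE_I2 tendsto_eventually)
        fix t :: real
        obtain m where "real m > - t" using reals_Archimedean2 by blast
        then show "\<forall>\<^sub>F n in sequentially. sgn (- real n - t) = -1"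
          by (intro eventually_sequentiallyI[of m]) (auto simp: sgn_if)
      qed
    qed (auto simp: sgn_if)
    then show ?thesis by simp
  qed
  have sgn_eq: "(\<integral>t. sgn (b - t) \<partial>M) = (\<integral>t. sgn (b - t) \<partial>N)" for b :: real
  proof -
    have 1: "(\<lambda>n. (\<integral>t. sgn (b - t) \<partial>M) - (\<integral>t. sgn (- real n - t) \<partial>M)) \<longlonglongrightarrow> (\<integral>t. sgn (b - t) \<partial>M) - (-1)"
      by (intro tendsto_intros lim_minus assms)
    have 2: "(\<lambda>n. (\<integral>t. sgn (b - t) \<partial>N) - (\<integral>t. sgn (- real n - t) \<partial>N)) \<longlonglongrightarrow> (\<integral>t. sgn (b - t) \<partial>N) - (-1)"
      by (intro tendsto_intros lim_minus assms)
    have 3: "\<forall>\<^sub>F n in sequentially. (\<integral>t. sgn (b - t) \<partial>N) - (\<integral>t. sgn (- real n - t) \<partial>N)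
        = (\<integral>t. sgn (b - t) \<partial>M) - (\<integral>t. sgn (- real n - t) \<partial>M)"
    proof -
      obtain m where "real m > - b" using reals_Archimedean2 by blast
      then show ?thesis by (intro eventually_sequentiallyI[of m] sgn_diff[symmetric]) auto
    qed
    have "(\<integral>t. sgn (b - t) \<partial>M) - (-1) = (\<integral>t. sgn (b - t) \<partial>N) - (-1)"
      by (rule LIMSEQ_unique[OF 1 Lim_transform_eventually[OF 2 3]])
    then show ?thesis by simp
  qed
  \<comment> \<open>Approaching b from the right counts an atom at b in full, since sgn(b + 1/(n+1)
    - t) is 1 at t = b.\<close>
  have lim_cdf: "(\<lambda>n. \<integral>t. sgn (b + 1 / real (Suc n) - t) \<partial>K) \<longlonglongrightarrow> 2 * cdf K b - 1" if "real_distribution K" for K b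
  proof -
    interpret real_distribution K by fact
    have "(\<lambda>n. \<integral>t. sgn (b + 1 / real (Suc n) - t) \<partial>K) \<longlonglongrightarrow> (\<integral>t. 2 * indicator {..b} t - 1 \<partial>K)"
    proof (rule integral_dominated_convergence[where w="\<lambda>_. 1"])
      show "AE t in K. (\<lambda>n. sgn (b + 1 / real (Suc n) - t)) \<longlonglongrightarrow> 2 * indicator {..b} t - 1"
      proof (intro AE_I2)
        fix t :: real
        show "(\<lambda>n. sgn (b + 1 / real (Suc n) - t)) \<longlonglongrightarrow> 2 * indicator {..b} t - 1"
        proof (cases "t \<le> b")
          case True
          have "sgn (b + 1 / real (Suc n) - t) = 1" for n
          proof -
            have "1 / real (Suc n) > 0" by simp
            then have "b + 1 / real (Suc n) - t > 0" using True by linarith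
            then show ?thesis by (rule sgn_pos)
          qed
          with True show ?thesis by simp
        next
          case False
          have "(\<lambda>n. b + 1 / real (Suc n) - t) \<longlonglongrightarrow> b - t" by real_asymp
          then have "\<forall>\<^sub>F n in sequentially. b + 1 / real (Suc n) - t < 0"
            using False by (intro order_tendstoD(2)[where y="b - t"]) auto
          then show ?thesis using False
            by (intro tendsto_eventually) (auto elim!: eventually_mono simp: sgn_if)
        qed
      qed
    qed (auto simp: sgn_if)
    also have "(\<integral>t. 2 * indicator {..b} t - 1 \<partial>K) = 2 * cdf K b - 1"
    proof -
      have "integrable K (indicat_real {..b})"
        by (rule integrable_bounded_cont[where B=1]) auto
      then show ?thesis by (subst Bochner_Integration.integral_diff) (auto simp: cdf_def)
    qed
    finally show ?thesis .
  qed
  have "cdf M = cdf N"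
  proof
    fix b
    show "cdf M b = cdf N b"
      using LIMSEQ_unique[OF lim_cdf[OF assms(1), of b] lim_cdf[OF assms(2), of b, folded sgn_eq]] by simp
  qed
  then show ?thesis by (rule cdf_unique[OF assms(1,2)])
qed

section \<open>Tightness and the continuity theorem for Cauchy transforms\<close>

context real_distribution
begin

text \<open>The quantity 1 + y Im G(iy) is the integral of t^2/(t^2 + y^2), and this integrand is at
  least 1/2 outside the interval; hence the factor 2.\<close>

lemma prob_tail_le:
  assumes y: "y > 0"
  shows "1 - measure M {-y<..y} \<le> 2 * (1 + y * Im (cauchy_transform M (\<i> * of_real y)))"
proof -
  have int: "integrable M (\<lambda>t. y\<^sup>2 * (norm (cauchy_kernel (\<i> * of_real y) t))\<^sup>2)"
    using y by (intro integrable_mult_right integrable_norm_cauchy_kernel) auto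
  have ind: "integrable M (indicat_real {-y<..y})"
    by (rule integrable_bounded_cont[where B=1]) auto
  have "1 - measure M {-y<..y} = (\<integral>t. 1 - indicator {-y<..y} t \<partial>M)"
    using ind by (subst Bochner_Integration.integral_diff) auto
  also have "\<dots> \<le> (\<integral>t. 2 * (1 - y\<^sup>2 * (norm (cauchy_kernel (\<i> * of_real y) t))\<^sup>2) \<partial>M)"
  proof (rule integral_mono)
    fix t
    have n: "(norm (cauchy_kernel (\<i> * of_real y) t))\<^sup>2 = 1 / (t\<^sup>2 + y\<^sup>2)"
      by (simp add: cauchy_kernel_def norm_divide power_divide cmod_power2)
    have "y\<^sup>2 / (t\<^sup>2 + y\<^sup>2) \<le> 1" using y by (simp add: divide_simps sum_power2_gt_zero_iff)
    moreover have "y\<^sup>2 / (t\<^sup>2 + y\<^sup>2) \<le> 1 / 2" if "t \<notin> {-y<..y}"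
    proof -
      have "\<bar>y\<bar> \<le> \<bar>t\<bar>" using that y by auto
      then have "y\<^sup>2 \<le> t\<^sup>2" by (simp add: abs_le_square_iff)
      then show ?thesis using y by (simp add: divide_simps sum_power2_gt_zero_iff)
    qed
    ultimately show "1 - indicator {-y<..y} t \<le> 2 * (1 - y\<^sup>2 * (norm (cauchy_kernel (\<i> * of_real y) t))\<^sup>2)"
      unfolding n by (auto split: split_indicator simp: mult.commute[of _ 2])
  qed (use int ind in \<open>auto intro!: integrable_mult_right Bochner_Integration.integrable_diff\<close>)
  also have "\<dots> = 2 * (1 + y * Im (cauchy_transform M (\<i> * of_real y)))"
    using int y by (simp add: Im_cauchy_transform power2_eq_square)
  finally show ?thesis .
qed

lemma Im_cauchy_transform_at_top: "((\<lambda>y. 1 + y * Im (cauchy_transform M (\<i> * of_real y))) \<longlongrightarrow> 0) at_top"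
proof -
  have "((\<lambda>y. 1 - Re ((\<i> * of_real y) * cauchy_transform M (\<i> * of_real y))) \<longlongrightarrow> 1 - Re 1) at_top"
    by (intro tendsto_intros cauchy_transform_at_top)
  then show ?thesis by simp
qed

end

text \<open>Convergence at a single point iy where 1 + y Im G(iy) is small already yields tightness.
  Subsequential limits are then identified by uniqueness of the transform.\<close>

theorem cauchy_transform_imp_weak_conv:
  assumes N: "\<And>n. real_distribution (N n)" and M: "real_distribution M"
    and lim: "\<And>z. Im z > 0 \<Longrightarrow> (\<lambda>n. cauchy_transform (N n) z) \<longlonglongrightarrow> cauchy_transform M z"
  shows "weak_conv_m N M"
proof (rule tight_subseq_weak_converge[OF N M])
  have ex: "\<exists>y>0. 1 + y * Im (cauchy_transform K (\<i> * of_real y)) < \<epsilon> / 2"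
    if "real_distribution K" "\<epsilon> > 0" for K \<epsilon>
  proof -
    have "\<forall>\<^sub>F y in at_top. 1 + y * Im (cauchy_transform K (\<i> * of_real y)) < \<epsilon> / 2 \<and> y > 0"
      using order_tendstoD(2)[OF real_distribution.Im_cauchy_transform_at_top[OF that(1)], of "\<epsilon> / 2"] that
      by (intro eventually_conj eventually_gt_at_top) auto
    then show ?thesis using eventually_happens'[OF trivial_limit_at_top_linorder] by blast
  qed
  show "tight N"
    unfolding tight_def
  proof (intro conjI allI impI N)
    fix \<epsilon> :: real assume \<epsilon>: "\<epsilon> > 0"
    obtain y where y: "y > 0" "1 + y * Im (cauchy_transform M (\<i> * of_real y)) < \<epsilon> / 2"
      using ex[OF M \<epsilon>] by blast
    have "(\<lambda>n. 1 + y * Im (cauchy_transform (N n) (\<i> * of_real y)))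
      \<longlonglongrightarrow> 1 + y * Im (cauchy_transform M (\<i> * of_real y))"
      using y by (intro tendsto_intros lim) auto
    from order_tendstoD(2)[OF this y(2)]
    obtain m where m: "\<And>n. n \<ge> m \<Longrightarrow> 1 + y * Im (cauchy_transform (N n) (\<i> * of_real y)) < \<epsilon> / 2"
      by (auto simp: eventually_sequentially)
    \<comment> \<open>Convergence says nothing about the first m measures. Each of them has its own
      radius, and Z below is the largest of these finitely many radii and y.\<close>
    obtain Y where Y: "\<And>n. Y n > 0" "\<And>n. 1 + Y n * Im (cauchy_transform (N n) (\<i> * of_real (Y n))) < \<epsilon> / 2"
      using ex[OF N \<epsilon>] by metis
    define Z where "Z = Max (insert y (Y ` {..<m}))"
    have Zy: "Z \<ge> y" and ZY: "\<And>n. n < m \<Longrightarrow> Z \<ge> Y n" by (auto simp: Z_def intro!: Max_ge)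
    have tail: "measure (N n) {-x<..x} > 1 - \<epsilon>"
      if "x > 0" "1 + x * Im (cauchy_transform (N n) (\<i> * of_real x)) < \<epsilon> / 2" for n x
    proof -
      have "2 * (1 + x * Im (cauchy_transform (N n) (\<i> * of_real x))) < \<epsilon>" using that(2) by simp
      then show ?thesis using real_distribution.prob_tail_le[OF N that(1), of n] by simp
    qed
    have "measure (N n) {-Z<..Z} > 1 - \<epsilon>" for n
    proof -
      interpret real_distribution "N n" by (rule N)
      define x where "x = (if n < m then Y n else y)"
      have x: "x > 0" "1 + x * Im (cauchy_transform (N n) (\<i> * of_real x)) < \<epsilon> / 2" "x \<le> Z"
        using Y m y(1) Zy ZY by (auto simp: x_def not_less)
      have "1 - \<epsilon> < measure (N n) {-x<..x}" by (rule tail[OF x(1,2)])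
      also have "\<dots> \<le> measure (N n) {-Z<..Z}" using x by (intro finite_measure_mono) auto
      finally show ?thesis .
    qed
    moreover have "- Z < Z" using Zy y by linarith
    ultimately show "\<exists>a b. a < b \<and> (\<forall>n. 1 - \<epsilon> < measure (N n) {a<..b})" by blast
  qed
next
  fix s :: "nat \<Rightarrow> nat" and \<nu> assume s: "strict_mono s" and \<nu>: "real_distribution \<nu>" and w: "weak_conv_m (N \<circ> s) \<nu>"
  have "\<nu> = M"
  proof (rule cauchy_transform_unique[OF \<nu> M])
    fix z :: complex assume z: "Im z > 0"
    have "(\<lambda>n. cauchy_transform ((N \<circ> s) n) z) \<longlonglongrightarrow> cauchy_transform \<nu> z"
      by (rule weak_conv_cauchy_transform[OF _ \<nu> w z]) (simp add: N)
    moreover have "(\<lambda>n. cauchy_transform ((N \<circ> s) n) z) \<longlonglongrightarrow> cauchy_transform M z"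
      using LIMSEQ_subseq_LIMSEQ[OF lim[OF z] s] by (simp add: o_def)
    ultimately show "cauchy_transform \<nu> z = cauchy_transform M z" by (rule LIMSEQ_unique)
  qed
  with w show "weak_conv_m (N \<circ> s) M" by simp
qed

section \<open>Functions that are Cauchy transforms\<close>

text \<open>The exact difference quotient is minus an integral of a product of two kernels, and this
  integral is continuous in w by a Lipschitz bound. That takes the place of differentiation under
  the integral.\<close>

lemma
  assumes "real_distribution M"
  shows has_field_derivative_cauchy_transform: "Im z > 0 \<Longrightarrow>
      (cauchy_transform M has_field_derivative - (\<integral>t. cauchy_kernel z t * cauchy_kernel z t \<partial>M)) (at z)"
    and holomorphic_on_cauchy_transform: "cauchy_transform M holomorphic_on {z. Im z > 0}"
proof -
  interpret real_distribution M by fact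
  show D: "(cauchy_transform M has_field_derivative - (\<integral>t. cauchy_kernel z t * cauchy_kernel z t \<partial>M)) (at z)"
    if z: "Im z > 0" for z
  proof -
    define I where "I w = (\<integral>t. cauchy_kernel w t * cauchy_kernel z t \<partial>M)" for w
    have ev: "\<forall>\<^sub>F w in at z. Im w > 0 \<and> w \<noteq> z"
    proof -
      have "((\<lambda>w. Im w) \<longlongrightarrow> Im z) (at z)" by (intro tendsto_intros)
      from order_tendstoD(1)[OF this z] show ?thesis
        by (intro eventually_conj) (auto simp: eventually_neq_at_within)
    qed
    have "((\<lambda>w. I w - I z) \<longlongrightarrow> 0) (at z)"
    proof (rule Lim_null_comparison)
      have "((\<lambda>w. norm (w - z) * (1 / Im w * (1 / Im z * (1 / Im z))))
        \<longlongrightarrow> norm (z - z) * (1 / Im z * (1 / Im z * (1 / Im z)))) (at z)"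
        using z by (intro tendsto_intros) auto
      then show "((\<lambda>w. norm (w - z) * (1 / Im w * (1 / Im z * (1 / Im z)))) \<longlongrightarrow> 0) (at z)" by simp
      show "\<forall>\<^sub>F w in at z. norm (I w - I z) \<le> norm (w - z) * (1 / Im w * (1 / Im z * (1 / Im z)))"
        using ev unfolding I_def
        by eventually_elim (intro norm_integral_cauchy_kernel_mult_diff_le z; simp)
    qed
    then have "((\<lambda>w. - I w) \<longlongrightarrow> - I z) (at z)" by (intro tendsto_minus) (rule Lim_null[THEN iffD2])
    moreover have "\<forall>\<^sub>F w in at z. - I w = (cauchy_transform M w - cauchy_transform M z) / (w - z)"
      using ev
    proof eventually_elim
      case (elim w)
      then have "Im w > 0" by blast
      from cauchy_transform_diff[OF this z] elim show ?case by (simp add: I_def field_simps)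
    qed
    ultimately show ?thesis
      unfolding has_field_derivative_iff I_def[symmetric] by (rule Lim_transform_eventually)
  qed
  show "cauchy_transform M holomorphic_on {z. Im z > 0}"
    by (rule holomorphic_onI) (auto simp: field_differentiable_def intro: D has_field_derivative_at_within)
qed

section \<open>Herglotz representation on the disc\<close>

definition unit_exp :: "real \<Rightarrow> complex" where
  "unit_exp x = exp (2 * of_real pi * \<i> * of_real x)"

lemma norm_unit_exp [simp]: "norm (unit_exp x) = 1"
  using norm_exp_i_times[of "2 * pi * x"] by (simp add: unit_exp_def mult_ac)

lemma unit_exp_nonzero [simp]: "unit_exp x \<noteq> 0"
  by (simp add: unit_exp_def)

lemma cnj_unit_exp: "cnj (unit_exp x) = 1 / unit_exp x"
  by (metis complex_norm_square norm_unit_exp nonzero_mult_div_cancel_left unit_exp_nonzero of_real_1 power_one)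

lemma continuous_on_unit_exp [continuous_intros]:
  "continuous_on A f \<Longrightarrow> continuous_on A (\<lambda>x. unit_exp (f x))"
  unfolding unit_exp_def by (intro continuous_intros)

lemma isCont_unit_exp: "isCont unit_exp x"
  using continuous_on_unit_exp[of UNIV "\<lambda>x. x"] by (simp add: continuous_on_eq_continuous_at)

lemma borel_measurable_unit_exp [measurable]: "unit_exp \<in> borel_measurable borel"
  by (intro borel_measurable_continuous_onI continuous_on_unit_exp continuous_intros)

lemma Cauchy_integral_unit_exp:
  assumes f: "f holomorphic_on cball 0 r" and r: "r > 0" and w: "norm w < r"
  shows "((\<lambda>x. f (of_real r * unit_exp x) * (of_real r * unit_exp x / (of_real r * unit_exp x
    - w))) has_integral f w) {0..1}"
proof -
  have "((\<lambda>u. f u / (u - w)) has_contour_integral (2 * of_real pi * \<i> * f w)) (circlepath 0 r)"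
    using Cauchy_integral_circlepath_simple[OF f, of w] w by simp
  then have "((\<lambda>x. f (circlepath 0 r x) / (circlepath 0 r x - w) *
      vector_derivative (circlepath 0 r) (at x within {0..1})) has_integral (2 * of_real pi * \<i> * f w)) {0..1}"
    by (simp add: has_contour_integral_def)
  then have "((\<lambda>x. (1 / (2 * of_real pi * \<i>)) * (f (circlepath 0 r x) / (circlepath 0 r x - w) *
      vector_derivative (circlepath 0 r) (at x within {0..1}))) has_integral
       (1 / (2 * of_real pi * \<i>)) * (2 * of_real pi * \<i> * f w)) {0..1}"
    by (rule has_integral_mult_right)
  moreover have "(1 / (2 * of_real pi * \<i>)) * (f (circlepath 0 r x) / (circlepath 0 r x - w) *
      vector_derivative (circlepath 0 r) (at x within {0..1}))
      = f (of_real r * unit_exp x) * (of_real r * unit_exp x / (of_real r * unit_exp x - w))"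
        if "x \<in> {0..1}" for x
  proof -
    have *: "(1 / c) * (a / b * (c * d)) = a * (d / b)" if "c \<noteq> 0" for a b c d :: complex
      using that by simp
    have vd: "vector_derivative (circlepath 0 r) (at x within {0..1})
      = (2 * of_real pi * \<i>) * (of_real r * unit_exp x)"
      using that by (simp add: vector_derivative_circlepath01 unit_exp_def)
    have cp: "circlepath 0 r x = of_real r * unit_exp x" by (simp add: circlepath unit_exp_def)
    show ?thesis unfolding vd cp by (rule *) simp
  qed
  ultimately show ?thesis
    by (subst (asm) has_integral_cong) auto
qed

text \<open>The sum of two Cauchy formulas on the circle of radius r: one for h at r \<zeta>, and
  the conjugate of one at 0 for h times a factor that turns into the same kernel. The sum of h and
  its conjugate then leaves 2 Re h under the integral.\<close>

lemma Poisson_integral_unit_exp: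
  assumes h: "h holomorphic_on ball 0 1" and r: "0 < r" "r < 1" and \<zeta>: "norm \<zeta> < 1"
  shows "((\<lambda>x. of_real (2 * Re (h (of_real r * unit_exp x))) * (unit_exp x / (unit_exp x - \<zeta>)))
    has_integral (h (of_real r * \<zeta>) + cnj (h 0))) {0..1}"
proof -
  have hr: "h holomorphic_on cball 0 r" using r by (intro holomorphic_on_subset[OF h]) auto
  have 1: "((\<lambda>x. h (of_real r * unit_exp x) * (unit_exp x / (unit_exp x
    - \<zeta>))) has_integral h (of_real r * \<zeta>)) {0..1}"
  proof -
    have *: "of_real r * unit_exp x / (of_real r * unit_exp x - of_real r * \<zeta>)
      = unit_exp x / (unit_exp x - \<zeta>)" for x
      using r by (simp add: right_diff_distrib[symmetric])
    show ?thesis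
      using Cauchy_integral_unit_exp[OF hr r(1), of "of_real r * \<zeta>"] r \<zeta>
      by (simp add: norm_mult *)
  qed
  \<comment> \<open>On |u| = r the conjugate of r/(r - cnj \<zeta> u) is e/(e - \<zeta>) with e =
    u/r, and at u = 0 the factor is 1.\<close>
  define f where "f u = h u * (of_real r / (of_real r - cnj \<zeta> * u))" for u
  have nz: "of_real r - cnj \<zeta> * u \<noteq> 0" if "norm u \<le> r" for u
  proof
    assume "of_real r - cnj \<zeta> * u = 0"
    then have "complex_of_real r = cnj \<zeta> * u" by simp
    then have "norm (complex_of_real r) = norm \<zeta> * norm u" by (simp add: norm_mult)
    also have "\<dots> \<le> norm \<zeta> * r" using that by (intro mult_left_mono) auto
    also have "\<dots> < r" using r \<zeta> by simp
    finally show False using r by simp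
  qed
  have "f holomorphic_on cball 0 r"
    unfolding f_def by (intro holomorphic_intros hr) (use nz in auto)
  from Cauchy_integral_unit_exp[OF this r(1), of 0] r
  have "((\<lambda>x. f (of_real r * unit_exp x)) has_integral h 0) {0..1}" by (simp add: f_def)
  then have "((cnj \<circ> (\<lambda>x. f (of_real r * unit_exp x))) has_integral cnj (h 0)) {0..1}"
    by (simp only: has_integral_cnj)
  moreover have "(cnj \<circ> (\<lambda>x. f (of_real r * unit_exp x))) x
     = cnj (h (of_real r * unit_exp x)) * (unit_exp x / (unit_exp x - \<zeta>))" for x
  proof -
    have "unit_exp x - \<zeta> \<noteq> 0" using \<zeta> norm_unit_exp[of x] by auto
    then have "of_real r / (of_real r - \<zeta> * (of_real r * (1 / unit_exp x))) = unit_exp x / (unit_exp x - \<zeta>)"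
      using r by (simp add: field_simps)
    then show ?thesis
      by (simp only: f_def o_def complex_cnj_mult complex_cnj_divide complex_cnj_diff complex_cnj_cnj
          complex_cnj_complex_of_real cnj_unit_exp)
  qed
  ultimately have 2: "((\<lambda>x. cnj (h (of_real r * unit_exp x)) * (unit_exp x / (unit_exp x
    - \<zeta>))) has_integral cnj (h 0)) {0..1}"
    by (simp only: o_def)
  have "((\<lambda>x. h (of_real r * unit_exp x) * (unit_exp x / (unit_exp x - \<zeta>))
      + cnj (h (of_real r * unit_exp x)) * (unit_exp x / (unit_exp x - \<zeta>))) has_integral (h (of_real r * \<zeta>)
        + cnj (h 0))) {0..1}"
    by (rule has_integral_add[OF 1 2])
  then show ?thesis by (simp only: distrib_right[symmetric] complex_add_cnj)
qed

text \<open>On circles of radius r_k the positive function Re h, divided by Re h(0), is a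
  probability density; a weak limit as r_k tends to 1 represents h. The circle is parametrised by
  [0,1] so that compactness for distributions on the line applies.\<close>

lemma herglotz_disc:
  assumes h: "h holomorphic_on ball 0 1" and pos: "\<And>\<zeta>. norm \<zeta> < 1 \<Longrightarrow> Re (h \<zeta>) > 0"
  obtains \<sigma> where "real_distribution \<sigma>"
    "\<And>\<zeta>. norm \<zeta> < 1 \<Longrightarrow> h \<zeta> + cnj (h 0) = of_real (2 * Re (h 0)) * (\<integral>x. unit_exp x / (unit_exp x - \<zeta>) \<partial>\<sigma>)"
proof -
  define s where "s = Re (h 0)"
  have s: "s > 0" using pos[of 0] by (simp add: s_def)
  define r where "r k = 1 - 1 / (real k + 2)" for k :: nat
  have r: "0 < r k" "r k < 1" for k by (auto simp: r_def field_simps)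
  have r_lim: "r \<longlonglongrightarrow> 1" unfolding r_def by real_asymp
  define p where "p k x = indicator {0..1} x * (Re (h (of_real (r k) * unit_exp x)) / s)" for k x
  have cont: "continuous_on A (\<lambda>x. h (of_real (r k) * unit_exp x))" for A k
  proof (rule continuous_on_compose2[OF holomorphic_on_imp_continuous_on[OF h]])
    show "(\<lambda>x. of_real (r k) * unit_exp x) ` A \<subseteq> ball 0 1"
      using r[of k] by (auto simp: norm_mult)
  qed (intro continuous_intros)
  have p0: "p k x \<ge> 0" for k x
    using pos[of "of_real (r k) * unit_exp x"] r[of k] s by (auto simp: p_def norm_mult split: split_indicator)
  have p_meas [measurable]: "p k \<in> borel_measurable borel" for k
    unfolding p_def
    by (intro borel_measurable_times borel_measurable_indicator borel_measurable_divide borel_measurable_Re)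
      (auto intro!: borel_measurable_continuous_onI continuous_intros cont)
  have key: "integrable lborel (\<lambda>x. p k x *\<^sub>R (unit_exp x / (unit_exp x - \<zeta>)))"
    "(\<integral>x. p k x *\<^sub>R (unit_exp x / (unit_exp x - \<zeta>)) \<partial>lborel)
      = (h (of_real (r k) * \<zeta>) + cnj (h 0)) / of_real (2 * s)"
    if \<zeta>: "norm \<zeta> < 1" for k \<zeta>
  proof -
    define q where "q x = of_real (2 * Re (h (of_real (r k) * unit_exp x))) * (unit_exp x / (unit_exp x
      - \<zeta>))" for x
    have ne: "unit_exp x \<noteq> \<zeta>" for x using \<zeta> norm_unit_exp[of x] by auto
    have "continuous_on {0..1} q" unfolding q_def using ne by (intro continuous_intros cont) auto
    then have si: "set_integrable lborel {0..1} q" by (rule borel_integrable_atLeastAtMost')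
    have "(q has_integral (h (of_real (r k) * \<zeta>) + cnj (h 0))) {0..1}"
      unfolding q_def by (rule Poisson_integral_unit_exp[OF h r \<zeta>])
    then have I: "(LINT x:{0..1}|lborel. q x) = h (of_real (r k) * \<zeta>) + cnj (h 0)"
      using set_borel_integral_eq_integral(2)[OF si] by (simp add: integral_unique)
    have eq: "p k x *\<^sub>R (unit_exp x / (unit_exp x - \<zeta>)) = (indicator {0..1} x *\<^sub>R q x) / of_real (2 * s)" for x
      using s by (auto simp: p_def q_def scaleR_conv_of_real split: split_indicator)
    show "integrable lborel (\<lambda>x. p k x *\<^sub>R (unit_exp x / (unit_exp x - \<zeta>)))"
      unfolding eq using si by (intro integrable_divide_zero) (simp add: set_integrable_def)
    show "(\<integral>x. p k x *\<^sub>R (unit_exp x / (unit_exp x - \<zeta>)) \<partial>lborel)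
      = (h (of_real (r k) * \<zeta>) + cnj (h 0)) / of_real (2 * s)"
      unfolding eq using I by (simp add: set_lebesgue_integral_def)
  qed
  have p_int: "integrable lborel (p k)" "(\<integral>x. p k x \<partial>lborel) = 1" for k
  proof -
    have "integrable lborel (\<lambda>x. complex_of_real (p k x))"
      using key(1)[of 0 k] by (simp add: scaleR_conv_of_real)
    from integrable_Re[OF this] show *: "integrable lborel (p k)" by simp
    have "complex_of_real (\<integral>x. p k x \<partial>lborel) = (\<integral>x. p k x *\<^sub>R (unit_exp x / (unit_exp x - 0)) \<partial>lborel)"
      by (simp add: scaleR_conv_of_real)
    also have "\<dots> = 1" using s by (subst key(2)) (auto simp: complex_add_cnj s_def)
    finally show "(\<integral>x. p k x \<partial>lborel) = 1" by (simp only: of_real_eq_1_iff)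
  qed
  define \<sigma> where "\<sigma> k = density lborel (\<lambda>x. ennreal (p k x))" for k
  have \<sigma>_space [simp]: "sets (\<sigma> k) = sets borel" "space (\<sigma> k) = UNIV" for k by (simp_all add: \<sigma>_def)
  have em: "emeasure (\<sigma> k) A = 1" if "A \<in> sets borel" "{0..1} \<subseteq> A" for k A
  proof -
    have "emeasure (\<sigma> k) A = (\<integral>\<^sup>+x. ennreal (p k x) * indicator A x \<partial>lborel)"
      unfolding \<sigma>_def using that by (subst emeasure_density) auto
    also have "\<dots> = (\<integral>\<^sup>+x. ennreal (p k x) \<partial>lborel)"
      using that by (intro nn_integral_cong) (auto simp: p_def split: split_indicator)
    also have "\<dots> = 1" using p_int p0 by (simp add: nn_integral_eq_integral)
    finally show ?thesis .
  qed
  have \<sigma>: "real_distribution (\<sigma> k)" for k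
    by (intro real_distribution.intro real_distribution_axioms.intro prob_spaceI) (auto simp: em)
  have "tight \<sigma>"
    unfolding tight_def
  proof (intro conjI allI impI \<sigma>)
    fix \<epsilon> :: real assume "\<epsilon> > 0"
    \<comment> \<open>The interval in the definition of tightness is open on the left, so it has to
      start below 0 to contain [0,1].\<close>
    then have "measure (\<sigma> k) {-1<..1} > 1 - \<epsilon>" for k
      using em[of "{-1<..1}" k] by (simp add: measure_def subset_eq)
    then show "\<exists>a b. a < b \<and> (\<forall>k. 1 - \<epsilon> < measure (\<sigma> k) {a<..b})"
      by (intro exI[of _ "-1"] exI[of _ 1]) simp
  qed
  from tight_imp_convergent_subsubsequence[OF this strict_mono_id]
  obtain l M where l: "strict_mono l" and M: "real_distribution M" and w: "weak_conv_m (\<sigma> \<circ> l) M" by auto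
  show ?thesis
  proof (rule that[OF M])
    fix \<zeta> :: complex assume \<zeta>: "norm \<zeta> < 1"
    have ne: "unit_exp x - \<zeta> \<noteq> 0" for x using \<zeta> norm_unit_exp[of x] by auto
    have bound: "norm (unit_exp x / (unit_exp x - \<zeta>)) \<le> 1 / (1 - norm \<zeta>)" for x
      using norm_triangle_ineq2[of "unit_exp x" \<zeta>] \<zeta> by (simp add: norm_divide frac_le)
    have A: "(\<lambda>k. \<integral>x. unit_exp x / (unit_exp x - \<zeta>) \<partial>(\<sigma> \<circ> l) k) \<longlonglongrightarrow> (\<integral>x. unit_exp x / (unit_exp x - \<zeta>) \<partial>M)"
      using ne
      by (intro weak_conv_imp_integral_bdd_continuous_conv[OF _ M w _ bound])
        (auto simp: \<sigma> intro!: continuous_intros isCont_unit_exp)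
    have B: "(\<integral>x. unit_exp x / (unit_exp x - \<zeta>) \<partial>\<sigma> k) = (h (of_real (r k) * \<zeta>)
      + cnj (h 0)) / of_real (2 * s)" for k
      unfolding \<sigma>_def using key(2)[OF \<zeta>, of k] p0 by (subst integral_density) auto
    have hc: "isCont h \<zeta>"
      using holomorphic_on_imp_continuous_on[OF h] \<zeta> by (auto simp: continuous_on_eq_continuous_at)
    have "(\<lambda>k. of_real (r (l k)) * \<zeta>) \<longlonglongrightarrow> of_real 1 * \<zeta>"
      by (intro tendsto_intros) (rule LIMSEQ_subseq_LIMSEQ[OF r_lim l, unfolded o_def])
    then have "(\<lambda>k. of_real (r (l k)) * \<zeta>) \<longlonglongrightarrow> \<zeta>" by simp
    from isCont_tendsto_compose[OF hc this]
    have "(\<lambda>k. h (of_real (r (l k)) * \<zeta>)) \<longlonglongrightarrow> h \<zeta>" .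
    then have "(\<lambda>k. (h (of_real (r (l k)) * \<zeta>) + cnj (h 0)) / of_real (2 * s))
      \<longlonglongrightarrow> (h \<zeta> + cnj (h 0)) / of_real (2 * s)"
      using s by (intro tendsto_intros) auto
    with A have "(\<integral>x. unit_exp x / (unit_exp x - \<zeta>) \<partial>M) = (h \<zeta> + cnj (h 0)) / of_real (2 * s)"
      by (simp add: B LIMSEQ_unique)
    then show "h \<zeta> + cnj (h 0) = of_real (2 * Re (h 0)) * (\<integral>x. unit_exp x / (unit_exp x - \<zeta>) \<partial>M)"
      using s by (simp add: s_def)
  qed
qed

text \<open>Under the Cayley transform the Herglotz measure on the circle becomes
  $\rho / (s (1 + t^2))$ on the line; an atom at $\infty$ is excluded, and the total mass is
  fixed, by the behaviour of $G$ along the imaginary axis.\<close>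

theorem cauchy_transform_representation:
  assumes G: "G holomorphic_on {z. Im z > 0}" and neg: "\<And>z. Im z > 0 \<Longrightarrow> Im (G z) < 0"
    and lim: "((\<lambda>y. (\<i> * of_real y) * G (\<i> * of_real y)) \<longlongrightarrow> 1) at_top"
  shows "\<exists>\<rho>. real_distribution \<rho> \<and> (\<forall>z. Im z > 0 \<longrightarrow> cauchy_transform \<rho> z = G z)"
proof -
  \<comment> \<open>The Cayley map of the disc onto the upper half-plane; \<open>\<zeta>\<close>
    below is its inverse.\<close>
  define w where "w \<zeta> = \<i> * (1 + \<zeta>) / (1 - \<zeta>)" for \<zeta>
  define h where "h \<zeta> = \<i> * G (w \<zeta>)" for \<zeta>
  have Im_w: "Im (w \<zeta>) > 0" if "norm \<zeta> < 1" for \<zeta>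
  proof -
    have "(norm \<zeta>)\<^sup>2 < 1" using that by (simp add: power_less_one_iff abs_square_less_1)
    then have *: "(Re \<zeta>)\<^sup>2 + (Im \<zeta>)\<^sup>2 < 1" by (simp add: cmod_power2)
    have "(1 - Re \<zeta>)\<^sup>2 + (Im \<zeta>)\<^sup>2 > 0"
      using that by (auto simp: sum_power2_gt_zero_iff) (metis complex_eq_iff norm_one one_complex.sel order_less_irrefl)
    with * show ?thesis
      by (simp add: w_def Im_divide) (simp add: power2_eq_square algebra_simps)
  qed
  have hol: "h holomorphic_on ball 0 1"
  proof -
    have "w holomorphic_on ball 0 1"
      unfolding w_def by (intro holomorphic_intros) (auto simp: dist_norm)
    then have "(G \<circ> w) holomorphic_on ball 0 1"
      by (rule holomorphic_on_compose_gen[OF _ G]) (use Im_w in auto)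
    then show ?thesis unfolding h_def by (intro holomorphic_intros) (simp add: o_def)
  qed
  have pos: "Re (h \<zeta>) > 0" if "norm \<zeta> < 1" for \<zeta>
    using neg[OF Im_w[OF that]] by (simp add: h_def)
  obtain \<sigma> where \<sigma>: "real_distribution \<sigma>"
    and rep: "\<And>\<zeta>. norm \<zeta> < 1 \<Longrightarrow> h \<zeta> + cnj (h 0) = of_real (2 * Re (h 0)) * (\<integral>x. unit_exp x / (unit_exp x
      - \<zeta>) \<partial>\<sigma>)"
    using herglotz_disc[OF hol pos] by blast
  interpret \<sigma>: real_distribution \<sigma> by fact
  define s where "s = Re (h 0)"
  have s: "s > 0" using pos[of 0] by (simp add: s_def)
  \<comment> \<open>The real point that corresponds to a point of the circle. At
    \<open>unit_exp x = 1\<close>, which corresponds to infinity, division by zero makes it 0; this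
    set is shown to be null below.\<close>
  define \<tau> where "\<tau> x = Re (\<i> * (1 + unit_exp x) / (1 - unit_exp x))" for x
  have [measurable]: "\<tau> \<in> borel_measurable borel" unfolding \<tau>_def by measurable
  define \<zeta> where "\<zeta> z = (z - \<i>) / (z + \<i>)" for z
  have zi: "z + \<i> \<noteq> 0" if "Im z > 0" for z using that by (auto simp: complex_eq_iff)
  have norm_\<zeta>: "norm (\<zeta> z) < 1" if "Im z > 0" for z
  proof -
    have "(norm (z - \<i>))\<^sup>2 < (norm (z + \<i>))\<^sup>2"
      using that unfolding cmod_power2 by (simp add: power2_eq_square algebra_simps)
    then show ?thesis
      using zi[OF that] by (simp add: \<zeta>_def norm_divide power_less_imp_less_base)
  qed
  have w_\<zeta>: "w (\<zeta> z) = z" if "Im z > 0" for z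
  proof -
    have "1 - \<zeta> z = 2 * \<i> / (z + \<i>)" "1 + \<zeta> z = 2 * z / (z + \<i>)"
      using zi[OF that] by (simp_all add: \<zeta>_def field_simps)
    then show ?thesis using zi[OF that] by (simp add: w_def)
  qed
  \<comment> \<open>The Herglotz kernel, scaled so that away from infinity it becomes (1 + t^2)/(z -
    t) + t - i with t = \<open>\<tau> x\<close>.\<close>
  define k where "k z x = - 2 * \<i> * (unit_exp x / (unit_exp x - \<zeta> z))" for z x
  have ne\<zeta>: "unit_exp x \<noteq> \<zeta> z" if "Im z > 0" for x z
    using norm_\<zeta>[OF that] norm_unit_exp[of x] by (metis order_less_irrefl)
  have k_int: "complex_integrable \<sigma> (k z)" if z: "Im z > 0" for z
  proof (rule \<sigma>.integrable_bounded_cont[where B="2 * (1 / (1 - norm (\<zeta> z)))"])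
    show "norm (k z t) \<le> 2 * (1 / (1 - norm (\<zeta> z)))" for t
      unfolding k_def norm_mult using norm_triangle_ineq2[of "unit_exp t" "\<zeta> z"] norm_\<zeta>[OF z]
      by (intro mult_mono) (auto simp: norm_divide frac_le)
  qed (simp add: k_def[abs_def])
  have G_rep: "G z = of_real s * (\<integral>x. k z x \<partial>\<sigma>) + (\<i> * of_real s + of_real (Im (h 0)))" if z: "Im z > 0" for z
  proof -
    have "G z = - \<i> * h (\<zeta> z)" by (simp add: h_def w_\<zeta>[OF z])
    also have "h (\<zeta> z) = of_real (2 * s) * (\<integral>x. unit_exp x / (unit_exp x - \<zeta> z) \<partial>\<sigma>) - cnj (h 0)"
      using rep[OF norm_\<zeta>[OF z]] by (simp add: s_def algebra_simps)
    also have "cnj (h 0) = of_real s - \<i> * of_real (Im (h 0))" by (simp add: complex_eq_iff s_def)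
    finally have *: "G z = - \<i> * (of_real (2 * s) * (\<integral>x. unit_exp x / (unit_exp x - \<zeta> z) \<partial>\<sigma>)
        - (of_real s - \<i> * of_real (Im (h 0))))" .
    have "(\<integral>x. k z x \<partial>\<sigma>) = - 2 * \<i> * (\<integral>x. unit_exp x / (unit_exp x - \<zeta> z) \<partial>\<sigma>)"
      unfolding k_def by (rule integral_mult_right_zero)
    then show ?thesis unfolding * by (simp add: algebra_simps)
  qed
  have k_eq: "k z x = of_real (1 + (\<tau> x)\<^sup>2) * cauchy_kernel z (\<tau> x) + of_real (\<tau> x) - \<i>"
    if z: "Im z > 0" and x: "unit_exp x \<noteq> 1" for z x
  proof -
    define e where "e = unit_exp x"
    define t where "t = \<i> * (1 + e) / (1 - e)"
    have e: "e \<noteq> 1" "e \<noteq> 0" using x by (auto simp: e_def)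
    have "cnj t = t"
    proof -
      have "cnj t = - \<i> * (1 + 1 / e) / (1 - 1 / e)" by (simp add: t_def e_def cnj_unit_exp)
      also have "\<dots> = t" using e by (simp add: t_def divide_simps) (simp add: algebra_simps)
      finally show ?thesis .
    qed
    then have t: "t = of_real (\<tau> x)"
      unfolding \<tau>_def e_def[symmetric] t_def[symmetric] by (simp add: complex_eq_iff)
    have ti: "t + \<i> \<noteq> 0" unfolding t by (simp add: complex_eq_iff)
    have zt: "z - t \<noteq> 0" unfolding t by (rule Im_pos_diff_of_real[OF z])
    have e_t: "e = (t - \<i>) / (t + \<i>)"
      using e ti by (simp add: t_def divide_simps) (simp add: algebra_simps)
    have "e - \<zeta> z = - 2 * \<i> * (z - t) / ((t + \<i>) * (z + \<i>))"
      using ti zi[OF z] by (simp add: e_t \<zeta>_def divide_simps) (simp add: algebra_simps)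
    then have "k z x = (t - \<i>) * (z + \<i>) / (z - t)"
      unfolding k_def e_def[symmetric] using ti zi[OF z] zt by (simp add: e_t)
    also have "\<dots> = (1 + t\<^sup>2) * (1 / (z - t)) + t - \<i>"
      using zt by (simp add: divide_simps) (simp add: algebra_simps power2_eq_square)
    finally show ?thesis by (simp add: t cauchy_kernel_def)
  qed
  \<comment> \<open>This function equals (1 + t^2) y^2/(t^2 + y^2) off infinity and y^2 at infinity,
    and its integral -y Im G(iy)/s tends to 1/s. Mass at infinity would make the integral unbounded;
    without it, monotone convergence in y shows that 1 + t^2 has integral 1/s.\<close>
  define f where "f y x = - y * Im (k (\<i> * of_real y) x) - y" for y x
  have f_eq: "f y x = (1 + (\<tau> x)\<^sup>2) * (y\<^sup>2 / ((\<tau> x)\<^sup>2 + y\<^sup>2))" if "y > 0" "unit_exp x \<noteq> 1" for y x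
    using that by (simp add: f_def k_eq cauchy_kernel_def Im_divide power2_eq_square algebra_simps)
  have f_eq1: "f y x = y\<^sup>2" if "y > 0" "unit_exp x = 1" for y x
  proof -
    have "1 - \<zeta> (\<i> * of_real y) = 2 * \<i> / (\<i> * of_real y + \<i>)"
      using zi[of "\<i> * of_real y"] that by (simp add: \<zeta>_def field_simps)
    then have *: "k (\<i> * of_real y) x = - (\<i> * of_real y + \<i>)" using that by (simp add: k_def)
    show ?thesis unfolding f_def * by (simp add: power2_eq_square algebra_simps)
  qed
  have f_int: "integrable \<sigma> (f y)" and f_val: "(\<integral>x. f y x \<partial>\<sigma>)
    = - y * Im (G (\<i> * of_real y)) / s" if y: "y > 0" for y
  proof -
    have ki: "integrable \<sigma> (\<lambda>x. Im (k (\<i> * of_real y) x))" using k_int[of "\<i> * of_real y"] y by simp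
    then show "integrable \<sigma> (f y)" unfolding f_def by simp
    have "(\<integral>x. f y x \<partial>\<sigma>) = - y * (\<integral>x. Im (k (\<i> * of_real y) x) \<partial>\<sigma>) - y"
      unfolding f_def using ki by simp
    also have "(\<integral>x. Im (k (\<i> * of_real y) x) \<partial>\<sigma>) = Im (\<integral>x. k (\<i> * of_real y) x \<partial>\<sigma>)"
      using k_int[of "\<i> * of_real y"] y by simp
    also have "Im (\<integral>x. k (\<i> * of_real y) x \<partial>\<sigma>) = (Im (G (\<i> * of_real y)) - s) / s"
      using G_rep[of "\<i> * of_real y"] y s by simp
    finally show "(\<integral>x. f y x \<partial>\<sigma>) = - y * Im (G (\<i> * of_real y)) / s"
      using s by (simp add: field_simps)
  qed
  have flim: "((\<lambda>y. \<integral>x. f y x \<partial>\<sigma>) \<longlongrightarrow> 1 / s) at_top"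
  proof -
    have "((\<lambda>y. Re ((\<i> * of_real y) * G (\<i> * of_real y)) / s) \<longlongrightarrow> Re 1 / s) at_top"
      using s by (intro tendsto_intros lim) auto
    moreover have "\<forall>\<^sub>F y in at_top. Re ((\<i> * of_real y) * G (\<i> * of_real y)) / s = (\<integral>x. f y x \<partial>\<sigma>)"
      using eventually_gt_at_top[of 0] by eventually_elim (simp add: f_val)
    ultimately show ?thesis by (auto intro: Lim_transform_eventually)
  qed
  have f0: "f y x \<ge> 0" if "y > 0" for x y
    by (cases "unit_exp x = 1") (simp_all add: f_eq f_eq1 that)
  define N where "N = {x. unit_exp x = 1}"
  have [measurable]: "N \<in> sets borel" unfolding N_def by measurable
  have "measure \<sigma> N = 0"
  proof -
    have bound: "measure \<sigma> N \<le> (\<integral>x. f y x \<partial>\<sigma>) / y\<^sup>2" if y: "y > 0" for y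
    proof -
      have ind: "integrable \<sigma> (indicat_real N)"
        by (rule \<sigma>.integrable_bounded_cont[where B=1]) auto
      have "y\<^sup>2 * measure \<sigma> N = (\<integral>x. y\<^sup>2 * indicator N x \<partial>\<sigma>)" by simp
      also have "\<dots> \<le> (\<integral>x. f y x \<partial>\<sigma>)"
        using ind f_int[OF y] f0[OF y] y
        by (intro integral_mono) (auto simp: N_def f_eq1 split: split_indicator)
      finally show ?thesis using y by (simp add: pos_le_divide_eq mult.commute)
    qed
    have "\<forall>\<^sub>F y in at_top. measure \<sigma> N \<le> (\<integral>x. f y x \<partial>\<sigma>) * (1 / y\<^sup>2)"
      using eventually_gt_at_top[of 0]
    proof eventually_elim
      case (elim y)
      then show ?case using bound[OF elim] by simp
    qed
    moreover have "((\<lambda>y::real. 1 / y\<^sup>2) \<longlongrightarrow> 0) at_top" by real_asymp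
    from tendsto_mult[OF flim this] have "((\<lambda>y. (\<integral>x. f y x \<partial>\<sigma>) * (1 / y\<^sup>2)) \<longlongrightarrow> 0) at_top" by simp
    ultimately have "measure \<sigma> N \<le> 0"
      using tendsto_lowerbound[of "\<lambda>y. (\<integral>x. f y x \<partial>\<sigma>) * (1 / y\<^sup>2)" 0 at_top] by auto
    then show ?thesis by (simp add: measure_le_0_iff)
  qed
  then have AE_N: "AE x in \<sigma>. unit_exp x \<noteq> 1"
    by (intro AE_I[where N=N]) (auto simp: N_def \<sigma>.emeasure_eq_measure)
  have mass: "integrable \<sigma> (\<lambda>x. 1 + (\<tau> x)\<^sup>2)" "(\<integral>x. 1 + (\<tau> x)\<^sup>2 \<partial>\<sigma>) = 1 / s"
  proof -
    define F where "F n x = f (real (Suc n)) x" for n x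
    have Fi: "integrable \<sigma> (F n)" for n unfolding F_def by (rule f_int) simp
    have Fm: "AE x in \<sigma>. mono (\<lambda>n. F n x)"
      using AE_N
    proof eventually_elim
      case (elim x)
      show ?case
      proof (rule monoI)
        fix m n :: nat assume mn: "m \<le> n"
        have "(real (Suc m))\<^sup>2 \<le> (real (Suc n))\<^sup>2" using mn by (intro power_mono) auto
        moreover have "a / (c + a) \<le> b / (c + b)" if "0 < a" "a \<le> b" "0 \<le> c" for a b c :: real
          using that by (simp add: divide_simps) (auto simp: algebra_simps intro!: mult_right_mono)
        ultimately have "(real (Suc m))\<^sup>2 / ((\<tau> x)\<^sup>2 + (real (Suc m))\<^sup>2)
          \<le> (real (Suc n))\<^sup>2 / ((\<tau> x)\<^sup>2 + (real (Suc n))\<^sup>2)"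
          by (simp del: of_nat_Suc)
        moreover have "F j x = (1 + (\<tau> x)\<^sup>2) * ((real (Suc j))\<^sup>2 / ((\<tau> x)\<^sup>2 + (real (Suc j))\<^sup>2))" for j
          unfolding F_def by (rule f_eq) (use elim in auto)
        ultimately show "F m x \<le> F n x"
          by (simp del: of_nat_Suc times_divide_eq_right add: mult_left_mono)
      qed
    qed
    have Fl: "AE x in \<sigma>. (\<lambda>n. F n x) \<longlonglongrightarrow> 1 + (\<tau> x)\<^sup>2"
      using AE_N
    proof eventually_elim
      case (elim x)
      have "(\<lambda>n. (1 + c) * ((real (Suc n))\<^sup>2 / (c + (real (Suc n))\<^sup>2))) \<longlonglongrightarrow> 1 + c" for c :: real
        by real_asymp
      then show ?case unfolding F_def by (subst f_eq) (use elim in auto)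
    qed
    have FI: "(\<lambda>n. \<integral>x. F n x \<partial>\<sigma>) \<longlonglongrightarrow> 1 / s"
      unfolding F_def
      by (rule filterlim_compose[OF flim]) (rule filterlim_compose[OF filterlim_real_sequentially filterlim_Suc])
    show "integrable \<sigma> (\<lambda>x. 1 + (\<tau> x)\<^sup>2)" "(\<integral>x. 1 + (\<tau> x)\<^sup>2 \<partial>\<sigma>) = 1 / s"
      using integrable_monotone_convergence[OF Fi Fm Fl FI] integral_monotone_convergence[OF Fi Fm Fl FI] by auto
  qed
  have \<tau>_int: "integrable \<sigma> \<tau>"
  proof (rule Bochner_Integration.integrable_bound[OF mass(1)])
    have "\<bar>t\<bar> \<le> 1 + t\<^sup>2" for t :: real
      using sum_squares_bound[of "1::real" "\<bar>t\<bar>"] by (simp add: power2_eq_square)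
    then show "AE x in \<sigma>. norm (\<tau> x) \<le> norm (1 + (\<tau> x)\<^sup>2)" by simp
  qed simp
  define D where "D = density \<sigma> (\<lambda>x. ennreal (s * (1 + (\<tau> x)\<^sup>2)))"
  define \<rho> where "\<rho> = distr D borel \<tau>"
  have D_meas: "\<tau> \<in> borel_measurable D" by (simp add: D_def)
  have emD: "emeasure D UNIV = 1"
  proof -
    have "emeasure D UNIV = (\<integral>\<^sup>+x. ennreal (s * (1 + (\<tau> x)\<^sup>2)) \<partial>\<sigma>)"
      unfolding D_def by (subst emeasure_density) auto
    also have "\<dots> = ennreal (\<integral>x. s * (1 + (\<tau> x)\<^sup>2) \<partial>\<sigma>)"
      using mass s by (intro nn_integral_eq_integral integrable_mult_right) auto
    also have "(\<integral>x. s * (1 + (\<tau> x)\<^sup>2) \<partial>\<sigma>) = 1"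
      using mass s by (subst integral_mult_right_zero) simp
    finally show ?thesis by simp
  qed
  have "prob_space D" by (rule prob_spaceI) (use emD in \<open>simp add: D_def\<close>)
  then have \<rho>: "real_distribution \<rho>"
    unfolding \<rho>_def by (intro prob_space.real_distribution_distr D_meas)
  interpret \<rho>: real_distribution \<rho> by fact
  define c where "c = s * (\<integral>x. \<tau> x \<partial>\<sigma>) + Im (h 0)"
  have G_eq: "G z = cauchy_transform \<rho> z + of_real c" if z: "Im z > 0" for z
  proof -
    have "cauchy_transform \<rho> z = (\<integral>x. cauchy_kernel z (\<tau> x) \<partial>D)"
      unfolding cauchy_transform_kernel \<rho>_def by (rule integral_distr[OF D_meas]) simp
    also have "\<dots> = (\<integral>x. (s * (1 + (\<tau> x)\<^sup>2)) *\<^sub>R cauchy_kernel z (\<tau> x) \<partial>\<sigma>)"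
      unfolding D_def using s by (intro integral_density) auto
    also have "\<dots> = of_real s * (\<integral>x. of_real (1 + (\<tau> x)\<^sup>2) * cauchy_kernel z (\<tau> x) \<partial>\<sigma>)"
      by (subst integral_mult_right_zero[symmetric]) (simp only: scaleR_conv_of_real of_real_mult mult.assoc)
    also have "(\<integral>x. of_real (1 + (\<tau> x)\<^sup>2) * cauchy_kernel z (\<tau> x) \<partial>\<sigma>) = (\<integral>x. k z x - of_real (\<tau> x) + \<i> \<partial>\<sigma>)"
    proof (rule integral_cong_AE)
      show "AE x in \<sigma>. of_real (1 + (\<tau> x)\<^sup>2) * cauchy_kernel z (\<tau> x) = k z x - of_real (\<tau> x) + \<i>"
        using AE_N
      proof eventually_elim
        case (elim x)
        then show ?case using k_eq[OF z elim] by simp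
      qed
    qed (auto simp: k_def[abs_def])
    also have "\<dots> = (\<integral>x. k z x \<partial>\<sigma>) - of_real (\<integral>x. \<tau> x \<partial>\<sigma>) + \<i>"
      using k_int[OF z] \<tau>_int by simp
    finally show ?thesis unfolding G_rep[OF z] c_def by (simp add: algebra_simps)
  qed
  \<comment> \<open>G and the Cauchy transform of \<rho> differ by the constant c, but the product
    of each with iy tends to 1.\<close>
  have "c = 0"
  proof -
    have "((\<lambda>y. ((\<i> * of_real y) * G (\<i> * of_real y) - (\<i> * of_real y) * cauchy_transform \<rho> (\<i> * of_real y))
      * of_real (1 / y))
        \<longlongrightarrow> (1 - 1) * of_real 0) at_top"
    proof (intro tendsto_mult tendsto_diff lim \<rho>.cauchy_transform_at_top tendsto_of_real)
      show "((\<lambda>y. 1 / y) \<longlongrightarrow> (0::real)) at_top" by real_asymp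
    qed
    moreover have "\<forall>\<^sub>F y in at_top. ((\<i> * of_real y) * G (\<i> * of_real y)
      - (\<i> * of_real y) * cauchy_transform \<rho> (\<i> * of_real y)) * of_real (1 / y)
      = \<i> * of_real c"
      using eventually_gt_at_top[of 0]
    proof eventually_elim
      case (elim y)
      then show ?case by (simp add: G_eq algebra_simps)
    qed
    ultimately have "((\<lambda>y::real. \<i> * of_real c) \<longlongrightarrow> (1 - 1) * of_real 0) at_top"
      by (rule Lim_transform_eventually)
    then show ?thesis by (simp add: tendsto_const_iff)
  qed
  with G_eq \<rho> show ?thesis by auto
qed

section \<open>Monotone convolution\<close>

text \<open>Gives content to the description in \<open>monotone_conv\<close>. The reciprocal of F_mu
  o F_nu is G_mu o F_nu, which is holomorphic with negative imaginary part; its behaviour at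
  infinity follows because F_nu(iy)/(iy) tends to 1.\<close>

lemma monotone_conv_ex:
  assumes \<mu>: "real_distribution \<mu>" and \<nu>: "real_distribution \<nu>"
  shows "\<exists>\<rho>. real_distribution \<rho> \<and> (\<forall>z. Im z > 0 \<longrightarrow>
    recip_cauchy_transform \<rho> z = recip_cauchy_transform \<mu> (recip_cauchy_transform \<nu> z))"
proof -
  interpret \<mu>: real_distribution \<mu> by fact
  interpret \<nu>: real_distribution \<nu> by fact
  define G where "G z = cauchy_transform \<mu> (recip_cauchy_transform \<nu> z)" for z
  have "\<exists>\<rho>. real_distribution \<rho> \<and> (\<forall>z. Im z > 0 \<longrightarrow> cauchy_transform \<rho> z = G z)"
  proof (rule cauchy_transform_representation)
    have "recip_cauchy_transform \<nu> holomorphic_on {z. Im z > 0}"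
      unfolding recip_cauchy_transform_def[abs_def]
      by (intro holomorphic_intros holomorphic_on_cauchy_transform \<nu>) (auto simp: \<nu>.cauchy_transform_nonzero)
    from holomorphic_on_compose_gen[OF this holomorphic_on_cauchy_transform[OF \<mu>]]
    show "G holomorphic_on {z. Im z > 0}"
      using \<nu>.Im_recip_cauchy_transform_pos by (auto simp: G_def[abs_def] o_def)
    show "Im (G z) < 0" if "Im z > 0" for z
      unfolding G_def by (intro \<mu>.Im_cauchy_transform_neg \<nu>.Im_recip_cauchy_transform_pos that)
    show "((\<lambda>y. (\<i> * of_real y) * G (\<i> * of_real y)) \<longlongrightarrow> 1) at_top"
      unfolding G_def
    proof (rule \<mu>.cauchy_transform_at_top_nontangential)
      show "y \<le> Im (recip_cauchy_transform \<nu> (\<i> * of_real y))" if "y > 0" for y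
        using \<nu>.Im_recip_cauchy_transform_ge[of "\<i> * of_real y"] that by simp
      have "((\<lambda>y. 1 / ((\<i> * of_real y) * cauchy_transform \<nu> (\<i> * of_real y))) \<longlongrightarrow> 1 / 1) at_top"
        by (intro tendsto_divide tendsto_const \<nu>.cauchy_transform_at_top) simp
      then show "((\<lambda>y. recip_cauchy_transform \<nu> (\<i> * of_real y) / (\<i> * of_real y)) \<longlongrightarrow> 1) at_top"
        by (simp add: recip_cauchy_transform_def mult.commute)
    qed
  qed
  then show ?thesis by (auto simp: recip_cauchy_transform_def G_def)
qed

lemma recip_cauchy_transform_unique:
  assumes "real_distribution M" "real_distribution N"
    and "\<And>z. Im z > 0 \<Longrightarrow> recip_cauchy_transform M z = recip_cauchy_transform N z"
  shows "M = N"
  using assms(3) by (intro cauchy_transform_unique assms(1,2)) (simp add: recip_cauchy_transform_def)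

lemma
  assumes "real_distribution \<mu>" "real_distribution \<nu>"
  shows real_distribution_monotone_conv: "real_distribution (monotone_conv \<mu> \<nu>)"
    and recip_cauchy_transform_monotone_conv: "\<And>z. Im z > 0 \<Longrightarrow>
      recip_cauchy_transform (monotone_conv \<mu> \<nu>) z = recip_cauchy_transform \<mu> (recip_cauchy_transform \<nu> z)"
proof -
  have "\<exists>!\<rho>. real_distribution \<rho> \<and> (\<forall>z. Im z > 0 \<longrightarrow>
    recip_cauchy_transform \<rho> z = recip_cauchy_transform \<mu> (recip_cauchy_transform \<nu> z))"
    using monotone_conv_ex[OF assms] by (auto intro: recip_cauchy_transform_unique)
  from theI'[OF this]
  show "real_distribution (monotone_conv \<mu> \<nu>)" "\<And>z. Im z > 0 \<Longrightarrow>
      recip_cauchy_transform (monotone_conv \<mu> \<nu>) z = recip_cauchy_transform \<mu> (recip_cauchy_transform \<nu> z)"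
    by (simp_all add: monotone_conv_def)
qed

lemma real_distribution_return: "real_distribution (return borel a)"
  by (intro real_distribution.intro real_distribution_axioms.intro prob_space_return) auto

lemma recip_cauchy_transform_return: "recip_cauchy_transform (return borel a) z = z - of_real a"
  by (simp add: recip_cauchy_transform_def cauchy_transform_kernel integral_return) (simp add: cauchy_kernel_def)

lemma
  assumes \<mu>: "real_distribution \<mu>"
  shows real_distribution_monotone_conv_power: "real_distribution (monotone_conv_power \<mu> n)"
    and recip_cauchy_transform_monotone_conv_power: "\<And>z. Im z > 0 \<Longrightarrow>
      recip_cauchy_transform (monotone_conv_power \<mu> n) z = (recip_cauchy_transform \<mu> ^^ n) z"
proof -
  have "real_distribution (monotone_conv_power \<mu> n) \<and> (\<forall>z. Im z > 0 \<longrightarrow>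
      recip_cauchy_transform (monotone_conv_power \<mu> n) z = (recip_cauchy_transform \<mu> ^^ n) z)"
  proof (induction n)
    case 0
    then show ?case by (simp add: real_distribution_return recip_cauchy_transform_return)
  next
    case (Suc n)
    then show ?case
      by (simp add: real_distribution_monotone_conv recip_cauchy_transform_monotone_conv \<mu>)
  qed
  then show "real_distribution (monotone_conv_power \<mu> n)" "\<And>z. Im z > 0 \<Longrightarrow>
      recip_cauchy_transform (monotone_conv_power \<mu> n) z = (recip_cauchy_transform \<mu> ^^ n) z" by auto
qed

section \<open>Dilations and iterates\<close>

context real_distribution
begin

lemma real_distribution_dilation: "real_distribution (dilation b M)"
  unfolding dilation_def by (rule real_distribution_distr) simp

lemma recip_cauchy_transform_dilation:
  assumes b: "b > 0"
  shows "recip_cauchy_transform (dilation b M) z = of_real b * recip_cauchy_transform M (z / of_real b)"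
proof -
  have "cauchy_transform (dilation b M) z = (\<integral>t. cauchy_kernel z (b * t) \<partial>M)"
    unfolding cauchy_transform_kernel dilation_def by (rule integral_distr) auto
  also have "\<dots> = (\<integral>t. (1 / of_real b) * cauchy_kernel (z / of_real b) t \<partial>M)"
    using b by (intro Bochner_Integration.integral_cong) (auto simp: cauchy_kernel_def divide_simps)
  also have "\<dots> = cauchy_transform M (z / of_real b) / of_real b"
    by (simp add: cauchy_transform_kernel)
  finally show ?thesis by (simp add: recip_cauchy_transform_def)
qed

lemma recip_shift_dilation:
  assumes b: "b > 0"
  shows "recip_shift (dilation b M) z = of_real b * recip_shift M (z / of_real b)"
  using b by (simp add: recip_shift_def recip_cauchy_transform_dilation[OF b] right_diff_distrib)

lemma Im_recip_cauchy_transform_funpow: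
  assumes "Im z > 0" "m \<le> n"
  shows "Im ((recip_cauchy_transform M ^^ m) z) \<le> Im ((recip_cauchy_transform M ^^ n) z)"
    and "Im z \<le> Im ((recip_cauchy_transform M ^^ n) z)"
proof -
  have step: "Im ((recip_cauchy_transform M ^^ n) z) \<ge> Im z" for n
  proof (induction n)
    case (Suc n)
    then have "Im ((recip_cauchy_transform M ^^ n) z) > 0" using assms by linarith
    from Im_recip_cauchy_transform_ge[OF this] Suc show ?case by simp
  qed simp
  then show "Im z \<le> Im ((recip_cauchy_transform M ^^ n) z)" .
  show "Im ((recip_cauchy_transform M ^^ m) z) \<le> Im ((recip_cauchy_transform M ^^ n) z)"
  proof (rule lift_Suc_mono_le[OF _ assms(2)])
    fix n
    have "Im ((recip_cauchy_transform M ^^ n) z) > 0" using assms step[of n] by linarith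
    from Im_recip_cauchy_transform_ge[OF this]
    show "Im ((recip_cauchy_transform M ^^ n) z) \<le> Im ((recip_cauchy_transform M ^^ Suc n) z)" by simp
  qed
qed

end

text \<open>Dilation conjugates F by a scaling, and conjugation commutes with iteration. The limit
  theorem thereby becomes a statement about the n-th iterate of the transform of the dilated
  measure.\<close>

lemma recip_cauchy_transform_dilation_power:
  assumes \<mu>: "real_distribution \<mu>" and b: "b > 0" and z: "Im z > 0"
  shows "recip_cauchy_transform (dilation b (monotone_conv_power \<mu> n)) z
    = (recip_cauchy_transform (dilation b \<mu>) ^^ n) z"
proof -
  interpret real_distribution \<mu> by fact
  have "(recip_cauchy_transform (dilation b \<mu>) ^^ n) z = of_real b
    * (recip_cauchy_transform \<mu> ^^ n) (z / of_real b)"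
    using b by (induction n) (auto simp: recip_cauchy_transform_dilation)
  moreover have "Im (z / of_real b) > 0" using z b by simp
  ultimately show ?thesis
    using real_distribution.recip_cauchy_transform_dilation[OF real_distribution_monotone_conv_power[OF \<mu>, of n] b]
      recip_cauchy_transform_monotone_conv_power[OF \<mu>] by simp
qed

section \<open>The arc-sine law\<close>

text \<open>The substitution x = sqrt 2 sin \<theta> makes the law the image of the uniform
  distribution on (-pi/2, pi/2) and removes the singularities of the density at the
  endpoints.\<close>

lemma arcsine_law_eq_distr:
  "arcsine_law = distr (density lborel (\<lambda>\<theta>. ennreal (indicator {-pi/2<..<pi/2} \<theta> / pi))) borel (\<lambda>\<theta>. sqrt 2
    * sin \<theta>)"
proof (rule measure_eqI)
  fix A assume "A \<in> sets arcsine_law"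
  then have [measurable]: "A \<in> sets borel" by (simp add: arcsine_law_def)
  define f where "f x = indicator A x * (indicator {- sqrt 2<..<sqrt 2} x * (1 / (pi * sqrt (2
    - x\<^sup>2))))" for x :: real
  have [measurable]: "f \<in> borel_measurable borel" unfolding f_def by measurable
  have "emeasure arcsine_law A = (\<integral>\<^sup>+x. ennreal (f x * indicator {- sqrt 2..sqrt 2} x) \<partial>lborel)"
    unfolding arcsine_law_def f_def
    by (subst emeasure_density) (auto intro!: nn_integral_cong split: split_indicator)
  also have "\<dots> = (\<integral>\<^sup>+x. ennreal (f (sqrt 2 * sin x) * (sqrt 2 * cos x) * indicator {-pi/2..pi/2} x) \<partial>lborel)"
  proof -
    have "(\<integral>\<^sup>+x. ennreal (f x * indicator {sqrt 2 * sin (-pi/2)..sqrt 2 * sin (pi/2)} x) \<partial>lborel)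
      = (\<integral>\<^sup>+x. ennreal (f (sqrt 2 * sin x) * (sqrt 2 * cos x) * indicator {-pi/2..pi/2} x) \<partial>lborel)"
    proof (rule nn_integral_substitution)
      show "0 \<le> sqrt 2 * cos x" if "x \<in> {-pi/2..pi/2}" for x
        using that cos_ge_zero[of x] by simp
    qed (auto intro!: derivative_eq_intros continuous_intros simp: set_borel_measurable_def)
    then show ?thesis by simp
  qed
  also have "\<dots> = (\<integral>\<^sup>+x. ennreal (indicator {-pi/2<..<pi/2} x / pi) * indicator ((\<lambda>\<theta>. sqrt 2
    * sin \<theta>) -` A) x \<partial>lborel)"
  proof (intro nn_integral_cong)
    fix x :: real
    show "ennreal (f (sqrt 2 * sin x) * (sqrt 2 * cos x) * indicator {-pi/2..pi/2} x)
      = ennreal (indicator {-pi/2<..<pi/2} x / pi) * indicator ((\<lambda>\<theta>. sqrt 2 * sin \<theta>) -` A) x"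
    proof (cases "x \<in> {-pi/2<..<pi/2}")
      case True
      then have c: "cos x > 0" using cos_gt_zero_pi[of x] by simp
      have "(sin x)\<^sup>2 < 1" using sin_cos_squared_add[of x] zero_less_power[OF c, of 2] by linarith
      then have "\<bar>sin x\<bar> < 1" by (rule iffD1[OF abs_square_less_1])
      then have s: "sqrt 2 * (-1) < sqrt 2 * sin x" "sqrt 2 * sin x < sqrt 2 * 1"
        by (intro mult_strict_left_mono; simp)+
      have "2 - (sqrt 2 * sin x)\<^sup>2 = (sqrt 2 * cos x)\<^sup>2"
        by (simp add: power_mult_distrib cos_squared_eq algebra_simps)
      then have "sqrt (2 - (sqrt 2 * sin x)\<^sup>2) = sqrt 2 * cos x"
        using c by (simp add: real_sqrt_unique)
      then have "f (sqrt 2 * sin x) * (sqrt 2 * cos x) = indicator A (sqrt 2 * sin x) / pi"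
        using c s by (simp add: f_def split: split_indicator)
      then show ?thesis using True by (simp add: indicator_def)
    next
      case False
      \<comment> \<open>Only the two endpoints are left here, and there the indicator of the open
        interval in \<open>f\<close> vanishes.\<close>
      have "f (sqrt 2 * sin x) = 0" if "x \<in> {-pi/2..pi/2}"
      proof -
        have "x = pi / 2 \<or> x = - (pi / 2)" using that False by auto
        then have "sin x = 1 \<or> sin x = -1" by (elim disjE) (simp_all only: sin_minus sin_pi_half simp_thms)
        then show ?thesis by (elim disjE) (simp_all add: f_def)
      qed
      then show ?thesis using False by (auto split: split_indicator)
    qed
  qed
  also have "\<dots> = emeasure (distr (density lborel (\<lambda>\<theta>. ennreal (indicator {-pi/2<..<pi/2} \<theta> / pi))) borel (\<lambda>\<theta>. sqrt 2 * sin \<theta>)) A"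
  proof -
    have "(\<lambda>\<theta>. sqrt 2 * sin \<theta>) -` A \<in> sets borel"
      by (rule measurable_sets_borel[of _ borel]) auto
    then show ?thesis
      by (subst emeasure_distr, simp, simp, subst emeasure_density) (auto simp: space_density)
  qed
  finally show "emeasure arcsine_law A = emeasure (distr (density lborel (\<lambda>\<theta>. ennreal (indicator {-pi/2<..<pi/2} \<theta> / pi))) borel (\<lambda>\<theta>. sqrt 2 * sin \<theta>)) A" .
qed (simp add: arcsine_law_def)

lemma real_distribution_arcsine: "real_distribution arcsine_law"
proof -
  define D where "D = density lborel (\<lambda>\<theta>. ennreal (indicator {-pi/2<..<pi/2} \<theta> / pi))"
  have "emeasure D UNIV = (\<integral>\<^sup>+\<theta>. ennreal (1 / pi) * indicator {-pi/2<..<pi/2} \<theta> \<partial>lborel)"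
    unfolding D_def by (subst emeasure_density) (auto intro!: nn_integral_cong split: split_indicator)
  also have "\<dots> = 1"
    by (subst nn_integral_cmult) (auto simp: ennreal_mult[symmetric] simp flip: ennreal_1)
  finally have "prob_space D" by (intro prob_spaceI) (simp add: D_def)
  then have "real_distribution (distr D borel (\<lambda>\<theta>. sqrt 2 * sin \<theta>))"
    by (rule prob_space.real_distribution_distr) (simp add: D_def)
  then show ?thesis unfolding arcsine_law_eq_distr D_def .
qed

lemma integral_arcsine:
  fixes g :: "real \<Rightarrow> complex"
  assumes [measurable]: "g \<in> borel_measurable borel"
  shows "(\<integral>t. g t \<partial>arcsine_law) = (LBINT \<theta>=ereal (-pi/2)..ereal (pi/2). g (sqrt 2 * sin \<theta>)) / of_real pi"
proof -
  have "(\<integral>t. g t \<partial>arcsine_law) = (\<integral>\<theta>. g (sqrt 2 * sin \<theta>) \<partial>density lborel (\<lambda>\<theta>. ennreal (indicator {-pi/2<..<pi/2} \<theta> / pi)))"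
    unfolding arcsine_law_eq_distr by (rule integral_distr) auto
  also have "\<dots> = (\<integral>\<theta>. (indicator {-pi/2<..<pi/2} \<theta> / pi) *\<^sub>R g (sqrt 2 * sin \<theta>) \<partial>lborel)"
    by (rule integral_density) auto
  also have "\<dots> = (\<integral>\<theta>. (indicator {-pi/2<..<pi/2} \<theta> *\<^sub>R g (sqrt 2 * sin \<theta>)) / of_real pi \<partial>lborel)"
    by (intro Bochner_Integration.integral_cong) (auto simp: scaleR_conv_of_real)
  also have "\<dots> = (LBINT \<theta>=ereal (-pi/2)..ereal (pi/2). g (sqrt 2 * sin \<theta>)) / of_real pi"
    by (simp add: interval_lebesgue_integral_def set_lebesgue_integral_def)
  finally show ?thesis .
qed

text \<open>The differential equation (z^2 - 2) G' = -z G. After the substitution, (2 - z t)/(z -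
  t)^2 is the derivative of sqrt 2 cos \<theta>/(z - sqrt 2 sin \<theta>), which vanishes at both
  endpoints, so its integral is zero; partial fractions in z - t give the equation.\<close>

lemma arcsine_cauchy_kernel_square:
  assumes z: "Im z > 0"
  shows "(z\<^sup>2 - 2) * (\<integral>t. cauchy_kernel z t * cauchy_kernel z t \<partial>arcsine_law)
    = z * cauchy_transform arcsine_law z"
proof -
  interpret real_distribution arcsine_law by (rule real_distribution_arcsine)
  define F where "F \<theta> = complex_of_real (sqrt 2 * cos \<theta>) / (z - of_real (sqrt 2 * sin \<theta>))" for \<theta>
  define g where "g t = (2 - z * of_real t) * (cauchy_kernel z t * cauchy_kernel z t)" for t
  have nz: "z - complex_of_real t \<noteq> 0" for t using z by (rule Im_pos_diff_of_real)
  have "continuous_on A g" for A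
    unfolding g_def by (intro continuous_intros continuous_on_cauchy_kernel z)
  then have g_cont: "continuous_on A (\<lambda>\<theta>. g (sqrt 2 * sin \<theta>))" for A
    by (rule continuous_on_compose2[where t=UNIV]) (auto intro!: continuous_intros)
  have "(LBINT \<theta>=ereal (-pi/2)..ereal (pi/2). g (sqrt 2 * sin \<theta>)) = F (pi/2) - F (-pi/2)"
  proof (rule interval_integral_FTC_finite)
    fix \<theta> :: real
    define s c where "s = complex_of_real (sin \<theta>)" and "c = complex_of_real (cos \<theta>)"
    define r where "r = complex_of_real (sqrt 2)"
    have r: "r * r = 2" unfolding r_def of_real_mult[symmetric] by simp
    have sc: "c * c = 1 - s * s"
      using sin_cos_squared_add[of \<theta>] unfolding s_def c_def power2_eq_square
      by (metis add_diff_cancel_left' of_real_1 of_real_diff of_real_mult)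
    have d: "z - r * s \<noteq> 0" using nz[of "sqrt 2 * sin \<theta>"] by (simp add: r_def s_def)
    define Fc where "Fc u = r * cos u / (z - r * sin u)" for u
    have "(Fc has_field_derivative ((- r * s) * (z - r * s) - (r * c) * (- r * c)) / ((z - r * s) * (z
      - r * s))) (at (of_real \<theta>))"
      unfolding Fc_def s_def c_def using d
      by (auto intro!: derivative_eq_intros simp: s_def sin_of_real cos_of_real)
    moreover have "F = (\<lambda>x. Fc (of_real x))"
      by (simp add: F_def Fc_def r_def sin_of_real cos_of_real fun_eq_iff)
    ultimately have "(F has_vector_derivative ((- r * s) * (z - r * s) - (r * c) * (- r * c)) / ((z
      - r * s) * (z - r * s))) (at \<theta> within {min (- pi / 2) (pi / 2)..max (- pi / 2) (pi / 2)})"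
      by (simp only: has_vector_derivative_real_field)
    also have "((- r * s) * (z - r * s) - (r * c) * (- r * c)) / ((z - r * s) * (z - r * s))
      = g (sqrt 2 * sin \<theta>)"
    proof -
      have "(- r * s) * (z - r * s) - (r * c) * (- r * c) = (r * r) * (s * s + c * c) - z * (r * s)"
        by (simp add: algebra_simps)
      also have "\<dots> = 2 - z * (r * s)" by (simp add: r sc)
      finally show ?thesis by (simp add: g_def cauchy_kernel_def r_def s_def)
    qed
    finally show "(F has_vector_derivative g (sqrt 2 * sin \<theta>)) (at \<theta> within {min (- pi / 2) (pi / 2)..max (- pi / 2) (pi / 2)})" .
  qed (rule g_cont)
  also have "\<dots> = 0" by (simp add: F_def)
  finally have "(\<integral>t. g t \<partial>arcsine_law) = 0"
    by (subst integral_arcsine) (auto simp: g_def[abs_def])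
  moreover have "g t = z * cauchy_kernel z t - (z\<^sup>2 - 2) * (cauchy_kernel z t * cauchy_kernel z t)" for t
    using nz[of t] by (simp add: g_def cauchy_kernel_def divide_simps power2_eq_square) (simp add: algebra_simps)
  ultimately show ?thesis
    using integrable_cauchy_kernel[OF z] integrable_cauchy_kernel_mult[OF z z]
    by (simp add: cauchy_transform_kernel)
qed

text \<open>By the differential equation (z^2 - 2) G^2 has derivative zero, and its behaviour along
  the imaginary axis fixes the constant. The squared form avoids the choice of a branch.\<close>

lemma cauchy_transform_arcsine:
  assumes z: "Im z > 0"
  shows "(z\<^sup>2 - 2) * (cauchy_transform arcsine_law z)\<^sup>2 = 1"
proof -
  interpret real_distribution arcsine_law by (rule real_distribution_arcsine)
  define G where "G = cauchy_transform arcsine_law"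
  define S where "S z = (\<integral>t. cauchy_kernel z t * cauchy_kernel z t \<partial>arcsine_law)" for z
  define f where "f z = (z\<^sup>2 - 2) * (G z)\<^sup>2" for z
  have "\<exists>c. \<forall>z\<in>{z. Im z > 0}. f z = c"
  proof (rule has_field_derivative_zero_constant)
    show "convex {z. Im z > 0}" by (rule convex_halfspace_Im_gt)
    fix z :: complex assume "z \<in> {z. Im z > 0}"
    then have z: "Im z > 0" by simp
    have "(f has_field_derivative (2 * z * (G z)\<^sup>2 + (z\<^sup>2 - 2) * (2 * G z * (- S z)))) (at z)"
      unfolding f_def using has_field_derivative_cauchy_transform[OF real_distribution_axioms z]
      by (auto intro!: derivative_eq_intros simp: G_def S_def)
    also have "2 * z * (G z)\<^sup>2 + (z\<^sup>2 - 2) * (2 * G z * (- S z)) = 2 * G z * (z * G z - (z\<^sup>2 - 2) * S z)"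
      by (simp add: algebra_simps power2_eq_square)
    also have "\<dots> = 0" using arcsine_cauchy_kernel_square[OF z] by (simp add: G_def S_def)
    finally show "(f has_field_derivative 0) (at z within {z. Im z > 0})"
      by (rule has_field_derivative_at_within)
  qed
  then obtain c where c: "\<And>z. Im z > 0 \<Longrightarrow> f z = c" by auto
  \<comment> \<open>At z = iy the factor z^2 - 2 is z^2 (1 + 2/y^2).\<close>
  have "((\<lambda>y. ((\<i> * of_real y) * G (\<i> * of_real y))\<^sup>2 * of_real (1 + 2 / y\<^sup>2)) \<longlongrightarrow> 1\<^sup>2 * of_real 1) at_top"
    unfolding G_def
  proof (intro tendsto_mult tendsto_power cauchy_transform_at_top tendsto_of_real)
    show "((\<lambda>y::real. 1 + 2 / y\<^sup>2) \<longlongrightarrow> 1) at_top" by real_asymp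
  qed
  moreover have "\<forall>\<^sub>F y in at_top. ((\<i> * of_real y) * G (\<i> * of_real y))\<^sup>2 * of_real (1 + 2 / y\<^sup>2) = c"
    using eventually_gt_at_top[of 0]
  proof eventually_elim
    case (elim y)
    have "c = f (\<i> * of_real y)" using elim by (intro c[symmetric]) simp
    also have "\<dots> = ((\<i> * of_real y) * G (\<i> * of_real y))\<^sup>2 * of_real (1 + 2 / y\<^sup>2)"
      using elim by (simp add: f_def power_mult_distrib field_simps)
    finally show ?case by simp
  qed
  ultimately have "((\<lambda>y::real. c) \<longlongrightarrow> 1\<^sup>2 * of_real 1) at_top" by (rule Lim_transform_eventually)
  then have "c = 1" by (simp add: tendsto_const_iff)
  with c[OF z] show ?thesis by (simp add: f_def G_def)
qed

section \<open>Iteration near the identity\<close>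

text \<open>Each step shifts the square by -2 \<epsilon> with an error of at most \<epsilon>
  \<delta>, and the errors add. The same estimate bounds the norm of the orbit, so
  \<open>bound\<close> keeps it inside the region where \<open>step\<close> applies; the induction
  carries both facts together.\<close>

lemma orbit_square_bound:
  fixes f :: "complex \<Rightarrow> complex" and \<epsilon> \<delta> R y :: real
  assumes ge: "\<And>w. Im w > 0 \<Longrightarrow> Im (f w) \<ge> Im w" and y: "y > 0" "Im z \<ge> y"
    and step: "\<And>w. Im w \<ge> y \<Longrightarrow> norm w \<le> R \<Longrightarrow> norm ((f w)\<^sup>2 - w\<^sup>2 + of_real (2 * \<epsilon>)) \<le> \<epsilon> * \<delta>"
    and bound: "(norm z)\<^sup>2 + real j * \<epsilon> * (2 + \<delta>) \<le> R\<^sup>2" and nn: "R \<ge> 0" "\<epsilon> \<ge> 0" "\<delta> \<ge> 0"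
  shows "norm (((f ^^ j) z)\<^sup>2 - z\<^sup>2 + of_real (2 * (real j * \<epsilon>))) \<le> real j * \<epsilon> * \<delta>"
proof -
  have "Im ((f ^^ i) z) \<ge> y \<and> norm (((f ^^ i) z)\<^sup>2 - z\<^sup>2 + of_real (2 * (real i * \<epsilon>))) \<le> real i * \<epsilon> * \<delta>"
    if "i \<le> j" for i
    using that
  proof (induction i)
    case 0
    then show ?case using y by simp
  next
    case (Suc i)
    define w where "w = (f ^^ i) z"
    have w: "Im w \<ge> y" "norm (w\<^sup>2 - z\<^sup>2 + of_real (2 * (real i * \<epsilon>))) \<le> real i * \<epsilon> * \<delta>"
      using Suc by (auto simp: w_def)
    have "(norm w)\<^sup>2 = norm (((w\<^sup>2 - z\<^sup>2 + of_real (2 * (real i * \<epsilon>))) + z\<^sup>2) - of_real (2 * (real i * \<epsilon>)))"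
      by (simp add: norm_power)
    also have "\<dots> \<le> norm ((w\<^sup>2 - z\<^sup>2 + of_real (2 * (real i * \<epsilon>))) + z\<^sup>2)
      + norm (of_real (2 * (real i * \<epsilon>)) :: complex)"
      by (rule norm_triangle_ineq4)
    also have "norm ((w\<^sup>2 - z\<^sup>2 + of_real (2 * (real i * \<epsilon>))) + z\<^sup>2)
        \<le> norm (w\<^sup>2 - z\<^sup>2 + of_real (2 * (real i * \<epsilon>))) + norm (z\<^sup>2)"
      by (rule norm_triangle_ineq)
    also have "norm (of_real (2 * (real i * \<epsilon>)) :: complex) = 2 * (real i * \<epsilon>)"
      using nn by (simp only: norm_of_real) simp
    also have "norm (z\<^sup>2) = (norm z)\<^sup>2" by (simp add: norm_power)
    finally have "(norm w)\<^sup>2 \<le> (norm z)\<^sup>2 + real i * \<epsilon> * (2 + \<delta>)"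
      using w(2) by (simp add: distrib_left)
    also have "\<dots> \<le> (norm z)\<^sup>2 + real j * \<epsilon> * (2 + \<delta>)"
      using Suc.prems nn by (intro add_left_mono mult_right_mono) auto
    also note bound
    finally have "norm w \<le> R" using nn(1) by (rule power2_le_imp_le)
    from step[OF w(1) this] have s: "norm ((f w)\<^sup>2 - w\<^sup>2 + of_real (2 * \<epsilon>)) \<le> \<epsilon> * \<delta>" .
    have "(f w)\<^sup>2 - z\<^sup>2 + of_real (2 * (real (Suc i) * \<epsilon>))
        = ((f w)\<^sup>2 - w\<^sup>2 + of_real (2 * \<epsilon>)) + (w\<^sup>2 - z\<^sup>2 + of_real (2 * (real i * \<epsilon>)))"
    proof -
      have "2 * (real (Suc i) * \<epsilon>) = 2 * \<epsilon> + 2 * (real i * \<epsilon>)" by (simp add: distrib_right)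
      then show ?thesis by (simp only: of_real_add) simp
    qed
    also have "norm \<dots> \<le> \<epsilon> * \<delta> + real i * \<epsilon> * \<delta>"
      by (rule norm_triangle_mono[OF s w(2)])
    also have "\<dots> = real (Suc i) * \<epsilon> * \<delta>" by (simp add: distrib_right)
    finally have "norm ((f w)\<^sup>2 - z\<^sup>2 + of_real (2 * (real (Suc i) * \<epsilon>))) \<le> real (Suc i) * \<epsilon> * \<delta>" .
    moreover have "Im (f w) \<ge> y" using ge[of w] w(1) y(1) by simp
    ultimately show ?case by (simp add: w_def)
  qed
  then show ?thesis by blast
qed

text \<open>With a common Lipschitz constant C, smallness on a finite net of mesh e/(2C) extends to
  all of K.\<close>

lemma equilipschitz_null_uniform:
  fixes d :: "nat \<Rightarrow> complex \<Rightarrow> complex"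
  assumes K: "compact K" and C: "C > 0"
    and lip: "\<forall>\<^sub>F n in sequentially. \<forall>x\<in>K. \<forall>y\<in>K. norm (d n x - d n y) \<le> C * norm (x - y)"
    and lim: "\<And>x. x \<in> K \<Longrightarrow> (\<lambda>n. d n x) \<longlonglongrightarrow> 0" and e: "e > 0"
  shows "\<forall>\<^sub>F n in sequentially. \<forall>x\<in>K. norm (d n x) < e"
proof -
  define r where "r = e / (2 * C)"
  have r: "r > 0" using e C by (simp add: r_def)
  obtain k where k: "finite k" "k \<subseteq> K" "K \<subseteq> (\<Union>x\<in>k. ball x r)"
    by (rule compactE_image[OF K, of K "\<lambda>x. ball x r"]) (use r in auto)
  have "\<forall>\<^sub>F n in sequentially. \<forall>x\<in>k. norm (d n x) < e / 2"
  proof (rule eventually_ball_finite[OF k(1)], intro ballI)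
    fix x assume "x \<in> k"
    then have "x \<in> K" using k(2) by blast
    from tendsto_norm_zero[OF lim[OF this]] have "(\<lambda>n. norm (d n x)) \<longlonglongrightarrow> 0" .
    then show "\<forall>\<^sub>F n in sequentially. norm (d n x) < e / 2" using e by (intro order_tendstoD(2)) auto
  qed
  with lip show ?thesis
  proof eventually_elim
    case (elim n)
    show ?case
    proof
      fix y assume y: "y \<in> K"
      then obtain x where x: "x \<in> k" "dist x y < r" using k(3) by auto
      have "norm (d n y - d n x) \<le> C * norm (y - x)" using elim(1) x k(2) y by blast
      also have "\<dots> < C * r" using x C by (intro mult_strict_left_mono) (auto simp: dist_norm norm_minus_commute)
      also have "\<dots> = e / 2" using C by (simp add: r_def)
      finally have "norm (d n y - d n x) < e / 2" .
      moreover have "norm (d n x) < e / 2" using elim(2) x by blast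
      ultimately show "norm (d n y) < e"
        using norm_triangle_ineq[of "d n y - d n x" "d n x"] by simp
    qed
  qed
qed

lemma hyp_gap_le:
  assumes "y > 0" "Im z \<ge> y" "Im w \<ge> y"
  shows "hyp_gap z w \<le> norm (z - w) / y"
proof -
  have "y * y \<le> Im z * Im w" using assms by (intro mult_mono) auto
  then have "y \<le> sqrt (Im z * Im w)" using assms by (intro real_le_rsqrt) (simp add: power2_eq_square)
  then show ?thesis using assms unfolding hyp_gap_def by (intro divide_left_mono) auto
qed

lemma hyp_gap_nonneg: "Im z > 0 \<Longrightarrow> Im w > 0 \<Longrightarrow> hyp_gap z w \<ge> 0"
  by (simp add: hyp_gap_def)

text \<open>Harnack carries the bound on the imaginary part from iy to the whole half-disc, and the
  two-point inequality turns this into a Lipschitz constant common to all large n. Pointwise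
  convergence then becomes uniform.\<close>

lemma recip_shift_scaled_uniform:
  fixes N :: "nat \<Rightarrow> real measure" and \<epsilon> :: "nat \<Rightarrow> real"
  assumes N: "\<And>n. real_distribution (N n)" and \<epsilon>: "\<And>n. \<epsilon> n > 0"
    and lim: "\<And>w. Im w > 0 \<Longrightarrow> (\<lambda>n. recip_shift (N n) w / of_real (\<epsilon> n)) \<longlonglongrightarrow> - 1 / w"
    and y: "y > 0" and e: "e > 0"
  shows "\<forall>\<^sub>F n in sequentially. \<forall>w. Im w \<ge> y \<longrightarrow> norm w \<le> R \<longrightarrow>
    norm (recip_shift (N n) w / of_real (\<epsilon> n) + 1 / w) < e"
proof -
  define K where "K = {w. Im w \<ge> y} \<inter> cball 0 R"
  have K: "compact K" unfolding K_def
    by (intro closed_Int_compact closed_halfspace_Im_ge compact_cball)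
  define z where "z = \<i> * of_real y"
  have z: "Im z = y" "Im z > 0" using y by (auto simp: z_def)
  define a where "a n w = recip_shift (N n) w / of_real (\<epsilon> n)" for n w
  have Im_a: "Im (a n w) = Im (recip_shift (N n) w) / \<epsilon> n" for n w by (simp add: a_def)
  \<comment> \<open>The hyperbolic gap from iy is at most (y + |R|)/y on K, and the scaled imaginary
    part at iy is eventually below its limit 1/y plus 1. In \<open>C\<close> below, M/y comes from
    the displacement and 1/(y y) from the function 1/w.\<close>
  define M where "M = (1 + (y + \<bar>R\<bar>) / y)\<^sup>2 * (1 / y + 1)"
  have M: "M > 0" using y unfolding M_def by (intro mult_pos_pos zero_less_power add_pos_nonneg) auto
  define C where "C = M / y + 1 / (y * y)"
  have C: "C > 0" using y M by (simp add: C_def add_pos_pos)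
  have "(\<lambda>n. Im (a n z)) \<longlonglongrightarrow> Im (- 1 / z)" unfolding a_def by (intro tendsto_Im lim z)
  moreover have "Im (- 1 / z) = 1 / y" using y by (simp add: z_def Im_divide power2_eq_square)
  ultimately have "\<forall>\<^sub>F n in sequentially. Im (a n z) < 1 / y + 1" by (intro order_tendstoD(2)) auto
  then have lip: "\<forall>\<^sub>F n in sequentially. \<forall>w\<in>K. \<forall>v\<in>K. norm ((a n w + 1 / w) - (a n v + 1 / v))
    \<le> C * norm (w - v)"
  proof eventually_elim
    case (elim n)
    interpret real_distribution "N n" by (rule N)
    have a_M: "Im (a n w) \<le> M" "Im (a n w) \<ge> 0" if "w \<in> K" for w
    proof -
      have w: "Im w \<ge> y" "norm w \<le> R" "Im w > 0" using that y by (auto simp: K_def)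
      have "norm (z - w) \<le> y + \<bar>R\<bar>" using norm_triangle_ineq4[of z w] w y by (simp add: z_def norm_mult)
      then have "hyp_gap z w \<le> (y + \<bar>R\<bar>) / y"
        using hyp_gap_le[OF y, of z w] z w y by (meson divide_right_mono order_refl order_trans less_imp_le eq_refl)
      then have g: "(1 + hyp_gap z w)\<^sup>2 \<le> (1 + (y + \<bar>R\<bar>) / y)\<^sup>2"
        using hyp_gap_nonneg[OF z(2) w(3)] by (intro power_mono) auto
      have "Im (a n w) \<le> (1 + hyp_gap z w)\<^sup>2 * Im (a n z)"
        unfolding Im_a using divide_right_mono[OF recip_shift_harnack[OF z(2) w(3)], of "\<epsilon> n"] \<epsilon>[of n] by simp
      also have "\<dots> \<le> M" unfolding M_def
        using elim g Im_recip_shift_nonneg[OF z(2)] \<epsilon>[of n]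
        by (intro mult_mono) (auto simp: Im_a)
      finally show "Im (a n w) \<le> M" .
      show "Im (a n w) \<ge> 0" unfolding Im_a using Im_recip_shift_nonneg[OF w(3)] \<epsilon>[of n] by simp
    qed
    show ?case
    proof (intro ballI)
      fix w v assume wv: "w \<in> K" "v \<in> K"
      then have w: "Im w \<ge> y" "Im w > 0" and v: "Im v \<ge> y" "Im v > 0" using y by (auto simp: K_def)
      have nz: "w \<noteq> 0" "v \<noteq> 0" using w v by auto
      have "norm (a n w - a n v) = norm (recip_shift (N n) w - recip_shift (N n) v) / \<epsilon> n"
        using \<epsilon>[of n] by (simp add: a_def diff_divide_distrib[symmetric] norm_divide)
      also have "\<dots> \<le> hyp_gap w v * sqrt (Im (recip_shift (N n) w) * Im (recip_shift (N n) v)) / \<epsilon> n"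
        using norm_recip_shift_diff_le[OF w(2) v(2)] \<epsilon>[of n] by (intro divide_right_mono) auto
      also have "\<dots> = hyp_gap w v * sqrt (Im (a n w) * Im (a n v))"
        unfolding Im_a using \<epsilon>[of n] by (simp add: real_sqrt_divide)
      also have "\<dots> \<le> norm (w - v) / y * M"
      proof (rule mult_mono)
        have "Im (a n w) * Im (a n v) \<le> M * M" using a_M wv M by (intro mult_mono) auto
        then show "sqrt (Im (a n w) * Im (a n v)) \<le> M"
          using M by (intro real_le_lsqrt) (auto simp: power2_eq_square intro: mult_nonneg_nonneg a_M wv)
      qed (use hyp_gap_le[OF y w(1) v(1)] y a_M wv in auto)
      finally have 1: "norm (a n w - a n v) \<le> M / y * norm (w - v)" by (simp add: mult.commute)
      have "norm (1 / w - 1 / v) = norm (w - v) / (norm w * norm v)"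
        using nz by (simp add: diff_frac_eq norm_divide norm_mult norm_minus_commute)
      also have "\<dots> \<le> norm (w - v) / (y * y)"
      proof (rule divide_left_mono)
        show "y * y \<le> norm w * norm v"
          using w(1) v(1) y abs_Im_le_cmod[of w] abs_Im_le_cmod[of v] by (intro mult_mono) auto
      qed (use nz y in auto)
      finally have 2: "norm (1 / w - 1 / v) \<le> 1 / (y * y) * norm (w - v)" by simp
      have "(a n w + 1 / w) - (a n v + 1 / v) = (a n w - a n v) + (1 / w - 1 / v)" by simp
      also have "norm \<dots> \<le> M / y * norm (w - v) + 1 / (y * y) * norm (w - v)"
        by (intro norm_triangle_mono 1 2)
      finally show "norm ((a n w + 1 / w) - (a n v + 1 / v)) \<le> C * norm (w - v)"
        by (simp add: C_def algebra_simps)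
    qed
  qed
  have "(\<lambda>n. a n w + 1 / w) \<longlonglongrightarrow> 0" if "w \<in> K" for w
  proof -
    have "(\<lambda>n. a n w + 1 / w) \<longlonglongrightarrow> - 1 / w + 1 / w"
      unfolding a_def using that y by (intro tendsto_add tendsto_const lim) (auto simp: K_def)
    then show ?thesis by simp
  qed
  from equilipschitz_null_uniform[OF K C lip this e] show ?thesis
    by (rule eventually_mono) (auto simp: K_def a_def)
qed

text \<open>If A = \<epsilon> (d - 1/w) with d small, then (w + A)^2 - w^2 = 2 w A + A^2 is -2
  \<epsilon> + o(\<epsilon>). Over j n steps the errors sum to at most S \<delta>. The count j is an
  arbitrary sequence because the converse direction runs this for a count that may stop before
  n.\<close>

theorem iterate_square_tendsto:
  fixes N :: "nat \<Rightarrow> real measure" and \<epsilon> :: "nat \<Rightarrow> real" and j :: "nat \<Rightarrow> nat"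
  assumes N: "\<And>n. real_distribution (N n)" and \<epsilon>: "\<And>n. \<epsilon> n > 0" and \<epsilon>0: "\<epsilon> \<longlonglongrightarrow> 0"
    and lim: "\<And>w. Im w > 0 \<Longrightarrow> (\<lambda>n. recip_shift (N n) w / of_real (\<epsilon> n)) \<longlonglongrightarrow> - 1 / w"
    and S: "\<And>n. real (j n) * \<epsilon> n \<le> S" and z: "Im z > 0"
  shows "(\<lambda>n. ((recip_cauchy_transform (N n) ^^ j n) z)\<^sup>2 - z\<^sup>2 + of_real (2 * (real (j n) * \<epsilon> n))) \<longlonglongrightarrow> 0"
proof (rule tendstoI)
  fix e :: real assume e: "e > 0"
  have S0: "S \<ge> 0" using S[of 0] \<epsilon>[of 0] by (meson mult_nonneg_nonneg of_nat_0_le_iff order_trans less_imp_le)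
  define \<delta> where "\<delta> = min 1 (e / (2 * (S + 1)))"
  have \<delta>: "\<delta> > 0" "\<delta> \<le> 1" using e S0 by (auto simp: \<delta>_def)
  have S\<delta>: "S * \<delta> < e"
  proof -
    have "S * \<delta> \<le> S * (e / (2 * (S + 1)))" using S0 by (intro mult_left_mono) (auto simp: \<delta>_def)
    also have "\<dots> = e * (S / (2 * (S + 1)))" by simp
    also have "\<dots> < e * 1" using e S0 by (intro mult_strict_left_mono) (auto simp: divide_simps)
    finally show ?thesis by simp
  qed
  define y where "y = Im z"
  have y: "y > 0" using z by (simp add: y_def)
  \<comment> \<open>Large enough for the orbit: its squared norm stays below |z|^2 + S (2 +
    \<delta>), and \<delta> <= 1.\<close>
  define R where "R = sqrt ((norm z)\<^sup>2 + S * 3) + 1"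
  have R: "R > 0" "(norm z)\<^sup>2 + S * 3 \<le> R\<^sup>2"
  proof -
    have q: "sqrt ((norm z)\<^sup>2 + S * 3) \<ge> 0" using S0 by simp
    then show "R > 0" unfolding R_def by linarith
    have "(norm z)\<^sup>2 + S * 3 = (sqrt ((norm z)\<^sup>2 + S * 3))\<^sup>2" using S0 by simp
    also have "\<dots> \<le> R\<^sup>2" using q by (intro power_mono) (auto simp: R_def)
    finally show "(norm z)\<^sup>2 + S * 3 \<le> R\<^sup>2" .
  qed
  \<comment> \<open>The linear error 2 w d and the quadratic term \<epsilon> (d - 1/w)^2 are each
    allotted \<delta>/2; this value settles the linear one.\<close>
  define e1 where "e1 = min 1 (\<delta> / (4 * R))"
  have e1: "e1 > 0" "e1 \<le> 1" "2 * R * e1 \<le> \<delta> / 2"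
  proof -
    show "e1 > 0" "e1 \<le> 1" using \<delta> R by (auto simp: e1_def)
    have "2 * R * e1 \<le> 2 * R * (\<delta> / (4 * R))" using R by (intro mult_left_mono) (auto simp: e1_def)
    then show "2 * R * e1 \<le> \<delta> / 2" using R by simp
  qed
  have ev1: "\<forall>\<^sub>F n in sequentially. \<forall>w. Im w \<ge> y \<longrightarrow> norm w \<le> R \<longrightarrow>
      norm (recip_shift (N n) w / of_real (\<epsilon> n) + 1 / w) < e1"
    by (rule recip_shift_scaled_uniform[OF N \<epsilon> lim y e1(1)])
  have "\<forall>\<^sub>F n in sequentially. \<epsilon> n < (\<delta> / 2) / (1 / y + 1)\<^sup>2"
  proof (rule order_tendstoD(2)[OF \<epsilon>0])
    have "1 / y + 1 > 0" using y by (simp add: add_pos_pos)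
    then show "0 < (\<delta> / 2) / (1 / y + 1)\<^sup>2" using \<delta> by simp
  qed
  with ev1 show "\<forall>\<^sub>F n in sequentially. dist (((recip_cauchy_transform (N n) ^^ j n) z)\<^sup>2 - z\<^sup>2
    + of_real (2 * (real (j n) * \<epsilon> n))) 0 < e"
  proof eventually_elim
    case (elim n)
    interpret real_distribution "N n" by (rule N)
    define f where "f = recip_cauchy_transform (N n)"
    have "norm (((f ^^ j n) z)\<^sup>2 - z\<^sup>2 + of_real (2 * (real (j n) * \<epsilon> n))) \<le> real (j n) * \<epsilon> n * \<delta>"
    proof (rule orbit_square_bound[where y=y and R=R])
      show "Im (f w) \<ge> Im w" if "Im w > 0" for w
        unfolding f_def by (rule Im_recip_cauchy_transform_ge[OF that])
      show "y > 0" by (rule y)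
      show "Im z \<ge> y" by (simp add: y_def)
      show "R \<ge> 0" "\<epsilon> n \<ge> 0" "\<delta> \<ge> 0" using R \<epsilon>[of n] \<delta> by auto
      have "real (j n) * \<epsilon> n * (2 + \<delta>) \<le> S * 3"
        using S[of n] S0 \<delta> by (intro mult_mono) auto
      then show "(norm z)\<^sup>2 + real (j n) * \<epsilon> n * (2 + \<delta>) \<le> R\<^sup>2" using R(2) by linarith
      fix w assume w: "Im w \<ge> y" "norm w \<le> R"
      define d where "d = recip_shift (N n) w / of_real (\<epsilon> n) + 1 / w"
      have d: "norm d < e1" using elim(1) w by (auto simp: d_def)
      have nz: "w \<noteq> 0" using w y by auto
      have ny: "norm (1 / w) \<le> 1 / y"
        using abs_Im_le_cmod[of w] w y by (simp add: norm_divide frac_le)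
      have A: "recip_shift (N n) w = of_real (\<epsilon> n) * (d - 1 / w)" using \<epsilon>[of n] by (simp add: d_def)
      have "(f w)\<^sup>2 - w\<^sup>2 + of_real (2 * \<epsilon> n) = of_real (\<epsilon> n) * (2 * w * d + of_real (\<epsilon> n) * (d - 1 / w)\<^sup>2)"
      proof -
        have "f w = w + of_real (\<epsilon> n) * (d - 1 / w)"
          using A by (simp add: f_def recip_shift_def algebra_simps)
        moreover have "w * (1 / w) = 1" using nz by simp
        then have "(w + E * (d - 1 / w))\<^sup>2 - w\<^sup>2 + 2 * E = E * (2 * w * d + E * (d - 1 / w)\<^sup>2)" for E
          by algebra
        ultimately show ?thesis by simp
      qed
      also have "norm \<dots> \<le> \<epsilon> n * (\<delta> / 2 + \<delta> / 2)"
        unfolding norm_mult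
      proof (rule mult_mono)
        show "norm (2 * w * d + of_real (\<epsilon> n) * (d - 1 / w)\<^sup>2) \<le> \<delta> / 2 + \<delta> / 2"
        proof (rule norm_triangle_mono)
          have "norm (2 * w * d) \<le> 2 * R * e1" unfolding norm_mult using w d R by (intro mult_mono) auto
          then show "norm (2 * w * d) \<le> \<delta> / 2" using e1(3) by linarith
          have "norm (d - 1 / w) \<le> 1 / y + 1" using norm_triangle_ineq4[of d "1 / w"] d e1(2) ny by linarith
          then have "\<epsilon> n * (norm (d - 1 / w))\<^sup>2 \<le> \<epsilon> n * (1 / y + 1)\<^sup>2"
            using \<epsilon>[of n] by (intro mult_left_mono power_mono) auto
          also have "\<dots> \<le> \<delta> / 2"
          proof -
            have "1 / y + 1 > 0" using y by (simp add: add_pos_pos)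
            from zero_less_power[OF this, of 2] elim(2) show ?thesis by (simp add: pos_less_divide_eq)
          qed
          finally show "norm (of_real (\<epsilon> n) * (d - 1 / w)\<^sup>2) \<le> \<delta> / 2"
            using \<epsilon>[of n] by (simp add: norm_mult norm_power)
        qed
      qed (use \<epsilon>[of n] in auto)
      finally show "norm ((f w)\<^sup>2 - w\<^sup>2 + of_real (2 * \<epsilon> n)) \<le> \<epsilon> n * \<delta>" by simp
    qed
    also have "\<dots> \<le> S * \<delta>" using S[of n] \<delta> by (intro mult_right_mono) auto
    also note S\<delta>
    finally show ?case by (simp add: f_def)
  qed
qed

section \<open>Truncated moments\<close>

definition truncated_tail_moment :: "real measure \<Rightarrow> real \<Rightarrow> real" where
  "truncated_tail_moment M x = (\<integral>t. \<bar>t\<bar> * indicator {t. \<bar>t\<bar> > x} t \<partial>M)"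

text \<open>A smooth companion of H_mu: for y > 0 it equals 1 + y Im G(iy), so it can be read off
  from the transform, and after multiplication by y^2 it is comparable to the truncated second
  moment at y.\<close>

definition smoothed_ratio :: "real measure \<Rightarrow> real \<Rightarrow> real" where
  "smoothed_ratio M y = (\<integral>t. t\<^sup>2 / (t\<^sup>2 + y\<^sup>2) \<partial>M)"

lemma slowly_varying_doubling:
  assumes "slowly_varying f" "e > 0"
  obtains x0 where "x0 > 0" "\<And>u. u \<ge> x0 \<Longrightarrow> f (2 * u) \<le> (1 + e) * f u" "\<And>u. u \<ge> x0 \<Longrightarrow> f u > 0"
proof -
  have pos: "\<forall>\<^sub>F x in at_top. f x > 0" and lim: "((\<lambda>x. f (2 * x) / f x) \<longlongrightarrow> 1) at_top"
    using assms by (auto simp: slowly_varying_def)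
  have "\<forall>\<^sub>F x in at_top. f (2 * x) / f x < 1 + e"
    using lim by (rule order_tendstoD(2)) (use assms in simp)
  with pos have "\<forall>\<^sub>F x in at_top. f (2 * x) \<le> (1 + e) * f x \<and> f x > 0"
  proof eventually_elim
    case (elim x)
    then show ?case by (simp add: pos_divide_less_eq)
  qed
  then obtain x1 where "\<And>u. u \<ge> x1 \<Longrightarrow> f (2 * u) \<le> (1 + e) * f u \<and> f u > 0"
    by (auto simp: eventually_at_top_linorder)
  then show ?thesis by (intro that[of "max x1 1"]) auto
qed

context real_distribution
begin

lemma truncated_second_moment_eq: "truncated_second_moment M x = (\<integral>t. t\<^sup>2 * indicator {-x..x} t \<partial>M)"
  by (simp add: truncated_second_moment_def set_lebesgue_integral_def mult.commute)

lemma integrable_truncated_square: "integrable M (\<lambda>t. t\<^sup>2 * indicator {-x..x} t)"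
proof (rule integrable_bounded_cont[where B="x\<^sup>2"])
  show "norm (t\<^sup>2 * indicator {-x..x} t) \<le> x\<^sup>2" for t
  proof (cases "t \<in> {-x..x}")
    case True
    then have "\<bar>t\<bar> \<le> \<bar>x\<bar>" by auto
    then show ?thesis using True by (simp add: abs_le_square_iff)
  qed simp
qed auto

lemma truncated_second_moment_mono: "x \<le> y \<Longrightarrow> truncated_second_moment M x \<le> truncated_second_moment M y"
  unfolding truncated_second_moment_eq
  by (intro integral_mono integrable_truncated_square) (auto split: split_indicator)

lemma truncated_second_moment_nonneg: "truncated_second_moment M x \<ge> 0"
  unfolding truncated_second_moment_eq by (intro integral_nonneg_AE) auto

lemma truncated_second_moment_measurable:
  "set_borel_measurable borel {0..} (truncated_second_moment M)"
proof -
  have "truncated_second_moment M \<in> borel_measurable borel"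
    by (rule borel_measurable_mono) (simp add: mono_def truncated_second_moment_mono)
  then show ?thesis by (simp add: set_borel_measurable_def)
qed

text \<open>Dyadic summation: on x < |t| <= 2x one has |t| <= t^2/x, so this shell contributes at
  most (H(2x) - H(x))/x <= e H(x)/x, and the remainder is the same problem at 2x.\<close>

lemma truncated_tail_moment_bound:
  fixes x0 e :: real
  assumes e: "e \<ge> 0" "e \<le> 1 / 2" and x0: "x0 > 0"
    and dbl: "\<And>u. u \<ge> x0 \<Longrightarrow> truncated_second_moment M (2 * u) \<le> (1 + e) * truncated_second_moment M u"
    and x: "x \<ge> x0"
  shows "integrable M (\<lambda>t. \<bar>t\<bar> * indicator {t. \<bar>t\<bar> > x} t)"
    and "truncated_tail_moment M x \<le> 4 * e * (truncated_second_moment M x / x)"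
proof -
  define H where "H = truncated_second_moment M"
  \<comment> \<open>Cutting off at 2^n x makes every integral finite; the induction on n needs x
    arbitrary since the starting point doubles. Monotone convergence removes the cut-off at the
    end.\<close>
  define f where "f n x t = \<bar>t\<bar> * indicator {t. x < \<bar>t\<bar> \<and> \<bar>t\<bar> \<le> 2 ^ n * x} t" for n :: nat and x t :: real
  have f_meas [measurable]: "f n x \<in> borel_measurable borel" for n x unfolding f_def by measurable
  have f_int: "integrable M (f n x)" for n x
    by (rule integrable_bounded_cont[where B="\<bar>2 ^ n * x\<bar>"]) (auto simp: f_def split: split_indicator)
  have bnd: "(\<integral>t. f n x t \<partial>M) \<le> 4 * e * (H x / x)" if "x \<ge> x0" for n x
    using that
  proof (induction n arbitrary: x)
    case 0
    have "f 0 x = (\<lambda>t. 0)" by (auto simp: f_def fun_eq_iff split: split_indicator)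
    then show ?case using 0 x0 e truncated_second_moment_nonneg[of x] by (simp add: H_def)
  next
    case (Suc n)
    have xpos: "x > 0" using Suc.prems x0 by simp
    have "(\<integral>t. f (Suc n) x t \<partial>M)
        \<le> (\<integral>t. (t\<^sup>2 * indicator {-(2*x)..2*x} t - t\<^sup>2 * indicator {-x..x} t) / x + f n (2 * x) t \<partial>M)"
    proof (rule integral_mono)
      fix t :: real
      have sq: "\<bar>t\<bar> \<le> t\<^sup>2 / x" if "x < \<bar>t\<bar>"
      proof -
        have "\<bar>t\<bar> * x \<le> \<bar>t\<bar> * \<bar>t\<bar>" using that by (intro mult_left_mono) auto
        then show ?thesis using xpos by (simp add: pos_le_divide_eq power2_eq_square)
      qed
      consider "\<bar>t\<bar> \<le> x" | "x < \<bar>t\<bar>" "\<bar>t\<bar> \<le> 2 * x" | "2 * x < \<bar>t\<bar>" by linarith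
      then show "f (Suc n) x t \<le> (t\<^sup>2 * indicator {-(2*x)..2*x} t - t\<^sup>2 * indicator {-x..x} t) / x
        + f n (2 * x) t"
      proof cases
        case 1
        then show ?thesis using xpos by (auto simp: f_def split: split_indicator)
      next
        case 2
        then have "f (Suc n) x t \<le> \<bar>t\<bar>" by (auto simp: f_def split: split_indicator)
        also have "\<dots> \<le> t\<^sup>2 / x" by (rule sq[OF 2(1)])
        also have "\<dots> = (t\<^sup>2 * indicator {-(2*x)..2*x} t - t\<^sup>2 * indicator {-x..x} t) / x"
          using 2 by (auto split: split_indicator)
        finally show ?thesis using 2 by (simp add: f_def)
      next
        case 3
        then show ?thesis using xpos
          by (auto simp: f_def mult_ac split: split_indicator)
      qed
    qed (intro f_int integrable_truncated_square Bochner_Integration.integrable_add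
        Bochner_Integration.integrable_diff integrable_divide_zero)+
    also have "\<dots> = (H (2 * x) - H x) / x + (\<integral>t. f n (2 * x) t \<partial>M)"
      using f_int[of n "2 * x"] integrable_truncated_square[of x] integrable_truncated_square[of "2 * x"]
      by (simp add: H_def truncated_second_moment_eq)
    also have "(\<integral>t. f n (2 * x) t \<partial>M) \<le> 4 * e * (H (2 * x) / (2 * x))"
      using Suc.prems xpos by (intro Suc.IH) auto
    \<comment> \<open>The constant 4 closes the induction: in units of H(x)/x the shell costs at
      most e, and the part beyond 2x at most 2e(1 + e) <= 3e because e <= 1/2.\<close>
    also have "(H (2 * x) - H x) / x + 4 * e * (H (2 * x) / (2 * x)) \<le> 4 * e * (H x / x)"
    proof -
      have d: "H (2 * x) \<le> (1 + e) * H x" unfolding H_def by (rule dbl[OF Suc.prems])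
      have H0: "H x \<ge> 0" unfolding H_def by (rule truncated_second_moment_nonneg)
      have "2 * e * H (2 * x) \<le> 2 * e * ((1 + e) * H x)" using d e by (intro mult_left_mono) auto
      also have "\<dots> \<le> 3 * e * H x"
      proof -
        have "e * e \<le> e * (1 / 2)" using e by (intro mult_left_mono) auto
        then have "(e * e) * H x \<le> (e * (1 / 2)) * H x" using H0 by (rule mult_right_mono)
        then show ?thesis by (simp add: algebra_simps)
      qed
      finally have "H (2 * x) - H x + 2 * e * H (2 * x) \<le> 4 * e * H x" using d by (simp add: algebra_simps)
      then have "(H (2 * x) - H x + 2 * e * H (2 * x)) / x \<le> (4 * e * H x) / x"
        using xpos by (intro divide_right_mono) auto
      then show ?thesis using xpos by (simp add: add_divide_distrib)
    qed
    finally show ?case by simp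
  qed
  have inc: "f m x t \<le> f n x t" if "m \<le> n" for m n t
  proof -
    have "(2::real) ^ m * x \<le> 2 ^ n * x" using that x x0 by (intro mult_right_mono power_increasing) auto
    then show ?thesis by (auto simp: f_def split: split_indicator)
  qed
  have "incseq (\<lambda>n. \<integral>t. f n x t \<partial>M)"
    unfolding incseq_def by (auto intro!: integral_mono f_int inc)
  then obtain L where L: "(\<lambda>n. \<integral>t. f n x t \<partial>M) \<longlonglongrightarrow> L"
    using incseq_convergent[of "\<lambda>n. \<integral>t. f n x t \<partial>M" "4 * e * (H x / x)"] bnd[OF x] by blast
  have lim: "AE t in M. (\<lambda>n. f n x t) \<longlonglongrightarrow> \<bar>t\<bar> * indicator {t. \<bar>t\<bar> > x} t"
  proof (intro AE_I2 tendsto_eventually)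
    fix t
    obtain m where m: "\<bar>t\<bar> / x < 2 ^ m" using real_arch_pow[of 2 "\<bar>t\<bar> / x"] by auto
    have "f n x t = \<bar>t\<bar> * indicator {t. \<bar>t\<bar> > x} t" if "n \<ge> m" for n
    proof -
      have "(2::real) ^ m \<le> 2 ^ n" using that by (intro power_increasing) auto
      with m have "\<bar>t\<bar> / x < 2 ^ n" by (rule less_le_trans)
      then have "\<bar>t\<bar> \<le> 2 ^ n * x" using x x0 by (simp add: pos_divide_less_eq)
      then show ?thesis by (auto simp: f_def split: split_indicator)
    qed
    then show "\<forall>\<^sub>F n in sequentially. f n x t = \<bar>t\<bar> * indicator {t. \<bar>t\<bar> > x} t"
      by (auto simp: eventually_sequentially)
  qed
  have mono: "AE t in M. mono (\<lambda>n. f n x t)" by (auto simp: mono_def inc)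
  show "integrable M (\<lambda>t. \<bar>t\<bar> * indicator {t. \<bar>t\<bar> > x} t)"
    by (rule integrable_monotone_convergence[OF f_int mono lim L]) simp
  have "truncated_tail_moment M x = L"
    unfolding truncated_tail_moment_def
    by (rule integral_monotone_convergence[OF f_int mono lim L]) simp
  also have "L \<le> 4 * e * (H x / x)"
    by (rule LIMSEQ_le_const2[OF L]) (intro exI[of _ 0] allI impI bnd[OF x])
  finally show "truncated_tail_moment M x \<le> 4 * e * (truncated_second_moment M x / x)" by (simp add: H_def)
qed

lemma slowly_varying_imp_integrable:
  assumes "slowly_varying (truncated_second_moment M)"
  shows "integrable M (\<lambda>t. t)"
proof -
  obtain x0 where x0: "x0 > 0" "\<And>u. u \<ge> x0 \<Longrightarrow> truncated_second_moment M (2 * u)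
    \<le> (1 + 1 / 2) * truncated_second_moment M u"
    by (rule slowly_varying_doubling[OF assms, of "1 / 2"]) auto
  have 1: "integrable M (\<lambda>t. \<bar>t\<bar> * indicator {t. \<bar>t\<bar> > x0} t)"
    by (rule truncated_tail_moment_bound(1)[of "1 / 2" x0 x0]) (use x0 in auto)
  show ?thesis
  proof (rule Bochner_Integration.integrable_bound[OF Bochner_Integration.integrable_add[OF 1 integrable_const[of x0]]])
    show "AE t in M. norm t \<le> norm (\<bar>t\<bar> * indicator {t. \<bar>t\<bar> > x0} t + x0)"
      using x0 by (auto split: split_indicator)
  qed simp
qed

lemma truncated_tail_moment_nonneg: "truncated_tail_moment M x \<ge> 0"
  unfolding truncated_tail_moment_def by (intro integral_nonneg_AE) auto

text \<open>A Karamata-type estimate. Slow variation brings the doubling ratio arbitrarily close to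
  1, and with it the constant of the tail bound to 0.\<close>

lemma truncated_tail_moment_tendsto:
  assumes sv: "slowly_varying (truncated_second_moment M)"
  shows "((\<lambda>x. x * truncated_tail_moment M x / truncated_second_moment M x) \<longlongrightarrow> 0) at_top"
proof (rule tendstoI)
  fix e :: real assume e: "e > 0"
  define d where "d = min (1 / 2) (e / 8)"
  have d: "d > 0" "d \<le> 1 / 2" "4 * d < e" using e by (auto simp: d_def)
  obtain x0 where x0: "x0 > 0" "\<And>u. u \<ge> x0 \<Longrightarrow> truncated_second_moment M (2 * u)
    \<le> (1 + d) * truncated_second_moment M u"
    "\<And>u. u \<ge> x0 \<Longrightarrow> truncated_second_moment M u > 0"
    using slowly_varying_doubling[OF sv d(1)] by auto
  show "\<forall>\<^sub>F x in at_top. dist (x * truncated_tail_moment M x / truncated_second_moment M x) 0 < e"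
    using eventually_ge_at_top[of x0]
  proof eventually_elim
    case (elim x)
    have H: "truncated_second_moment M x > 0" using x0(3)[OF elim] .
    have "truncated_tail_moment M x \<le> 4 * d * (truncated_second_moment M x / x)"
      by (rule truncated_tail_moment_bound(2)[OF _ d(2) x0(1) x0(2) elim]) (use d in auto)
    then have "x * truncated_tail_moment M x \<le> 4 * d * truncated_second_moment M x"
      using elim x0(1) by (simp add: pos_le_divide_eq mult.commute)
    then have "x * truncated_tail_moment M x / truncated_second_moment M x \<le> 4 * d"
      using H by (simp add: pos_divide_le_eq)
    moreover have "x * truncated_tail_moment M x / truncated_second_moment M x \<ge> 0"
      using elim x0(1) H truncated_tail_moment_nonneg[of x]
      by (intro divide_nonneg_pos mult_nonneg_nonneg) auto
    ultimately show ?case using d by (simp add: dist_real_def)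
  qed
qed

section \<open>Second-order remainder of the Cauchy transform\<close>

lemma cauchy_kernel_mult_id:
  assumes "Im z > 0" shows "of_real t * cauchy_kernel z t = z * cauchy_kernel z t - 1"
  using Im_pos_diff_of_real[OF assms, of t] by (simp add: cauchy_kernel_def divide_simps del: right_minus_eq)

lemma norm_id_cauchy_kernel_le:
  assumes "Im z > 0" shows "norm (of_real t * cauchy_kernel z t) \<le> norm z / Im z + 1"
proof -
  have "norm (of_real t * cauchy_kernel z t) \<le> norm (z * cauchy_kernel z t) + norm (1::complex)"
    unfolding cauchy_kernel_mult_id[OF assms] by (rule norm_triangle_ineq4)
  also have "norm (z * cauchy_kernel z t) \<le> norm z * (1 / Im z)"
    unfolding norm_mult by (intro mult_left_mono norm_cauchy_kernel_le assms) auto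
  finally show ?thesis by simp
qed

lemma integrable_square_cauchy_kernel:
  assumes z: "Im z > 0" and t: "integrable M (\<lambda>t. t)"
  shows "integrable M (\<lambda>t. (of_real t)\<^sup>2 * cauchy_kernel z t)"
proof (rule Bochner_Integration.integrable_bound)
  show "integrable M (\<lambda>t. (norm z / Im z + 1) * t)" using t by simp
  show "AE t in M. norm ((of_real t)\<^sup>2 * cauchy_kernel z t) \<le> norm ((norm z / Im z + 1) * t)"
  proof (intro AE_I2)
    fix t
    have "norm ((of_real t)\<^sup>2 * cauchy_kernel z t) = norm (of_real t * cauchy_kernel z t) * \<bar>t\<bar>"
      by (simp add: power2_eq_square norm_mult)
    also have "\<dots> \<le> (norm z / Im z + 1) * \<bar>t\<bar>"
      by (intro mult_right_mono norm_id_cauchy_kernel_le z) auto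
    also have "\<dots> = norm ((norm z / Im z + 1) * t)" using z by (simp add: abs_mult)
    finally show "norm ((of_real t)\<^sup>2 * cauchy_kernel z t) \<le> norm ((norm z / Im z + 1) * t)" .
  qed
qed simp

text \<open>For |t| small against |z| the function z t^2/(z - t) is close to t^2, the difference
  being t^3/(z - t). The integral is split at |t| = \<delta> B: inside, one factor |t| is at most
  \<delta> B; outside, the integrand is bounded by a multiple of B |t|.\<close>

lemma square_cauchy_kernel_bound:
  fixes w :: complex and B \<delta> :: real
  assumes w: "Im w > 0" and B: "B > 0" and \<delta>: "\<delta> > 0" and t: "integrable M (\<lambda>t. t)"
  defines "z \<equiv> of_real B * w"
  shows "norm (z * (\<integral>t. (of_real t)\<^sup>2 * cauchy_kernel z t \<partial>M) - of_real (truncated_second_moment M (\<delta> * B)))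
    \<le> \<delta> / Im w * truncated_second_moment M (\<delta> * B)
      + norm w * (norm w / Im w + 1) * B * truncated_tail_moment M (\<delta> * B)"
proof -
  have z: "Im z > 0" using w B by (simp add: z_def)
  have zw: "norm z / Im z = norm w / Im w" "norm z = B * norm w" using B by (simp_all add: z_def norm_mult)
  define I where "I t = indicat_real {-(\<delta> * B)..\<delta> * B} t" for t
  define J where "J t = indicat_real {t. \<bar>t\<bar> > \<delta> * B} t" for t
  have iJ: "integrable M (\<lambda>t. \<bar>t\<bar> * J t)"
    by (rule Bochner_Integration.integrable_bound[OF t]) (auto simp: J_def split: split_indicator)
  have iI: "integrable M (\<lambda>t. t\<^sup>2 * I t)" unfolding I_def by (rule integrable_truncated_square)
  then have iIc: "complex_integrable M (\<lambda>t. complex_of_real (t\<^sup>2 * I t))" by (rule integrable_of_real)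
  note iK = integrable_mult_right[OF integrable_square_cauchy_kernel[OF z t], of z]
  have "z * (\<integral>t. (of_real t)\<^sup>2 * cauchy_kernel z t \<partial>M) - of_real (truncated_second_moment M (\<delta> * B))
    = (\<integral>t. z * ((of_real t)\<^sup>2 * cauchy_kernel z t) - of_real (t\<^sup>2 * I t) \<partial>M)"
    using Bochner_Integration.integral_diff[OF iK iIc]
    by (simp only: truncated_second_moment_eq I_def[symmetric] integral_mult_right_zero integral_complex_of_real)
  also have "norm \<dots> \<le> (\<integral>t. \<delta> / Im w * (t\<^sup>2 * I t) + norm w * (norm w / Im w + 1) * B * (\<bar>t\<bar> * J t) \<partial>M)"
  proof (intro order_trans[OF integral_norm_bound] integral_mono)
    show "integrable M (\<lambda>t. norm (z * ((of_real t)\<^sup>2 * cauchy_kernel z t) - of_real (t\<^sup>2 * I t)))"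
      by (intro integrable_norm Bochner_Integration.integrable_diff iK iIc)
    show "integrable M (\<lambda>t. \<delta> / Im w * (t\<^sup>2 * I t) + norm w * (norm w / Im w + 1) * B * (\<bar>t\<bar> * J t))"
      by (intro Bochner_Integration.integrable_add integrable_mult_right iI iJ)
    fix t :: real
    show "norm (z * ((of_real t)\<^sup>2 * cauchy_kernel z t) - of_real (t\<^sup>2 * I t))
      \<le> \<delta> / Im w * (t\<^sup>2 * I t) + norm w * (norm w / Im w + 1) * B * (\<bar>t\<bar> * J t)"
    proof (cases "\<bar>t\<bar> \<le> \<delta> * B")
      case True
      then have IJ: "I t = 1" "J t = 0" by (auto simp: I_def J_def abs_le_iff)
      have "z * ((of_real t)\<^sup>2 * cauchy_kernel z t) - of_real (t\<^sup>2 * I t)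
        = (of_real t)\<^sup>2 * (of_real t * cauchy_kernel z t)"
        unfolding cauchy_kernel_mult_id[OF z] IJ by (simp add: algebra_simps)
      also have "norm \<dots> = t\<^sup>2 * (\<bar>t\<bar> * norm (cauchy_kernel z t))" by (simp add: norm_mult norm_power)
      also have "\<dots> \<le> t\<^sup>2 * ((\<delta> * B) * (1 / Im z))"
        using True \<delta> B by (intro mult_left_mono mult_mono norm_cauchy_kernel_le z) auto
      also have "(\<delta> * B) * (1 / Im z) = \<delta> / Im w" using B by (simp add: z_def)
      finally show ?thesis using IJ by (simp add: mult.commute)
    next
      case False
      then have IJ: "I t = 0" "J t = 1" by (auto simp: I_def J_def abs_le_iff)
      have "norm (z * ((of_real t)\<^sup>2 * cauchy_kernel z t) - of_real (t\<^sup>2 * I t))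
          = norm z * (\<bar>t\<bar> * norm (of_real t * cauchy_kernel z t))"
        by (simp add: IJ norm_mult norm_power power2_eq_square)
      also have "\<dots> \<le> norm z * (\<bar>t\<bar> * (norm z / Im z + 1))"
        by (intro mult_left_mono norm_id_cauchy_kernel_le z) auto
      also have "norm z * (\<bar>t\<bar> * (norm z / Im z + 1)) = (B * norm w) * (\<bar>t\<bar> * (norm w / Im w + 1))"
        by (simp only: zw(1)) (simp only: zw(2))
      finally show ?thesis using IJ by (simp add: mult_ac)
    qed
  qed
  also have "\<dots> = \<delta> / Im w * truncated_second_moment M (\<delta> * B)
      + norm w * (norm w / Im w + 1) * B * truncated_tail_moment M (\<delta> * B)"
    using iI iJ by (simp add: truncated_second_moment_eq truncated_tail_moment_def I_def J_def)
  finally show ?thesis .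
qed

text \<open>The tail is negligible against H(\<delta> B), and slow variation replaces H(\<delta> B)
  by H(B). Since \<delta> is fixed while B grows, it may be taken small at the outset.\<close>

lemma square_cauchy_kernel_asymp:
  assumes sv: "slowly_varying (truncated_second_moment M)" and w: "Im w > 0"
  shows "((\<lambda>B. of_real B * w * (\<integral>t. (of_real t)\<^sup>2 * cauchy_kernel (of_real B * w) t \<partial>M)
    / of_real (truncated_second_moment M B)) \<longlongrightarrow> 1) at_top"
proof (rule tendstoI)
  fix e :: real assume e: "e > 0"
  define H where "H = truncated_second_moment M"
  have t: "integrable M (\<lambda>t. t)" by (rule slowly_varying_imp_integrable[OF sv])
  \<comment> \<open>Makes the inner error \<delta>/Im w equal to e/2.\<close>
  define \<delta> where "\<delta> = e * Im w / 2"
  have \<delta>: "\<delta> > 0" using e w by (simp add: \<delta>_def)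
  define c where "c = norm w * (norm w / Im w + 1)"
  have c: "c \<ge> 0" using w by (simp add: c_def)
  have rat: "((\<lambda>B. H (\<delta> * B) / H B) \<longlongrightarrow> 1) at_top" using sv \<delta> by (simp add: slowly_varying_def H_def)
  have Hpos: "\<forall>\<^sub>F B in at_top. H B > 0" using sv by (simp add: slowly_varying_def H_def)
  have scale: "filterlim (\<lambda>B. \<delta> * B) at_top at_top"
    using \<delta> by (intro filterlim_tendsto_pos_mult_at_top[OF tendsto_const]) (auto simp: filterlim_ident)
  have tail: "((\<lambda>B. \<delta> * B * truncated_tail_moment M (\<delta> * B) / H (\<delta> * B)) \<longlongrightarrow> 0) at_top"
    using filterlim_compose[OF truncated_tail_moment_tendsto[OF sv] scale] by (simp add: H_def)
  have "((\<lambda>B. \<delta> / Im w * (H (\<delta> * B) / H B)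
      + c / \<delta> * (\<delta> * B * truncated_tail_moment M (\<delta> * B) / H (\<delta> * B)) * (H (\<delta> * B) / H B)
      + \<bar>H (\<delta> * B) / H B - 1\<bar>) \<longlongrightarrow> \<delta> / Im w * 1 + c / \<delta> * 0 * 1 + \<bar>1 - 1\<bar>) at_top"
    by (intro tendsto_add tendsto_mult tendsto_const rat tail tendsto_rabs tendsto_diff)
  moreover have "\<delta> / Im w * 1 + c / \<delta> * 0 * 1 + \<bar>1 - 1\<bar> < e" using e w by (simp add: \<delta>_def)
  ultimately have ev: "\<forall>\<^sub>F B in at_top. \<delta> / Im w * (H (\<delta> * B) / H B)
      + c / \<delta> * (\<delta> * B * truncated_tail_moment M (\<delta> * B) / H (\<delta> * B)) * (H (\<delta> * B) / H B)
      + \<bar>H (\<delta> * B) / H B - 1\<bar> < e"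
    by (rule order_tendstoD(2))
  have Hpos': "\<forall>\<^sub>F B in at_top. H (\<delta> * B) > 0"
    using eventually_compose_filterlim[OF Hpos scale] .
  show "\<forall>\<^sub>F B in at_top. dist (of_real B * w * (\<integral>t. (of_real t)\<^sup>2 * cauchy_kernel (of_real B * w) t \<partial>M)
    / of_real (truncated_second_moment M B)) 1 < e"
    using ev Hpos Hpos' eventually_gt_at_top[of 0]
  proof eventually_elim
    case (elim B)
    define Q where "Q = of_real B * w * (\<integral>t. (of_real t)\<^sup>2 * cauchy_kernel (of_real B * w) t \<partial>M)"
    define \<tau> where "\<tau> = truncated_tail_moment M (\<delta> * B)"
    have b: "norm (Q - of_real (H (\<delta> * B))) \<le> \<delta> / Im w * H (\<delta> * B) + c * B * \<tau>"
      using square_cauchy_kernel_bound[OF w elim(4) \<delta> t] by (simp add: Q_def H_def c_def \<tau>_def)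
    have "Q / of_real (H B) - 1 = (Q - of_real (H (\<delta> * B))) / of_real (H B) + of_real (H (\<delta> * B) / H B - 1)"
      by (simp add: diff_divide_distrib)
    also have "norm \<dots> \<le> (\<delta> / Im w * H (\<delta> * B) + c * B * \<tau>) / H B + \<bar>H (\<delta> * B) / H B - 1\<bar>"
    proof (rule norm_triangle_mono)
      show "norm ((Q - of_real (H (\<delta> * B))) / of_real (H B)) \<le> (\<delta> / Im w * H (\<delta> * B) + c * B * \<tau>) / H B"
        using b elim by (simp add: norm_divide divide_right_mono)
      show "norm (complex_of_real (H (\<delta> * B) / H B - 1)) \<le> \<bar>H (\<delta> * B) / H B - 1\<bar>"
        by (simp only: norm_of_real)
    qed
    also have "(\<delta> / Im w * H (\<delta> * B) + c * B * \<tau>) / H B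
        = \<delta> / Im w * (H (\<delta> * B) / H B) + c / \<delta> * (\<delta> * B * \<tau> / H (\<delta> * B)) * (H (\<delta> * B) / H B)"
      using \<delta> elim by (simp add: add_divide_distrib)
    also have "\<dots> + \<bar>H (\<delta> * B) / H B - 1\<bar> < e" using elim(1) by (simp add: \<tau>_def)
    finally show ?case by (simp add: dist_norm Q_def H_def)
  qed
qed

section \<open>The smoothed ratio on the imaginary axis\<close>

lemma smoothed_ratio_eq:
  assumes y: "y > 0"
  shows "smoothed_ratio M y = 1 + y * Im (cauchy_transform M (\<i> * of_real y))"
proof -
  have int: "integrable M (\<lambda>t. y\<^sup>2 * (norm (cauchy_kernel (\<i> * of_real y) t))\<^sup>2)"
    using y by (intro integrable_mult_right integrable_norm_cauchy_kernel) auto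
  have "t\<^sup>2 / (t\<^sup>2 + y\<^sup>2) = 1 - y\<^sup>2 * (norm (cauchy_kernel (\<i> * of_real y) t))\<^sup>2" for t
  proof -
    have "t\<^sup>2 + y\<^sup>2 > 0" using y by (simp add: sum_power2_gt_zero_iff)
    moreover have "(norm (cauchy_kernel (\<i> * of_real y) t))\<^sup>2 = 1 / (t\<^sup>2 + y\<^sup>2)"
      by (simp add: cauchy_kernel_def norm_divide power_divide cmod_power2)
    moreover from calculation(1) have "t\<^sup>2 / (t\<^sup>2 + y\<^sup>2) + y\<^sup>2 / (t\<^sup>2 + y\<^sup>2) = 1"
      using y by (simp only: add_divide_distrib[symmetric]) auto
    ultimately show ?thesis by simp
  qed
  then have "smoothed_ratio M y = 1 - y\<^sup>2 * (\<integral>t. (norm (cauchy_kernel (\<i> * of_real y) t))\<^sup>2 \<partial>M)"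
    using int by (simp add: smoothed_ratio_def)
  then show ?thesis using y by (simp add: Im_cauchy_transform power2_eq_square)
qed

lemma integrable_smoothed_ratio: "integrable M (\<lambda>t. t\<^sup>2 / (t\<^sup>2 + y\<^sup>2))"
  by (rule integrable_bounded_cont[where B=1]) (auto simp: divide_le_eq_1 sum_power2_gt_zero_iff)

lemma smoothed_ratio_antimono:
  assumes "0 < x" "x \<le> y" shows "smoothed_ratio M y \<le> smoothed_ratio M x"
  unfolding smoothed_ratio_def
proof (intro integral_mono integrable_smoothed_ratio)
  fix t :: real
  have "t\<^sup>2 + x\<^sup>2 > 0" "x\<^sup>2 \<le> y\<^sup>2" using assms by (auto simp: sum_power2_gt_zero_iff intro: power_mono)
  then show "t\<^sup>2 / (t\<^sup>2 + y\<^sup>2) \<le> t\<^sup>2 / (t\<^sup>2 + x\<^sup>2)" by (intro divide_left_mono) auto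
qed

lemma smoothed_ratio_tendsto: "(smoothed_ratio M \<longlongrightarrow> 0) at_top"
proof (rule Lim_transform_eventually[OF Im_cauchy_transform_at_top])
  show "\<forall>\<^sub>F y in at_top. 1 + y * Im (cauchy_transform M (\<i> * of_real y)) = smoothed_ratio M y"
    using eventually_gt_at_top[of 0] by eventually_elim (simp add: smoothed_ratio_eq)
qed

lemma smoothed_ratio_pos:
  assumes nd: "\<not> degenerate M" and y: "y > 0"
  shows "smoothed_ratio M y > 0"
proof -
  have "smoothed_ratio M y \<noteq> 0"
  proof
    assume "smoothed_ratio M y = 0"
    then have "AE t in M. t\<^sup>2 / (t\<^sup>2 + y\<^sup>2) = 0"
      unfolding smoothed_ratio_def by (subst (asm) integral_nonneg_eq_0_iff_AE[OF integrable_smoothed_ratio]) auto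
    then have ae: "AE t in M. t = 0" using y by (auto elim!: eventually_mono simp: sum_power2_eq_zero_iff)
    have "M = return borel 0"
    proof (rule measure_eqI)
      fix A assume "A \<in> sets M"
      then have [measurable]: "A \<in> sets borel" by simp
      have "emeasure M A = emeasure M (if (0::real) \<in> A then UNIV else {})"
      proof (rule emeasure_eq_AE)
        show "AE t in M. (t \<in> A) = (t \<in> (if (0::real) \<in> A then UNIV else {}))"
          using ae by eventually_elim simp
      qed auto
      then show "emeasure M A = emeasure (return borel 0) A" by simp
    qed simp
    with nd show False by (auto simp: degenerate_def)
  qed
  moreover have "smoothed_ratio M y \<ge> 0" unfolding smoothed_ratio_def by (intro integral_nonneg_AE) auto
  ultimately show ?thesis by simp
qed

end

section \<open>Sufficiency\<close>

text \<open>No wrong branch can occur: both numbers lie in the upper half-plane, so |g + f| >= Im f,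
  and |g - f| is controlled by |g^2 - f^2|.\<close>

lemma tendsto_of_square_tendsto:
  fixes g :: "nat \<Rightarrow> complex"
  assumes g: "\<And>n. Im (g n) > 0" and f: "Im f > 0" and lim: "(\<lambda>n. (g n)\<^sup>2) \<longlonglongrightarrow> f\<^sup>2"
  shows "g \<longlonglongrightarrow> f"
proof -
  have "(\<lambda>n. norm ((g n)\<^sup>2 - f\<^sup>2) / Im f) \<longlonglongrightarrow> norm (f\<^sup>2 - f\<^sup>2) / Im f"
    using f by (intro tendsto_intros lim) auto
  then have "(\<lambda>n. norm ((g n)\<^sup>2 - f\<^sup>2) / Im f) \<longlonglongrightarrow> 0" by simp
  moreover have "norm (g n - f) \<le> norm ((g n)\<^sup>2 - f\<^sup>2) / Im f" for n
  proof -
    have "Im f \<le> norm (g n + f)" using abs_Im_le_cmod[of "g n + f"] g[of n] f by simp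
    then have "norm (g n - f) * Im f \<le> norm (g n - f) * norm (g n + f)" by (intro mult_left_mono) auto
    also have "\<dots> = norm ((g n)\<^sup>2 - f\<^sup>2)" unfolding norm_mult[symmetric]
      by (simp add: power2_eq_square algebra_simps)
    finally show ?thesis using f by (simp add: pos_le_divide_eq)
  qed
  ultimately have "(\<lambda>n. g n - f) \<longlonglongrightarrow> 0" by (intro Lim_null_comparison[of "\<lambda>n. g n - f"]) auto
  then show ?thesis by (rule Lim_null[THEN iffD2])
qed

lemma recip_cauchy_transform_arcsine:
  assumes z: "Im z > 0"
  shows "(recip_cauchy_transform arcsine_law z)\<^sup>2 = z\<^sup>2 - 2" "Im (recip_cauchy_transform arcsine_law z) > 0"
proof -
  interpret real_distribution arcsine_law by (rule real_distribution_arcsine)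
  show "(recip_cauchy_transform arcsine_law z)\<^sup>2 = z\<^sup>2 - 2"
  proof -
    have "z\<^sup>2 - 2 = 1 / (cauchy_transform arcsine_law z)\<^sup>2"
      using cauchy_transform_arcsine[OF z] cauchy_transform_nonzero[OF z] by (simp add: eq_divide_eq)
    then show ?thesis by (simp add: recip_cauchy_transform_def power_divide)
  qed
  show "Im (recip_cauchy_transform arcsine_law z) > 0" by (rule Im_recip_cauchy_transform_pos[OF z])
qed

lemma Re_of_real_mult: "Re (of_real r * z) = r * Re z" and Im_of_real_mult: "Im (of_real r * z) = r * Im z"
  by simp_all

context real_distribution
begin

lemma recip_shift_dilation_inverse:
  assumes "b > 0"
  shows "recip_shift (dilation (1 / b) M) w = recip_shift M (of_real b * w) / of_real b"
  using recip_shift_dilation[of "1 / b" w] assms by (simp add: mult.commute)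

text \<open>Integrates z^2/(z - t) = z + t + t^2/(z - t); the mean is the term that drops
  out.\<close>

lemma cauchy_transform_mean_zero:
  assumes z: "Im z > 0" and mean: "has_mean M 0"
  shows "z * cauchy_transform M z = 1 + (\<integral>t. (of_real t)\<^sup>2 * cauchy_kernel z t \<partial>M) / z"
proof -
  have t: "integrable M (\<lambda>t. t)" "(\<integral>t. t \<partial>M) = 0" using mean by (auto simp: has_mean_def)
  have nz: "z \<noteq> 0" using z by auto
  have "z * (z * cauchy_kernel z t) = z + of_real t + (of_real t)\<^sup>2 * cauchy_kernel z t" for t
  proof -
    have "(of_real t)\<^sup>2 * cauchy_kernel z t = of_real t * (of_real t * cauchy_kernel z t)"
      by (simp add: power2_eq_square)
    also have "\<dots> = of_real t * (z * cauchy_kernel z t - 1)"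
      by (simp only: cauchy_kernel_mult_id[OF z])
    also have "\<dots> = z * (of_real t * cauchy_kernel z t) - of_real t"
      by (simp add: right_diff_distrib mult.left_commute)
    finally have "(of_real t)\<^sup>2 * cauchy_kernel z t = z * (of_real t * cauchy_kernel z t) - of_real t" .
    moreover have "z * (z * cauchy_kernel z t) = z + z * (of_real t * cauchy_kernel z t)"
      unfolding cauchy_kernel_mult_id[OF z] by (simp add: right_diff_distrib)
    ultimately show ?thesis by simp
  qed
  then have "(\<integral>t. z * (z * cauchy_kernel z t) \<partial>M) = (\<integral>t. z + of_real t
    + (of_real t)\<^sup>2 * cauchy_kernel z t \<partial>M)" by simp
  also have "\<dots> = z + (\<integral>t. (of_real t)\<^sup>2 * cauchy_kernel z t \<partial>M)"
    using t integrable_square_cauchy_kernel[OF z t(1)] integrable_of_real[OF t(1), where 'a=complex] by simp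
  finally have "z * (z * cauchy_transform M z) = z + (\<integral>t. (of_real t)\<^sup>2 * cauchy_kernel z t \<partial>M)"
    by (simp add: cauchy_transform_kernel)
  then have "z * (z * cauchy_transform M z) / z = (z + (\<integral>t. (of_real t)\<^sup>2 * cauchy_kernel z t \<partial>M)) / z" by simp
  then show ?thesis using nz by (simp add: add_divide_distrib)
qed

text \<open>The real part of the preceding asymptotics at w = i. It allows the continuous function
  y^2 psi(y) to stand in for H(y) when the constants B_n are chosen.\<close>

lemma smoothed_ratio_asymp:
  assumes sv: "slowly_varying (truncated_second_moment M)"
  shows "((\<lambda>y. y\<^sup>2 * smoothed_ratio M y / truncated_second_moment M y) \<longlongrightarrow> 1) at_top"
proof -
  have 1: "((\<lambda>B. Re (of_real B * \<i> * (\<integral>t. (of_real t)\<^sup>2 * cauchy_kernel (of_real B * \<i>) t \<partial>M)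
    / of_real (truncated_second_moment M B))) \<longlongrightarrow> Re 1) at_top"
    by (intro tendsto_Re square_cauchy_kernel_asymp sv) simp
  have 2: "\<forall>\<^sub>F B in at_top. Re (of_real B * \<i> * (\<integral>t. (of_real t)\<^sup>2 * cauchy_kernel (of_real B * \<i>) t \<partial>M)
    / of_real (truncated_second_moment M B)) = B\<^sup>2 * smoothed_ratio M B / truncated_second_moment M B"
    using eventually_gt_at_top[of 0]
  proof eventually_elim
    case (elim B)
    have int: "complex_integrable M (\<lambda>t. (of_real t)\<^sup>2 * cauchy_kernel (of_real B * \<i>) t)"
      using elim by (intro integrable_square_cauchy_kernel slowly_varying_imp_integrable[OF sv]) simp
    have "Re (of_real B * \<i> * (\<integral>t. (of_real t)\<^sup>2 * cauchy_kernel (of_real B * \<i>) t \<partial>M))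
      = - B * Im (\<integral>t. (of_real t)\<^sup>2 * cauchy_kernel (of_real B * \<i>) t \<partial>M)" by simp
    also have "\<dots> = - B * (\<integral>t. Im ((of_real t)\<^sup>2 * cauchy_kernel (of_real B * \<i>) t) \<partial>M)"
      using integral_Im[OF int] by simp
    also have "(\<lambda>t. Im ((of_real t)\<^sup>2 * cauchy_kernel (of_real B * \<i>) t)) = (\<lambda>t. - B * (t\<^sup>2 / (t\<^sup>2 + B\<^sup>2)))"
    proof
      fix t
      have "(of_real t)\<^sup>2 * cauchy_kernel (of_real B * \<i>) t
        = of_real (t\<^sup>2) * cauchy_kernel (of_real B * \<i>) t" by simp
      then have "Im ((of_real t)\<^sup>2 * cauchy_kernel (of_real B * \<i>) t)
        = t\<^sup>2 * Im (cauchy_kernel (of_real B * \<i>) t)"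
        by (simp only: Im_of_real_mult)
      also have "Im (cauchy_kernel (of_real B * \<i>) t) = - B / (t\<^sup>2 + B\<^sup>2)"
        by (simp add: cauchy_kernel_def Im_divide)
      finally show "Im ((of_real t)\<^sup>2 * cauchy_kernel (of_real B * \<i>) t) = - B * (t\<^sup>2 / (t\<^sup>2 + B\<^sup>2))" by simp
    qed
    also have "- B * (\<integral>t. - B * (t\<^sup>2 / (t\<^sup>2 + B\<^sup>2)) \<partial>M) = B\<^sup>2 * smoothed_ratio M B"
      by (simp only: smoothed_ratio_def integral_mult_right_zero) (simp add: power2_eq_square)
    finally show ?case by (simp only: Re_divide_of_real)
  qed
  from Lim_transform_eventually[OF 1 2] show ?thesis by simp
qed

text \<open>Under slow variation psi(B_n) = 1/n amounts to the norming B_n^2 ~ n H(B_n). The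
  equation is solvable exactly because psi is continuous, which H need not be. As psi is positive
  and nonincreasing, the solutions tend to infinity.\<close>

lemma smoothed_ratio_level:
  assumes nd: "\<not> degenerate M"
  obtains B :: "nat \<Rightarrow> real" where "\<And>n. B n > 0" "\<forall>\<^sub>F n in sequentially. smoothed_ratio M (B n) = 1 / real n"
    "filterlim B at_top sequentially"
proof -
  define \<psi> where "\<psi> = smoothed_ratio M"
  have small: "\<forall>\<^sub>F n in sequentially. 1 / real n < c" if "c > 0" for c :: real
    using order_tendstoD(2)[OF lim_const_over_n[of 1] that] by simp
  \<comment> \<open>For the finitely many n with 1/n above psi(1) any b >= 1 is accepted, so that B
    is defined and positive for every index.\<close>
  have "\<exists>b\<ge>1. n > 0 \<and> 1 / real n \<le> \<psi> 1 \<longrightarrow> \<psi> b = 1 / real n" for n :: nat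
  proof (cases "n > 0 \<and> 1 / real n \<le> \<psi> 1")
    case True
    have "\<forall>\<^sub>F y in at_top. \<psi> y < 1 / real n \<and> y \<ge> 1"
      unfolding \<psi>_def using True
      by (intro eventually_conj order_tendstoD(2)[OF smoothed_ratio_tendsto] eventually_ge_at_top) auto
    then obtain Y where Y: "\<psi> Y < 1 / real n" "Y \<ge> 1"
      using eventually_happens'[OF trivial_limit_at_top_linorder] by blast
    have "continuous_on {1..Y} (\<lambda>y. 1 + y * Im (cauchy_transform M (\<i> * of_real y)))"
      by (intro continuous_intros continuous_on_compose2[OF holomorphic_on_imp_continuous_on[OF holomorphic_on_cauchy_transform[OF real_distribution_axioms]]]) auto
    then have "continuous_on {1..Y} \<psi>"
      by (rule continuous_on_eq) (auto simp: \<psi>_def smoothed_ratio_eq)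
    from IVT2'[of \<psi> Y "1 / real n" 1, OF _ _ Y(2) this] Y True show ?thesis by auto
  qed auto
  then obtain B where B: "\<And>n. B n \<ge> 1" "\<And>n. n > 0 \<and> 1 / real n \<le> \<psi> 1 \<Longrightarrow> \<psi> (B n) = 1 / real n" by metis
  have ev: "\<forall>\<^sub>F n in sequentially. \<psi> (B n) = 1 / real n"
    using small[OF smoothed_ratio_pos[OF nd zero_less_one, folded \<psi>_def]] eventually_gt_at_top[of 0]
    by eventually_elim (use B(2) in \<open>auto simp: \<psi>_def\<close>)
  show ?thesis
  proof (rule that)
    show "B n > 0" for n using B(1)[of n] by simp
    show "\<forall>\<^sub>F n in sequentially. smoothed_ratio M (B n) = 1 / real n" using ev by (simp add: \<psi>_def)
    show "filterlim B at_top sequentially"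
      unfolding filterlim_at_top
    proof
      fix C :: real
      define C' where "C' = max C 1"
      have "\<psi> C' > 0" unfolding \<psi>_def by (rule smoothed_ratio_pos[OF nd]) (simp add: C'_def)
      from ev small[OF this] show "\<forall>\<^sub>F n in sequentially. C \<le> B n"
      proof eventually_elim
        case (elim n)
        have "\<not> B n \<le> C'"
        proof
          assume "B n \<le> C'"
          then have "\<psi> C' \<le> \<psi> (B n)" unfolding \<psi>_def using B(1)[of n] by (intro smoothed_ratio_antimono) auto
          then show False using elim by simp
        qed
        then show ?case by (simp add: C'_def)
      qed
    qed
  qed
qed

text \<open>With h = z G(z) - 1 at z = B_n w one has F(z) - z = -z h/(1 + h). Mean zero makes h of
  second order, and the choice of B_n makes n h tend to 1/w^2.\<close>

lemma recip_shift_dilation_asymp: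
  assumes sv: "slowly_varying (truncated_second_moment M)" and mean: "has_mean M 0"
    and B: "\<And>n. B n > 0" "\<forall>\<^sub>F n in sequentially. smoothed_ratio M (B n)
      = 1 / real n" "filterlim B at_top sequentially"
    and w: "Im w > 0"
  shows "(\<lambda>n. of_nat n * recip_shift (dilation (1 / B n) M) w) \<longlonglongrightarrow> - 1 / w"
proof -
  have nzw: "w \<noteq> 0" using w by auto
  define H where "H = truncated_second_moment M"
  define z where "z n = of_real (B n) * w" for n
  have z: "Im (z n) > 0" "z n \<noteq> 0" for n using w B(1)[of n] nzw by (auto simp: z_def)
  define I where "I n = (\<integral>t. (of_real t)\<^sup>2 * cauchy_kernel (z n) t \<partial>M)" for n
  define h where "h n = I n / z n" for n
  have 1: "(\<lambda>n. z n * I n / of_real (H (B n))) \<longlonglongrightarrow> 1"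
    using filterlim_compose[OF square_cauchy_kernel_asymp[OF sv w] B(3)] by (simp add: z_def I_def H_def)
  have "(\<lambda>n. (B n)\<^sup>2 * smoothed_ratio M (B n) / H (B n)) \<longlonglongrightarrow> 1"
    using filterlim_compose[OF smoothed_ratio_asymp[OF sv] B(3)] by (simp add: H_def)
  then have "(\<lambda>n. inverse ((B n)\<^sup>2 * smoothed_ratio M (B n) / H (B n))) \<longlonglongrightarrow> inverse 1"
    by (intro tendsto_inverse) auto
  from tendsto_of_real[OF this, where 'a=complex]
  have 2: "(\<lambda>n. of_real (inverse ((B n)\<^sup>2 * smoothed_ratio M (B n) / H (B n))) :: complex) \<longlonglongrightarrow> 1" by simp
  have Hpos: "\<forall>\<^sub>F n in sequentially. H (B n) > 0"
    using eventually_compose_filterlim[OF _ B(3), of "\<lambda>x. H x > 0"] sv by (simp add: slowly_varying_def H_def)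
  \<comment> \<open>Factors n h as (z I/H) (n H/B^2)/w^2. The first factor tends to 1 by the kernel
    asymptotics, the second because n = 1/psi(B_n).\<close>
  have 3: "(\<lambda>n. (z n * I n / of_real (H (B n))) * of_real (inverse ((B n)\<^sup>2
    * smoothed_ratio M (B n) / H (B n))) / w\<^sup>2)
      \<longlonglongrightarrow> 1 * 1 / w\<^sup>2"
    using nzw by (intro tendsto_intros 1 2) auto
  have 4: "\<forall>\<^sub>F n in sequentially. (z n * I n / of_real (H (B n))) * of_real (inverse ((B n)\<^sup>2
    * smoothed_ratio M (B n) / H (B n))) / w\<^sup>2
      = of_nat n * h n"
    using Hpos B(2) eventually_gt_at_top[of 0]
  proof eventually_elim
    case (elim n)
    have "inverse ((B n)\<^sup>2 * smoothed_ratio M (B n) / H (B n)) = real n * H (B n) / (B n)\<^sup>2"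
      unfolding elim(2) using elim(3) by simp
    then show ?case
      using elim B(1)[of n] nzw z(2)[of n] by (simp add: h_def z_def power2_eq_square)
  qed
  from Lim_transform_eventually[OF 3 4] have nh: "(\<lambda>n. of_nat n * h n) \<longlonglongrightarrow> 1 / w\<^sup>2" by simp
  have 5: "(\<lambda>n. (of_nat n * h n) * of_real (1 / real n)) \<longlonglongrightarrow> 1 / w\<^sup>2 * of_real 0"
    by (intro tendsto_mult nh tendsto_of_real lim_const_over_n)
  have 6: "\<forall>\<^sub>F n in sequentially. (of_nat n * h n) * of_real (1 / real n) = h n"
    using eventually_gt_at_top[of 0] by eventually_elim simp
  from Lim_transform_eventually[OF 5 6] have h0: "h \<longlonglongrightarrow> 0" by simp
  have "(\<lambda>n. - w * (of_nat n * h n) / (1 + h n)) \<longlonglongrightarrow> - w * (1 / w\<^sup>2) / (1 + 0)"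
    by (intro tendsto_intros nh h0) auto
  moreover have "- w * (of_nat n * h n) / (1 + h n) = of_nat n * recip_shift (dilation (1 / B n) M) w" for n
  proof -
    have b: "complex_of_real (B n) \<noteq> 0" using B(1)[of n] by simp
    have zG: "z n * cauchy_transform M (z n) = 1 + h n"
      using cauchy_transform_mean_zero[OF z(1) mean] by (simp add: h_def I_def)
    then have nz: "1 + h n \<noteq> 0" using z(2)[of n] cauchy_transform_nonzero[OF z(1)] by (metis mult_eq_0_iff)
    have "recip_cauchy_transform M (z n) = z n / (1 + h n)"
      unfolding zG[symmetric] recip_cauchy_transform_def using z(2)[of n] by simp
    then have "recip_shift (dilation (1 / B n) M) w = (z n / (1 + h n) - z n) / of_real (B n)"
      using recip_shift_dilation_inverse[OF B(1)[of n]] by (simp add: recip_shift_def z_def)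
    also have "\<dots> = w / (1 + h n) - w" using b by (simp add: z_def diff_divide_distrib)
    also have "\<dots> = - w * h n / (1 + h n)" using nz by (simp add: divide_simps) (simp add: algebra_simps)
    finally show ?thesis by simp
  qed
  moreover have "- w * (1 / w\<^sup>2) / (1 + 0) = - 1 / w" using nzw by (simp add: power2_eq_square)
  ultimately show ?thesis by simp
qed

end

theorem arcsine_limit_sufficient:
  assumes \<mu>: "real_distribution \<mu>" and nd: "\<not> degenerate \<mu>"
    and sv: "slowly_varying (truncated_second_moment \<mu>)" and mean: "has_mean \<mu> 0"
  shows "\<exists>B :: nat \<Rightarrow> real. (\<forall>n. B n > 0) \<and>
    weak_conv_m (\<lambda>n. dilation (1 / B n) (monotone_conv_power \<mu> n)) arcsine_law"
proof -
  interpret real_distribution \<mu> by fact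
  obtain B :: "nat \<Rightarrow> real" where B: "\<And>n. B n > 0" "\<forall>\<^sub>F n in sequentially. smoothed_ratio \<mu> (B n) = 1 / real n"
    "filterlim B at_top sequentially"
    using smoothed_ratio_level[OF nd] by blast
  define N where "N n = dilation (1 / B n) \<mu>" for n
  define P where "P n = dilation (1 / B n) (monotone_conv_power \<mu> n)" for n
  have N: "real_distribution (N n)" for n unfolding N_def by (rule real_distribution_dilation)
  have P: "real_distribution (P n)" for n unfolding P_def
    by (intro real_distribution.real_distribution_dilation real_distribution_monotone_conv_power \<mu>)
  \<comment> \<open>The iteration theorem requires positivity at every index, whereas 1/0 = 0; hence
    the separate value at n = 0.\<close>
  define \<epsilon> where "\<epsilon> n = (if n = 0 then 1 else 1 / real n)" for n :: nat
  have \<epsilon>: "\<epsilon> n > 0" "real n * \<epsilon> n \<le> 1" for n by (auto simp: \<epsilon>_def)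
  have \<epsilon>_ev: "\<forall>\<^sub>F n in sequentially. 1 / real n = \<epsilon> n"
    using eventually_gt_at_top[of 0] by eventually_elim (simp add: \<epsilon>_def)
  have \<epsilon>0: "\<epsilon> \<longlonglongrightarrow> 0" by (rule Lim_transform_eventually[OF lim_const_over_n \<epsilon>_ev])
  have lim: "(\<lambda>n. recip_shift (N n) w / of_real (\<epsilon> n)) \<longlonglongrightarrow> - 1 / w" if w: "Im w > 0" for w
  proof (rule Lim_transform_eventually[OF recip_shift_dilation_asymp[OF sv mean B w]])
    show "\<forall>\<^sub>F n in sequentially. of_nat n * recip_shift (dilation (1 / B n) \<mu>) w
      = recip_shift (N n) w / of_real (\<epsilon> n)"
      using eventually_gt_at_top[of 0] by eventually_elim (simp add: \<epsilon>_def N_def)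
  qed
  have "weak_conv_m P arcsine_law"
  proof (rule cauchy_transform_imp_weak_conv[OF P real_distribution_arcsine])
    fix z :: complex assume z: "Im z > 0"
    define g where "g n = recip_cauchy_transform (P n) z" for n
    define f where "f = recip_cauchy_transform arcsine_law z"
    have g_eq: "g n = (recip_cauchy_transform (N n) ^^ n) z" for n
      unfolding g_def P_def N_def using B(1)[of n] by (intro recip_cauchy_transform_dilation_power \<mu> z) simp
    have f: "f\<^sup>2 = z\<^sup>2 - 2" "Im f > 0" using recip_cauchy_transform_arcsine[OF z] by (auto simp: f_def)
    have 1: "(\<lambda>n. (g n)\<^sup>2 - z\<^sup>2 + of_real (2 * (real n * \<epsilon> n))) \<longlonglongrightarrow> 0"
      unfolding g_eq by (rule iterate_square_tendsto[OF N \<epsilon>(1) \<epsilon>0 lim \<epsilon>(2) z])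
    have 2: "\<forall>\<^sub>F n in sequentially. (g n)\<^sup>2 - z\<^sup>2 + of_real (2 * (real n * \<epsilon> n)) = (g n)\<^sup>2 - f\<^sup>2"
      using eventually_gt_at_top[of 0]
    proof eventually_elim
      case (elim n)
      then have "real n * \<epsilon> n = 1" by (simp add: \<epsilon>_def)
      then show ?case unfolding f(1) by simp
    qed
    have 3: "(\<lambda>n. (g n)\<^sup>2) \<longlonglongrightarrow> f\<^sup>2"
      by (rule Lim_null[THEN iffD2]) (rule Lim_transform_eventually[OF 1 2])
    have 4: "Im (g n) > 0" for n
      unfolding g_def by (rule real_distribution.Im_recip_cauchy_transform_pos[OF P z])
    have fnz: "f \<noteq> 0" using f(2) by auto
    have lim1: "(\<lambda>n. 1 / g n) \<longlonglongrightarrow> 1 / f"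
      by (rule tendsto_divide[OF tendsto_const tendsto_of_square_tendsto[OF 4 f(2) 3] fnz])
    have "1 / g n = cauchy_transform (P n) z" for n unfolding g_def recip_cauchy_transform_def by simp
    moreover have "1 / f = cauchy_transform arcsine_law z" unfolding f_def recip_cauchy_transform_def by simp
    ultimately show "(\<lambda>n. cauchy_transform (P n) z) \<longlonglongrightarrow> cauchy_transform arcsine_law z"
      using lim1 by (simp only:)
  qed
  then show ?thesis unfolding P_def[abs_def] using B(1) by blast
qed

section \<open>Necessity\<close>

context real_distribution
begin

text \<open>On |t| <= u = \<delta> y the denominator t^2 + y^2 is at most (1 + \<delta>^2) y^2. A
  small \<delta> brings the factor close to 1 at the price of looking at the larger scale
  u/\<delta>.\<close>

lemma truncated_second_moment_le:
  assumes u: "u > 0" and \<delta>: "\<delta> > 0"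
  shows "truncated_second_moment M u \<le> (1 + \<delta>\<^sup>2) * ((u / \<delta>)\<^sup>2 * smoothed_ratio M (u / \<delta>))"
proof -
  define y where "y = u / \<delta>"
  have y: "y > 0" "u = \<delta> * y" using u \<delta> by (auto simp: y_def)
  have "truncated_second_moment M u \<le> (\<integral>t. (1 + \<delta>\<^sup>2) * (y\<^sup>2 * (t\<^sup>2 / (t\<^sup>2 + y\<^sup>2))) \<partial>M)"
    unfolding truncated_second_moment_eq
  proof (intro integral_mono integrable_truncated_square integrable_mult_right integrable_smoothed_ratio)
    fix t :: real
    have p: "t\<^sup>2 + y\<^sup>2 > 0" using y by (simp add: sum_power2_gt_zero_iff)
    show "t\<^sup>2 * indicator {-u..u} t \<le> (1 + \<delta>\<^sup>2) * (y\<^sup>2 * (t\<^sup>2 / (t\<^sup>2 + y\<^sup>2)))"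
    proof (cases "t \<in> {-u..u}")
      case True
      then have "\<bar>t\<bar> \<le> \<bar>\<delta> * y\<bar>" using y u by auto
      then have "t\<^sup>2 \<le> (\<delta> * y)\<^sup>2" by (simp add: abs_le_square_iff)
      then have "t\<^sup>2 + y\<^sup>2 \<le> (1 + \<delta>\<^sup>2) * y\<^sup>2" by (simp add: power_mult_distrib algebra_simps)
      then have "t\<^sup>2 * (t\<^sup>2 + y\<^sup>2) \<le> t\<^sup>2 * ((1 + \<delta>\<^sup>2) * y\<^sup>2)" by (intro mult_left_mono) auto
      then have "t\<^sup>2 \<le> t\<^sup>2 * ((1 + \<delta>\<^sup>2) * y\<^sup>2) / (t\<^sup>2 + y\<^sup>2)" using p by (simp add: pos_le_divide_eq)
      then show ?thesis using True by (simp add: mult_ac)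
    qed simp
  qed
  also have "\<dots> = (1 + \<delta>\<^sup>2) * (y\<^sup>2 * smoothed_ratio M y)"
    by (simp only: smoothed_ratio_def integral_mult_right_zero)
  finally show ?thesis by (simp add: y_def)
qed

text \<open>The function y^2 t^2/(t^2 + y^2) increases with y. For |t| <= u its value at u is at
  most t^2; for |t| > u, which H does not count, its value is at most 10/3 of its increment from u
  to 2u. If doubling u hardly changes u^2 psi(u), then H(u) is nearly as large.\<close>

lemma truncated_second_moment_ge:
  assumes u: "u > 0"
  shows "u\<^sup>2 * smoothed_ratio M u - 10 / 3 * ((2 * u)\<^sup>2 * smoothed_ratio M (2 * u) - u\<^sup>2 * smoothed_ratio M u)
    \<le> truncated_second_moment M u"
proof -
  have "(\<integral>t. u\<^sup>2 * (t\<^sup>2 / (t\<^sup>2 + u\<^sup>2)) - 10 / 3 * ((2 * u)\<^sup>2 * (t\<^sup>2 / (t\<^sup>2 + (2 * u)\<^sup>2)) - u\<^sup>2 * (t\<^sup>2 / (t\<^sup>2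
    + u\<^sup>2))) \<partial>M)
    \<le> truncated_second_moment M u"
    unfolding truncated_second_moment_eq
  proof (intro integral_mono integrable_truncated_square integrable_mult_right integrable_smoothed_ratio
      Bochner_Integration.integrable_diff)
    fix t :: real
    define s v where "s = t\<^sup>2" and "v = u\<^sup>2"
    have sv: "s \<ge> 0" "v > 0" using u by (auto simp: s_def v_def)
    have d: "4 * v * (s / (s + 4 * v)) - v * (s / (s + v)) = 3 * v * s * s / ((s + 4 * v) * (s + v))"
      using sv by (simp add: divide_simps) (simp add: algebra_simps)
    have "v * (s / (s + v)) - 10 / 3 * (4 * v * (s / (s + 4 * v)) - v * (s / (s + v)))
      \<le> s * indicator {-u..u} t"
    proof (cases "t \<in> {-u..u}")
      case True
      have "3 * v * s * s / ((s + 4 * v) * (s + v)) \<ge> 0" using sv by simp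
      moreover have "v * (s / (s + v)) \<le> s"
      proof -
        have "v * s \<le> s * (s + v)" using sv by (simp add: algebra_simps)
        then show ?thesis using sv by (simp add: pos_divide_le_eq)
      qed
      ultimately have "v * (s / (s + v)) - 10 / 3 * (3 * v * s * s / ((s + 4 * v) * (s + v)))
        \<le> s * 1" by linarith
      moreover have "indicat_real {-u..u} t = 1" using True by simp
      ultimately show ?thesis by (simp only: d)
    next
      case False
      then have "\<bar>u\<bar> \<le> \<bar>t\<bar>" using u by auto
      then have "v \<le> s" by (simp add: s_def v_def abs_le_square_iff)
      \<comment> \<open>The increment is v s/(s + v) times 3 s/(s + 4 v), so this makes the second
        factor at least 3/10. The constant is generous; any fixed one serves.\<close>
      then have "s + 4 * v \<le> 10 * s" using sv by simp
      then have "v * s * (s + 4 * v) \<le> v * s * (10 * s)" using sv by (intro mult_left_mono) auto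
      then have "v * s * (s + 4 * v) / ((s + 4 * v) * (s + v)) \<le> v * s * (10 * s) / ((s + 4 * v) * (s + v))"
        using sv by (intro divide_right_mono) auto
      moreover have "v * s * (s + 4 * v) / ((s + 4 * v) * (s + v)) = v * (s / (s + v))"
        using sv by simp
      ultimately have "v * (s / (s + v)) \<le> 10 / 3 * (3 * v * s * s / ((s + 4 * v) * (s + v)))"
        by (simp add: mult_ac)
      then have "v * (s / (s + v)) - 10 / 3 * (3 * v * s * s / ((s + 4 * v) * (s + v))) \<le> s * 0" by linarith
      moreover have "indicat_real {-u..u} t = 0" using False by simp
      ultimately show ?thesis by (simp only: d)
    qed
    then show "u\<^sup>2 * (t\<^sup>2 / (t\<^sup>2 + u\<^sup>2)) - 10 / 3 * ((2 * u)\<^sup>2 * (t\<^sup>2 / (t\<^sup>2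
      + (2 * u)\<^sup>2)) - u\<^sup>2 * (t\<^sup>2 / (t\<^sup>2 + u\<^sup>2)))
      \<le> t\<^sup>2 * indicator {-u..u} t"
      by (simp add: s_def v_def power_mult_distrib)
  qed
  also have "(\<integral>t. u\<^sup>2 * (t\<^sup>2 / (t\<^sup>2 + u\<^sup>2)) - 10 / 3 * ((2 * u)\<^sup>2 * (t\<^sup>2 / (t\<^sup>2
    + (2 * u)\<^sup>2)) - u\<^sup>2 * (t\<^sup>2 / (t\<^sup>2 + u\<^sup>2))) \<partial>M)
    = u\<^sup>2 * smoothed_ratio M u - 10 / 3 * ((2 * u)\<^sup>2 * smoothed_ratio M (2 * u) - u\<^sup>2 * smoothed_ratio M u)"
    using integrable_smoothed_ratio[of u] integrable_smoothed_ratio[of "2 * u"]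
    by (simp only: smoothed_ratio_def Bochner_Integration.integral_diff integral_mult_right_zero integrable_mult_right
        Bochner_Integration.integrable_diff)
  finally show ?thesis .
qed

text \<open>The scaled quantities \<open>L l n\<close> tend to 1 for every l, so their change under
  doubling tends to 0 and the lower bound becomes 1. The upper bound becomes 1 + \<delta>^2 with
  \<delta> arbitrary.\<close>

lemma truncated_second_moment_scaled:
  assumes B: "\<And>n. B n > 0"
    and lim: "\<And>l. l > 0 \<Longrightarrow> (\<lambda>n. real n * smoothed_ratio M (l * B n)) \<longlonglongrightarrow> 1 / l\<^sup>2" and l: "l > 0"
  shows "(\<lambda>n. real n * truncated_second_moment M (l * B n) / (B n)\<^sup>2) \<longlonglongrightarrow> 1"
proof -
  define L where "L l n = real n * ((l * B n)\<^sup>2 * smoothed_ratio M (l * B n)) / (B n)\<^sup>2" for l n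
  have L: "L l \<longlonglongrightarrow> 1" if "l > 0" for l
  proof -
    have "L l = (\<lambda>n. l\<^sup>2 * (real n * smoothed_ratio M (l * B n)))"
      unfolding L_def using B by (auto simp: power_mult_distrib fun_eq_iff less_imp_neq[THEN not_sym])
    then show ?thesis using tendsto_mult[OF tendsto_const lim[OF that], of "l\<^sup>2"] that by simp
  qed
  define X where "X n = real n * truncated_second_moment M (l * B n) / (B n)\<^sup>2" for n
  have lower: "L l n - 10 / 3 * (L (2 * l) n - L l n) \<le> X n" for n
  proof -
    have p: "real n / (B n)\<^sup>2 \<ge> 0" using B[of n] by simp
    have "l * B n > 0" using l B[of n] by simp
    note ineq = mult_left_mono[OF truncated_second_moment_ge[OF this] p]
    have alg: "q * (a - 10 / 3 * (b - a)) = q * a - 10 / 3 * (q * b - q * a)" for q a b :: real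
      by (simp add: algebra_simps)
    have "L l n = real n / (B n)\<^sup>2 * ((l * B n)\<^sup>2 * smoothed_ratio M (l * B n))"
      "L (2 * l) n = real n / (B n)\<^sup>2 * ((2 * (l * B n))\<^sup>2 * smoothed_ratio M (2 * (l * B n)))"
      "X n = real n / (B n)\<^sup>2 * truncated_second_moment M (l * B n)"
      by (simp_all add: L_def X_def mult.assoc)
    then show ?thesis using ineq unfolding alg by simp
  qed
  have upper: "X n \<le> (1 + \<delta>\<^sup>2) * L (l / \<delta>) n" if "\<delta> > 0" for n \<delta>
  proof -
    have p: "real n / (B n)\<^sup>2 \<ge> 0" using B[of n] by simp
    have "l * B n > 0" using l B[of n] by simp
    from mult_left_mono[OF truncated_second_moment_le[OF this that] p]
    show ?thesis by (simp add: L_def X_def mult_ac)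
  qed
  have "X \<longlonglongrightarrow> 1"
  proof (rule order_tendstoI)
    fix a :: real assume a: "a < 1"
    have "(\<lambda>n. L l n - 10 / 3 * (L (2 * l) n - L l n)) \<longlonglongrightarrow> 1 - 10 / 3 * (1 - 1)"
      using l by (intro tendsto_intros L) auto
    then have "\<forall>\<^sub>F n in sequentially. a < L l n - 10 / 3 * (L (2 * l) n - L l n)"
      using a by (intro order_tendstoD(1)) auto
    then show "\<forall>\<^sub>F n in sequentially. a < X n"
      by eventually_elim (use lower less_le_trans in blast)
  next
    fix a :: real assume a: "1 < a"
    \<comment> \<open>Chosen so that 1 + \<delta>^2 is the midpoint of 1 and a.\<close>
    define \<delta> where "\<delta> = sqrt ((a - 1) / 2)"
    have \<delta>: "\<delta> > 0" "\<delta>\<^sup>2 = (a - 1) / 2" using a by (auto simp: \<delta>_def)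
    have lim': "(\<lambda>n. (1 + \<delta>\<^sup>2) * L (l / \<delta>) n) \<longlonglongrightarrow> (1 + \<delta>\<^sup>2) * 1"
      using l \<delta>(1) by (intro tendsto_mult tendsto_const L) auto
    have "\<forall>\<^sub>F n in sequentially. (1 + \<delta>\<^sup>2) * L (l / \<delta>) n < a"
      by (rule order_tendstoD(2)[OF lim']) (use a in \<open>simp add: \<delta>(2) field_simps\<close>)
    then show "\<forall>\<^sub>F n in sequentially. X n < a"
      by eventually_elim (use upper[OF \<delta>(1)] le_less_trans in blast)
  qed
  then show ?thesis by (simp add: X_def[abs_def])
qed

text \<open>The hypothesis speaks only of the scales l B_n. A general y is matched with n =
  floor(1/psi(y)), for which n psi(y) is of order one, and monotonicity of psi and H interpolates
  between fixed multiples of B_n.\<close>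

lemma slowly_varying_from_level:
  assumes nd: "\<not> degenerate M" and B: "\<And>n. B n > 0"
    and lim: "\<And>l. l > 0 \<Longrightarrow> (\<lambda>n. real n * smoothed_ratio M (l * B n)) \<longlonglongrightarrow> 1 / l\<^sup>2"
  shows "slowly_varying (truncated_second_moment M)"
proof -
  define H where "H = truncated_second_moment M"
  define \<psi> where "\<psi> = smoothed_ratio M"
  define m where "m y = nat \<lfloor>1 / \<psi> y\<rfloor>" for y
  have \<psi>_pos: "\<psi> y > 0" if "y > 0" for y unfolding \<psi>_def using smoothed_ratio_pos[OF nd that] .
  have \<psi>_ev: "\<forall>\<^sub>F y in at_top. \<psi> y > 0" using eventually_gt_at_top[of 0] by eventually_elim (rule \<psi>_pos)
  have inv: "filterlim (\<lambda>y. 1 / \<psi> y) at_top at_top"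
    using filterlim_inverse_at_top[OF smoothed_ratio_tendsto] \<psi>_ev by (simp add: \<psi>_def inverse_eq_divide)
  have m_lim: "filterlim m sequentially at_top"
    unfolding m_def
    by (intro filterlim_compose[OF filterlim_nat_sequentially] filterlim_compose[OF filterlim_floor_sequentially inv])
  have m: "real (m y) \<le> 1 / \<psi> y" "1 / \<psi> y < real (m y) + 1" if "y > 0" for y
  proof -
    have "1 / \<psi> y \<ge> 0" using \<psi>_pos[OF that] by simp
    then have "real (m y) = of_int \<lfloor>1 / \<psi> y\<rfloor>" by (simp add: m_def)
    then show "real (m y) \<le> 1 / \<psi> y" "1 / \<psi> y < real (m y) + 1" by linarith+
  qed
  have "\<forall>\<^sub>F n in sequentially. real n * \<psi> (2 * B n) < 1 / 2"
    unfolding \<psi>_def by (rule order_tendstoD(2)[OF lim]) auto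
  moreover have "\<forall>\<^sub>F n in sequentially. real n * \<psi> (1 / 2 * B n) > 1"
    unfolding \<psi>_def by (rule order_tendstoD(1)[OF lim]) (auto simp: power2_eq_square)
  moreover have "\<forall>\<^sub>F n in sequentially. n > 0" by (rule eventually_gt_at_top)
  ultimately have "\<forall>\<^sub>F n in sequentially. real n * \<psi> (2 * B n) < 1 / 2 \<and> real n * \<psi> (1 / 2 * B n) > 1 \<and> n > 0"
    by eventually_elim simp
  from eventually_compose_filterlim[OF this m_lim]
  have "\<forall>\<^sub>F y in at_top. real (m y) * \<psi> (2 * B (m y)) < 1 / 2 \<and> real (m y) * \<psi> (1 / 2 * B (m y)) > 1
    \<and> m y > 0" .
  \<comment> \<open>Along the sequence n psi(2 B_n) tends to 1/4 and n psi(B_n/2) to 4, while n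
    psi(y) lies in (1/2, 1]. Since psi is nonincreasing, y is trapped.\<close>
  then have sandwich: "\<forall>\<^sub>F y in at_top. 1 / 2 * B (m y) \<le> y \<and> y \<le> 2 * B (m y)"
    using eventually_gt_at_top[of 0]
  proof eventually_elim
    case (elim y)
    define n where "n = m y"
    have n: "n > 0" "real n * \<psi> (2 * B n) < 1 / 2" "real n * \<psi> (1 / 2 * B n) > 1"
      "real n \<le> 1 / \<psi> y" "1 / \<psi> y < real n + 1" using elim m[OF elim(2)] by (auto simp: n_def)
    have \<psi>y: "\<psi> y > 0" by (rule \<psi>_pos[OF elim(2)])
    have "real n * \<psi> y \<le> 1" using n(4) \<psi>y by (simp add: pos_le_divide_eq)
    moreover have "1 < (real n + 1) * \<psi> y" using n(5) \<psi>y by (simp add: pos_divide_less_eq)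
    then have "real n * \<psi> y > 1 / 2"
    proof -
      have "real n + 1 \<le> 2 * real n" using n(1) by simp
      then have "(real n + 1) * \<psi> y \<le> 2 * real n * \<psi> y" using \<psi>y by (intro mult_right_mono) auto
      with \<open>1 < (real n + 1) * \<psi> y\<close> show ?thesis by linarith
    qed
    ultimately have "real n * \<psi> (2 * B n) < real n * \<psi> y" "real n * \<psi> y < real n * \<psi> (1 / 2 * B n)"
      using n by linarith+
    then have c: "\<psi> (2 * B n) < \<psi> y" "\<psi> y < \<psi> (1 / 2 * B n)" using n(1) by auto
    have "y \<le> 2 * B n"
    proof (rule ccontr)
      assume "\<not> y \<le> 2 * B n"
      then have "\<psi> y \<le> \<psi> (2 * B n)" unfolding \<psi>_def using B[of n] by (intro smoothed_ratio_antimono) auto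
      with c show False by simp
    qed
    moreover have "1 / 2 * B n \<le> y"
    proof (rule ccontr)
      assume "\<not> 1 / 2 * B n \<le> y"
      then have "\<psi> (1 / 2 * B n) \<le> \<psi> y" unfolding \<psi>_def using elim(2) by (intro smoothed_ratio_antimono) auto
      with c show False by simp
    qed
    ultimately show ?case by (simp add: n_def)
  qed
  have X: "(\<lambda>n. real n * H (l * B n) / (B n)\<^sup>2) \<longlonglongrightarrow> 1" if "l > 0" for l
    unfolding H_def using B lim that by (rule truncated_second_moment_scaled)
  have Hpos_seq: "\<forall>\<^sub>F n in sequentially. H (l * B n) > 0" if "l > 0" for l
  proof -
    have "\<forall>\<^sub>F n in sequentially. real n * H (l * B n) / (B n)\<^sup>2 > 0"
      by (rule order_tendstoD(1)[OF X[OF that]]) simp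
    then show ?thesis
    proof eventually_elim
      case (elim n)
      then have "H (l * B n) \<noteq> 0" by auto
      then show ?case using truncated_second_moment_nonneg[of "l * B n"] by (simp add: H_def)
    qed
  qed
  have ratio: "(\<lambda>n. H (k * B n) / H (l * B n)) \<longlonglongrightarrow> 1" if "k > 0" "l > 0" for k l
  proof -
    have 1: "(\<lambda>n. (real n * H (k * B n) / (B n)\<^sup>2) / (real n * H (l * B n) / (B n)\<^sup>2)) \<longlonglongrightarrow> 1 / 1"
      by (intro tendsto_divide X that) simp
    have 2: "\<forall>\<^sub>F n in sequentially. (real n * H (k * B n) / (B n)\<^sup>2) / (real n * H (l * B n) / (B n)\<^sup>2)
        = H (k * B n) / H (l * B n)"
      using eventually_gt_at_top[of 0]
    proof eventually_elim
      case (elim n)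
      have "(B n)\<^sup>2 \<noteq> 0" using B[of n] by simp
      with elim show ?case by simp
    qed
    from Lim_transform_eventually[OF 1 2] show ?thesis by simp
  qed
  have mono: "H x \<le> H y" if "x \<le> y" for x y unfolding H_def by (rule truncated_second_moment_mono[OF that])
  have Hpos_half: "\<forall>\<^sub>F y in at_top. H (1 / 2 * B (m y)) > 0"
    by (rule eventually_compose_filterlim[OF Hpos_seq m_lim]) simp
  then have Hpos: "\<forall>\<^sub>F y in at_top. H y > 0"
    using sandwich by eventually_elim (use mono less_le_trans in blast)
  have "((\<lambda>y. H (c * y) / H y) \<longlongrightarrow> 1) at_top" if c: "c > 0" for c
  proof (rule tendsto_sandwich)
    show "((\<lambda>y. H (c / 2 * B (m y)) / H (2 * B (m y))) \<longlongrightarrow> 1) at_top"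
      by (rule filterlim_compose[OF ratio m_lim]) (use c in auto)
    show "((\<lambda>y. H (2 * c * B (m y)) / H (1 / 2 * B (m y))) \<longlongrightarrow> 1) at_top"
      by (rule filterlim_compose[OF ratio m_lim]) (use c in auto)
    show "\<forall>\<^sub>F y in at_top. H (c / 2 * B (m y)) / H (2 * B (m y)) \<le> H (c * y) / H y"
      using sandwich Hpos
    proof eventually_elim
      case (elim y)
      have "c * (1 / 2 * B (m y)) \<le> c * y" using elim c by (intro mult_left_mono) auto
      then show ?case using elim
        by (intro frac_le mono truncated_second_moment_nonneg[folded H_def]) auto
    qed
    show "\<forall>\<^sub>F y in at_top. H (c * y) / H y \<le> H (2 * c * B (m y)) / H (1 / 2 * B (m y))"
      using sandwich Hpos_half
    proof eventually_elim
      case (elim y)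
      have "c * y \<le> c * (2 * B (m y))" using elim c by (intro mult_left_mono) auto
      then show ?case using elim
        by (intro frac_le mono truncated_second_moment_nonneg[folded H_def]) (auto simp: mult_ac)
    qed
  qed
  then show ?thesis
    using Hpos truncated_second_moment_measurable by (simp add: slowly_varying_def H_def)
qed

text \<open>The difference z^2 G(z) - z is the integral of t z/(z - t). On the imaginary axis |z/(z
  - t)| <= 1, so |t| dominates the integrand.\<close>

lemma mean_tendsto:
  assumes t: "integrable M (\<lambda>t. t)" and B: "\<And>n. B n > 0" "filterlim B at_top sequentially"
  shows "(\<lambda>n. (\<i> * of_real (B n))\<^sup>2 * cauchy_transform M (\<i> * of_real (B n)) - \<i> * of_real (B n))
    \<longlonglongrightarrow> of_real (\<integral>t. t \<partial>M)"
proof -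
  define z where "z n = \<i> * complex_of_real (B n)" for n
  have z: "Im (z n) > 0" "norm (z n) = Im (z n)" for n using B(1)[of n] by (auto simp: z_def norm_mult)
  have bd: "norm (z n * cauchy_kernel (z n) t) \<le> 1" for n t
  proof -
    have "norm (z n * cauchy_kernel (z n) t) \<le> norm (z n) * (1 / Im (z n))"
      unfolding norm_mult by (intro mult_left_mono norm_cauchy_kernel_le z) auto
    then show ?thesis using z[of n] by simp
  qed
  have eq: "z n * z n * cauchy_kernel (z n) t - z n = of_real t * (z n * cauchy_kernel (z n) t)" for n t
  proof -
    have "z n * z n * cauchy_kernel (z n) t - z n = z n * (z n * cauchy_kernel (z n) t - 1)"
      by (simp add: right_diff_distrib mult.assoc)
    then show ?thesis unfolding cauchy_kernel_mult_id[OF z(1), symmetric] by (simp add: mult_ac)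
  qed
  have "(\<lambda>n. \<integral>t. of_real t * (z n * cauchy_kernel (z n) t) \<partial>M) \<longlonglongrightarrow> (\<integral>t. complex_of_real t \<partial>M)"
  proof (rule integral_dominated_convergence[where w="\<lambda>t. \<bar>t\<bar>"])
    show "integrable M (\<lambda>t. \<bar>t\<bar>)" using t by simp
    show "AE t in M. norm (of_real t * (z n * cauchy_kernel (z n) t)) \<le> \<bar>t\<bar>" for n
    proof (intro AE_I2)
      fix t
      show "norm (of_real t * (z n * cauchy_kernel (z n) t)) \<le> \<bar>t\<bar>"
        using mult_left_mono[OF bd[of n t], of "\<bar>t\<bar>"] by (simp add: norm_mult)
    qed
    show "AE t in M. (\<lambda>n. of_real t * (z n * cauchy_kernel (z n) t)) \<longlonglongrightarrow> of_real t"
    proof (intro AE_I2)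
      fix t :: real
      have "(\<lambda>n. of_real t * cauchy_kernel (z n) t) \<longlonglongrightarrow> 0"
      proof (rule Lim_null_comparison)
        have "(\<lambda>n. \<bar>t\<bar> * inverse (B n)) \<longlonglongrightarrow> \<bar>t\<bar> * 0"
          by (intro tendsto_mult tendsto_const filterlim_compose[OF tendsto_inverse_0_at_top B(2)]) 
             (rule filterlim_ident)
        then show "(\<lambda>n. \<bar>t\<bar> * inverse (B n)) \<longlonglongrightarrow> 0" by simp
        have "norm (of_real t * cauchy_kernel (z n) t) \<le> \<bar>t\<bar> * inverse (B n)" for n
          using mult_left_mono[OF norm_cauchy_kernel_le[OF z(1)[of n], of t], of "\<bar>t\<bar>"]
          by (simp add: norm_mult z_def inverse_eq_divide)
        then show "\<forall>\<^sub>F n in sequentially. norm (of_real t * cauchy_kernel (z n) t)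
          \<le> \<bar>t\<bar> * inverse (B n)" by simp
      qed
      then have "(\<lambda>n. of_real t * (1 + of_real t * cauchy_kernel (z n) t)) \<longlonglongrightarrow> of_real t * (1 + 0)"
        by (intro tendsto_intros)
      then show "(\<lambda>n. of_real t * (z n * cauchy_kernel (z n) t)) \<longlonglongrightarrow> of_real t"
        unfolding cauchy_kernel_mult_id[OF z(1)] by simp
    qed
  qed auto
  moreover have "(\<integral>t. of_real t * (z n * cauchy_kernel (z n) t) \<partial>M)
    = (z n)\<^sup>2 * cauchy_transform M (z n) - z n" for n
    unfolding eq[symmetric]
    using integrable_cauchy_kernel[OF z(1)[of n]] by (simp add: cauchy_transform_kernel power2_eq_square)
  ultimately show ?thesis by (simp add: z_def)
qed

end

text \<open>The divided difference of F at z'_n and z, taken for the measure \<open>P n\<close>,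
  tends to the derivative of the limiting F at z. Lipschitz bounds that do not depend on the measure
  allow the point to move with n.\<close>

lemma recip_diff_quotient_tendsto:
  fixes P :: "nat \<Rightarrow> real measure"
  assumes P: "\<And>n. real_distribution (P n)" and M: "real_distribution M" and w: "weak_conv_m P M"
    and z: "Im z > 0" and z': "\<And>n. Im (z' n) \<ge> Im z" "z' \<longlonglongrightarrow> z"
  shows "(\<lambda>n. (\<integral>t. cauchy_kernel (z' n) t * cauchy_kernel z t \<partial>P n) / (cauchy_transform (P n) (z' n)
    * cauchy_transform (P n) z))
    \<longlonglongrightarrow> (\<integral>t. cauchy_kernel z t * cauchy_kernel z t \<partial>M) / (cauchy_transform M z * cauchy_transform M z)"
proof -
  define y where "y = Im z"
  have y: "y > 0" "\<And>n. Im (z' n) \<ge> y" "\<And>n. Im (z' n) > 0" using z z'(1)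
    by (auto simp: y_def intro: less_le_trans)
  have d0: "(\<lambda>n. norm (z' n - z)) \<longlonglongrightarrow> 0" using z'(2) by (simp add: tendsto_norm_zero LIM_zero)
  have le: "1 / Im (z' n) \<le> 1 / y" for n using y(1,2) by (intro divide_left_mono) (auto intro: mult_pos_pos y(3))
  have G0: "(\<lambda>n. cauchy_transform (P n) z) \<longlonglongrightarrow> cauchy_transform M z"
    by (rule weak_conv_cauchy_transform[OF P M w z])
  have S0: "(\<lambda>n. \<integral>t. cauchy_kernel z t * cauchy_kernel z t \<partial>P n)
    \<longlonglongrightarrow> (\<integral>t. cauchy_kernel z t * cauchy_kernel z t \<partial>M)"
    by (rule weak_conv_cauchy_kernel_mult[OF P M w z z])
  have "(\<lambda>n. (\<integral>t. cauchy_kernel (z' n) t * cauchy_kernel z t \<partial>P n)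
    - (\<integral>t. cauchy_kernel z t * cauchy_kernel z t \<partial>P n)) \<longlonglongrightarrow> 0"
  proof (rule Lim_null_comparison)
    show "(\<lambda>n. norm (z' n - z) * (1 / y * (1 / y * (1 / y)))) \<longlonglongrightarrow> 0"
      using tendsto_mult_right[OF d0, of "1 / y * (1 / y * (1 / y))"] by (simp only: mult_zero_left)
    have "norm ((\<integral>t. cauchy_kernel (z' n) t * cauchy_kernel z t \<partial>P n)
      - (\<integral>t. cauchy_kernel z t * cauchy_kernel z t \<partial>P n))
      \<le> norm (z' n - z) * (1 / y * (1 / y * (1 / y)))" for n
    proof -
      have "norm ((\<integral>t. cauchy_kernel (z' n) t * cauchy_kernel z t \<partial>P n)
        - (\<integral>t. cauchy_kernel z t * cauchy_kernel z t \<partial>P n))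
        \<le> norm (z' n - z) * (1 / Im (z' n) * (1 / Im z * (1 / Im z)))"
        by (rule real_distribution.norm_integral_cauchy_kernel_mult_diff_le[OF P z y(3) z])
      also have "\<dots> \<le> norm (z' n - z) * (1 / y * (1 / y * (1 / y)))"
        using le[of n] y by (intro mult_left_mono mult_mono) (auto simp: y_def)
      finally show ?thesis .
    qed
    then show "\<forall>\<^sub>F n in sequentially. norm ((\<integral>t. cauchy_kernel (z' n) t * cauchy_kernel z t \<partial>P n)
      - (\<integral>t. cauchy_kernel z t * cauchy_kernel z t \<partial>P n))
      \<le> norm (z' n - z) * (1 / y * (1 / y * (1 / y)))" by simp
  qed
  from tendsto_add[OF this S0]
  have S: "(\<lambda>n. \<integral>t. cauchy_kernel (z' n) t * cauchy_kernel z t \<partial>P n)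
    \<longlonglongrightarrow> (\<integral>t. cauchy_kernel z t * cauchy_kernel z t \<partial>M)"
    by simp
  have "(\<lambda>n. cauchy_transform (P n) (z' n) - cauchy_transform (P n) z) \<longlonglongrightarrow> 0"
  proof (rule Lim_null_comparison)
    show "(\<lambda>n. norm (z' n - z) * (1 / y * (1 / y))) \<longlonglongrightarrow> 0"
      using tendsto_mult_right[OF d0, of "1 / y * (1 / y)"] by (simp only: mult_zero_left)
    have "norm (cauchy_transform (P n) (z' n) - cauchy_transform (P n) z)
      \<le> norm (z' n - z) * (1 / y * (1 / y))" for n
    proof -
      interpret real_distribution "P n" by (rule P)
      have "norm (\<integral>t. cauchy_kernel (z' n) t * cauchy_kernel z t \<partial>P n) \<le> 1 / Im (z' n) * (1 / Im z)"
      proof (rule order_trans[OF integral_norm_bound], rule integral_le_const)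
        show "integrable (P n) (\<lambda>t. norm (cauchy_kernel (z' n) t * cauchy_kernel z t))"
          by (intro integrable_norm integrable_cauchy_kernel_mult y z)
        show "AE t in P n. norm (cauchy_kernel (z' n) t * cauchy_kernel z t) \<le> 1 / Im (z' n) * (1 / Im z)"
          using norm_cauchy_kernel_mult_le[OF y(3) z] by simp
      qed
      also have "\<dots> \<le> 1 / y * (1 / y)" using le[of n] y by (intro mult_mono) (auto simp: y_def)
      finally have "norm (z - z' n) * norm (\<integral>t. cauchy_kernel (z' n) t * cauchy_kernel z t \<partial>P n)
        \<le> norm (z - z' n) * (1 / y * (1 / y))"
        by (intro mult_left_mono) auto
      then show ?thesis by (simp add: cauchy_transform_diff[OF y(3) z] norm_mult norm_minus_commute)
    qed
    then show "\<forall>\<^sub>F n in sequentially. norm (cauchy_transform (P n) (z' n) - cauchy_transform (P n) z)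
      \<le> norm (z' n - z) * (1 / y * (1 / y))"
      by simp
  qed
  from tendsto_add[OF this G0]
  have G: "(\<lambda>n. cauchy_transform (P n) (z' n)) \<longlonglongrightarrow> cauchy_transform M z" by simp
  show ?thesis
    using real_distribution.cauchy_transform_nonzero[OF M z] by (intro tendsto_divide tendsto_mult S G G0) simp
qed

section \<open>The normalising constants tend to infinity\<close>

context real_distribution
begin

text \<open>The smoothed ratio is nonincreasing, so y |G(iy)| >= -Im G(i) for y >= 1. A bound at the
  fixed point \<i>, where weak convergence gives information, thus carries over to starting points
  that vary with n.\<close>

lemma norm_recip_le_at_unit:
  assumes y: "y \<ge> 1"
  shows "norm (recip_cauchy_transform M (\<i> * of_real y)) * - Im (cauchy_transform M \<i>) \<le> y"
proof -
  define G where "G = cauchy_transform M (\<i> * of_real y)"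
  have y0: "y > 0" using y by simp
  have "- Im (cauchy_transform M \<i>) = 1 - smoothed_ratio M 1" using smoothed_ratio_eq[of 1] by simp
  also have "\<dots> \<le> 1 - smoothed_ratio M y" using smoothed_ratio_antimono[of 1 y] y by simp
  also have "\<dots> = y * (- Im G)" using smoothed_ratio_eq[OF y0] by (simp add: G_def)
  also have "\<dots> \<le> y * norm G" using abs_Im_le_cmod[of G] y0 by (intro mult_left_mono) auto
  finally have 1: "- Im (cauchy_transform M \<i>) \<le> y * norm G" .
  have "G \<noteq> 0" unfolding G_def using y0 by (intro cauchy_transform_nonzero) simp
  then have p: "norm G > 0" by simp
  have "norm (recip_cauchy_transform M (\<i> * of_real y)) = 1 / norm G"
    by (simp add: recip_cauchy_transform_def G_def norm_divide)
  with mult_left_mono[OF 1, of "1 / norm G"] p show ?thesis by simp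
qed

end

text \<open>If the normalising constants stayed bounded along a subsequence, the orbit of a point
  would return to a compact set infinitely often, and each visit raises the imaginary part by a
  fixed amount, although the imaginary parts are bounded.\<close>

lemma normalisation_at_top:
  assumes \<mu>: "real_distribution \<mu>" and nd: "\<not> degenerate \<mu>" and B: "\<And>n. B n > 0"
    and M: "real_distribution M"
    and w: "weak_conv_m (\<lambda>n. dilation (1 / B n) (monotone_conv_power \<mu> n)) M"
  shows "filterlim B at_top sequentially"
proof (rule ccontr)
  interpret real_distribution \<mu> by fact
  assume "\<not> filterlim B at_top sequentially"
  then obtain C0 where "\<not> (\<forall>\<^sub>F n in sequentially. C0 \<le> B n)" by (auto simp: filterlim_at_top)
  then have "\<exists>\<^sub>F n in sequentially. \<not> C0 \<le> B n" by (simp add: not_eventually)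
  then have freq0: "\<exists>\<^sub>F n in sequentially. B n \<le> C0" by (rule frequently_elim1) simp
  define C where "C = max C0 1"
  have C: "C > 0" "C0 \<le> C" by (auto simp: C_def)
  define P where "P n = dilation (1 / B n) (monotone_conv_power \<mu> n)" for n
  have P: "real_distribution (P n)" for n unfolding P_def
    by (intro real_distribution.real_distribution_dilation real_distribution_monotone_conv_power \<mu>)
  define \<kappa> where "\<kappa> = - Im (cauchy_transform M \<i>) / 2"
  have \<kappa>: "\<kappa> > 0" using real_distribution.Im_cauchy_transform_neg[OF M, of \<i>] by (simp add: \<kappa>_def)
  have "(\<lambda>n. - Im (cauchy_transform (P n) \<i>)) \<longlonglongrightarrow> - Im (cauchy_transform M \<i>)"
    by (intro tendsto_intros weak_conv_cauchy_transform[OF P M w[folded P_def]]) simp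
  then have ev: "\<forall>\<^sub>F n in sequentially. - Im (cauchy_transform (P n) \<i>) > \<kappa>"
    using \<kappa> by (intro order_tendstoD(1)) (auto simp: \<kappa>_def)
  \<comment> \<open>The unscaled orbit of one fixed point, so that the times n with bounded B_n can
    be compared with each other.\<close>
  define u where "u n = (recip_cauchy_transform \<mu> ^^ n) (\<i> * of_real C)" for n
  define D where "D = C / \<kappa>"
  have iC: "Im (\<i> * of_real C) > 0" using C by simp
  have u_ge: "Im (u n) \<ge> C" for n
    using Im_recip_cauchy_transform_funpow(2)[OF iC order_refl, of n] by (simp add: u_def)
  have freq: "\<exists>\<^sub>F n in sequentially. norm (u n) \<le> D"
    using frequently_eventually_conj[OF freq0 ev]
  proof (rule frequently_elim1, elim conjE)
    fix n assume n: "- Im (cauchy_transform (P n) \<i>) > \<kappa>" "B n \<le> C0"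
    \<comment> \<open>As B_n <= C, the rescaled starting point iC/B_n lies at or above \<i> on the
      axis, where the preceding bound applies.\<close>
    have y: "C / B n \<ge> 1" using n(2) C B[of n] by (simp add: pos_le_divide_eq)
    have b: "1 / B n > 0" using B[of n] by simp
    have "recip_cauchy_transform (P n) (\<i> * of_real (C / B n)) = of_real (1 / B n) * u n"
      using real_distribution.recip_cauchy_transform_dilation[OF real_distribution_monotone_conv_power[OF \<mu>] b, of n "\<i> * of_real (C / B n)"]
        recip_cauchy_transform_monotone_conv_power[OF \<mu> iC, of n] B[of n]
      by (simp add: P_def u_def)
    then have eq: "norm (recip_cauchy_transform (P n) (\<i> * of_real (C / B n))) = norm (u n) / B n"
      using B[of n] by (simp add: norm_divide)
    have "norm (u n) / B n * \<kappa> \<le> norm (u n) / B n * - Im (cauchy_transform (P n) \<i>)"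
      using n(1) B[of n] by (intro mult_left_mono) auto
    also have "\<dots> \<le> C / B n"
      using real_distribution.norm_recip_le_at_unit[OF P y, of n] unfolding eq .
    finally have "norm (u n) * \<kappa> \<le> C" using B[of n] by (simp add: divide_le_cancel)
    then show "norm (u n) \<le> D" using \<kappa> by (simp add: D_def pos_le_divide_eq)
  qed
  have u_mono: "Im (u m) \<le> Im (u n)" if "m \<le> n" for m n
    unfolding u_def by (rule Im_recip_cauchy_transform_funpow(1)[OF iC that])
  have "Im (u n) \<le> D" for n
  proof -
    from frequently_eventually_conj[OF freq eventually_ge_at_top[of n]]
    obtain m where "n \<le> m" "norm (u m) \<le> D" using frequently_ex by blast
    then show ?thesis using u_mono[of n m] abs_Im_le_cmod[of "u m"] by linarith
  qed
  then have bd: "\<forall>n. Im (u n) \<le> D" by blast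
  have "incseq (\<lambda>n. Im (u n))" unfolding incseq_def using u_mono by blast
  from incseq_convergent[OF this bd] obtain I where I: "(\<lambda>n. Im (u n)) \<longlonglongrightarrow> I" by blast
  \<comment> \<open>Heights that increase and stay bounded have increments tending to 0, and the
    increment at time n is Im A at \<open>u n\<close>.\<close>
  have "(\<lambda>n. Im (u (Suc n)) - Im (u n)) \<longlonglongrightarrow> I - I"
    by (intro tendsto_diff I LIMSEQ_Suc)
  then have lim0: "(\<lambda>n. Im (recip_shift \<mu> (u n))) \<longlonglongrightarrow> 0"
    by (simp add: u_def recip_shift_def)
  \<comment> \<open>Bounds the Harnack factor between iC and any point of height at least C and norm
    at most D, hence at every visit to the compact set.\<close>
  define c where "c = (1 + (D + C) / C)\<^sup>2"
  have D: "D > 0" using C \<kappa> by (simp add: D_def)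
  have c: "c > 0" unfolding c_def using C D by (intro zero_less_power add_pos_pos) auto
  define a where "a = Im (recip_shift \<mu> (\<i> * of_real C))"
  have a: "a > 0" unfolding a_def by (rule recip_shift_strict[OF iC nd])
  have "\<forall>\<^sub>F n in sequentially. Im (recip_shift \<mu> (u n)) < a / c"
    using a c by (intro order_tendstoD(2)[OF lim0]) simp
  from frequently_eventually_conj[OF freq this]
  obtain n where n: "Im (recip_shift \<mu> (u n)) < a / c" "norm (u n) \<le> D" using frequently_ex by blast
  have un: "Im (u n) > 0" using u_ge[of n] C by simp
  have "hyp_gap (u n) (\<i> * of_real C) \<le> norm (u n - \<i> * of_real C) / C"
    by (rule hyp_gap_le) (use C u_ge in auto)
  also have "\<dots> \<le> (D + C) / C"
    using norm_triangle_ineq4[of "u n" "\<i> * of_real C"] n(2) C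
    by (intro divide_right_mono) (auto simp: norm_mult)
  finally have "(1 + hyp_gap (u n) (\<i> * of_real C))\<^sup>2 \<le> c"
    unfolding c_def using hyp_gap_nonneg[OF un iC] by (intro power_mono) auto
  then have "a \<le> c * Im (recip_shift \<mu> (u n))"
    unfolding a_def
    using recip_shift_harnack[OF un iC] mult_right_mono[OF _ Im_recip_shift_nonneg[OF un]]
      by (meson order_trans)
  with n(1) c show False by (simp add: pos_less_divide_eq mult.commute)
qed

text \<open>With $f = F_\gamma$ and $g_n = f_n^{\circ n} \to f$, the maps $f_n$ and $g_n$ commute. Linearising
  $g_n(z + A_n(z)) = g_n(z) + A_n(g_n(z))$ in the small displacement $A_n = f_n - \mathrm{id}$ gives
  $f(z) A_n(f(z)) \approx z A_n(z)$. Along the $f$-orbits of two points, which approach each other while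
  escaping to infinity, this forces $z A_n(z)$ to be asymptotically constant.\<close>

locale arcsine_scaling =
  fixes N :: "nat \<Rightarrow> real measure" and P :: "nat \<Rightarrow> real measure"
  assumes N: "\<And>n. real_distribution (N n)" and P: "\<And>n. real_distribution (P n)"
    and P_eq: "\<And>n z. Im z > 0 \<Longrightarrow> recip_cauchy_transform (P n) z = (recip_cauchy_transform (N n) ^^ n) z"
    and P_conv: "weak_conv_m P arcsine_law"
    and shift_pos: "\<And>n z. Im z > 0 \<Longrightarrow> Im (recip_shift (N n) z) > 0"
    and shift0: "(\<lambda>n. recip_shift (N n) \<i>) \<longlonglongrightarrow> 0"
begin

definition f :: "complex \<Rightarrow> complex" where "f = recip_cauchy_transform arcsine_law"
text \<open>Normalises the displacement by its own size at \<i>, since the rate 1/n is not known in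
  advance; it is recovered in \<open>n_eps_tendsto\<close>.\<close>

definition \<epsilon> :: "nat \<Rightarrow> real" where "\<epsilon> n = norm (recip_shift (N n) \<i>)"
definition a :: "nat \<Rightarrow> complex \<Rightarrow> complex" where "a n z = recip_shift (N n) z / of_real (\<epsilon> n)"

lemma f_props: "Im z > 0 \<Longrightarrow> (f z)\<^sup>2 = z\<^sup>2 - 2" "Im z > 0 \<Longrightarrow> Im (f z) > 0"
  unfolding f_def by (rule recip_cauchy_transform_arcsine; assumption)+

lemma \<epsilon>_pos: "\<epsilon> n > 0"
  using shift_pos[of \<i> n] by (auto simp: \<epsilon>_def)

lemma \<epsilon>_lim: "\<epsilon> \<longlonglongrightarrow> 0"
  unfolding \<epsilon>_def[abs_def] by (rule tendsto_norm_zero[OF shift0])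

lemma Im_a: "Im (a n z) = Im (recip_shift (N n) z) / \<epsilon> n" and norm_a: "norm (a n z)
  = norm (recip_shift (N n) z) / \<epsilon> n"
  using \<epsilon>_pos[of n] by (simp_all add: a_def norm_divide)

lemma Im_a_nonneg: "Im z > 0 \<Longrightarrow> Im (a n z) \<ge> 0"
  unfolding Im_a using shift_pos[of z n] \<epsilon>_pos[of n] by simp

lemma norm_a_i: "norm (a n \<i>) = 1"
  using \<epsilon>_pos[of n] by (simp add: norm_a) (simp add: \<epsilon>_def)

lemma norm_a_le: "Im z > 0 \<Longrightarrow> norm (a n z) \<le> (1 + hyp_gap \<i> z)\<^sup>2"
  unfolding norm_a using real_distribution.norm_recip_shift_le[OF N, of \<i> z n] \<epsilon>_pos[of n]
  by (simp add: pos_divide_le_eq) (simp add: \<epsilon>_def)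

lemma norm_a_diff_le:
  assumes z: "Im z > 0" and w: "Im w > 0"
  shows "norm (a n z - a n w) \<le> hyp_gap z w * sqrt (norm (a n z) * norm (a n w))"
proof -
  have e: "\<epsilon> n > 0" by (rule \<epsilon>_pos)
  have "norm (a n z - a n w) = norm (recip_shift (N n) z - recip_shift (N n) w) / \<epsilon> n"
    using e by (simp add: a_def diff_divide_distrib[symmetric] norm_divide)
  also have "\<dots> \<le> hyp_gap z w * sqrt (Im (recip_shift (N n) z) * Im (recip_shift (N n) w)) / \<epsilon> n"
    using real_distribution.norm_recip_shift_diff_le[OF N z w] e by (intro divide_right_mono) auto
  also have "\<dots> = hyp_gap z w * sqrt (Im (a n z) * Im (a n w))"
    unfolding Im_a using e by (simp add: real_sqrt_divide)
  also have "\<dots> \<le> hyp_gap z w * sqrt (norm (a n z) * norm (a n w))"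
    using hyp_gap_nonneg[OF z w] Im_a_nonneg[OF z, of n] Im_a_nonneg[OF w, of n]
      abs_Im_le_cmod[of "a n z"] abs_Im_le_cmod[of "a n w"]
    by (intro mult_left_mono real_sqrt_le_mono mult_mono) auto
  finally show ?thesis .
qed

lemma shift_tendsto:
  assumes z: "Im z > 0" shows "(\<lambda>n. recip_shift (N n) z) \<longlonglongrightarrow> 0"
proof (rule Lim_null_comparison)
  show "\<forall>\<^sub>F n in sequentially. norm (recip_shift (N n) z) \<le> (1 + hyp_gap \<i> z)\<^sup>2 * \<epsilon> n"
    unfolding \<epsilon>_def using real_distribution.norm_recip_shift_le[OF N _ z, of \<i>] by simp
  show "(\<lambda>n. (1 + hyp_gap \<i> z)\<^sup>2 * \<epsilon> n) \<longlonglongrightarrow> 0"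
    using tendsto_mult_left[OF \<epsilon>_lim, of "(1 + hyp_gap \<i> z)\<^sup>2"] by simp
qed

lemma g_tendsto:
  assumes z: "Im z > 0" shows "(\<lambda>n. recip_cauchy_transform (P n) z) \<longlonglongrightarrow> f z"
  unfolding f_def recip_cauchy_transform_def
  using real_distribution.cauchy_transform_nonzero[OF real_distribution_arcsine z]
  by (intro tendsto_divide tendsto_const weak_conv_cauchy_transform[OF P real_distribution_arcsine P_conv z])

text \<open>The approximate equation A_n(f(z)) = f'(z) A_n(z) with f'(z) = z/f(z), divided by the
  norm of A_n(i). It says that z a_n(z) is asymptotically invariant under f.\<close>

lemma commutation:
  assumes z: "Im z > 0"
  shows "(\<lambda>n. f z * a n (f z) - z * a n z) \<longlonglongrightarrow> 0"
proof -
  define g where "g n = recip_cauchy_transform (P n) z" for n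
  define z' where "z' n = recip_cauchy_transform (N n) z" for n
  define q where "q n = (\<integral>t. cauchy_kernel (z' n) t * cauchy_kernel z t \<partial>P n)
    / (cauchy_transform (P n) (z' n) * cauchy_transform (P n) z)" for n
  have z': "Im (z' n) \<ge> Im z" "Im (z' n) > 0" for n
    using real_distribution.Im_recip_cauchy_transform_ge[OF N z] real_distribution.Im_recip_cauchy_transform_pos[OF N z]
    by (auto simp: z'_def)
  have g: "Im (g n) > 0" for n unfolding g_def by (rule real_distribution.Im_recip_cauchy_transform_pos[OF P z])
  have fz: "Im (f z) > 0" by (rule f_props(2)[OF z])
  have z'_eq: "z' n - z = recip_shift (N n) z" for n by (simp add: z'_def recip_shift_def)
  have "(\<lambda>n. z + recip_shift (N n) z) \<longlonglongrightarrow> z + 0" by (intro tendsto_intros shift_tendsto z)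
  then have z'_lim: "z' \<longlonglongrightarrow> z" by (simp add: z'_def[abs_def] recip_shift_def)
  \<comment> \<open>Exact for each n: F of \<open>P n\<close> commutes with F of \<open>N n\<close>,
    and \<open>q n\<close> is the divided difference of the former at z'_n and z.\<close>
  have A: "recip_shift (N n) (g n) = recip_shift (N n) z * q n" for n
  proof -
    have "recip_cauchy_transform (N n) (g n) = recip_cauchy_transform (P n) (z' n)"
    proof -
      have "recip_cauchy_transform (P n) (z' n) = (recip_cauchy_transform (N n) ^^ n) (z' n)"
        by (rule P_eq[OF z'(2)])
      then show ?thesis unfolding g_def P_eq[OF z] by (simp add: z'_def funpow_swap1)
    qed
    then have "recip_shift (N n) (g n) = recip_cauchy_transform (P n) (z' n) - recip_cauchy_transform (P n) z"
      by (simp add: recip_shift_def g_def)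
    also have "\<dots> = (z' n - z) * q n"
      unfolding q_def by (rule real_distribution.recip_cauchy_transform_diff[OF P z'(2) z])
    finally show ?thesis by (simp add: z'_eq)
  qed
  define G where "G = cauchy_transform arcsine_law z"
  have Gnz: "G \<noteq> 0" unfolding G_def by (rule real_distribution.cauchy_transform_nonzero[OF real_distribution_arcsine z])
  have fG: "f z = 1 / G" by (simp add: f_def G_def recip_cauchy_transform_def)
  \<comment> \<open>This is f'(z) = z/f(z), obtained from the differential and the algebraic
    equation for G.\<close>
  have "(\<integral>t. cauchy_kernel z t * cauchy_kernel z t \<partial>arcsine_law) / (G * G) = z * G"
  proof -
    have 1: "(z\<^sup>2 - 2) * G\<^sup>2 = 1" unfolding G_def by (rule cauchy_transform_arcsine[OF z])
    have 2: "(z\<^sup>2 - 2) * (\<integral>t. cauchy_kernel z t * cauchy_kernel z t \<partial>arcsine_law) = z * G"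
      unfolding G_def by (rule arcsine_cauchy_kernel_square[OF z])
    have "(\<integral>t. cauchy_kernel z t * cauchy_kernel z t \<partial>arcsine_law)
      = ((z\<^sup>2 - 2) * (\<integral>t. cauchy_kernel z t * cauchy_kernel z t \<partial>arcsine_law)) * G\<^sup>2"
      using 1 by (metis mult.commute mult.left_commute mult.right_neutral)
    then show ?thesis unfolding 2 using Gnz by (simp add: power2_eq_square)
  qed
  then have q_lim: "q \<longlonglongrightarrow> z * G"
    using recip_diff_quotient_tendsto[OF P real_distribution_arcsine P_conv z z'(1) z'_lim]
    by (simp add: q_def[abs_def] G_def)
  have "(\<lambda>n. f z * q n - z) \<longlonglongrightarrow> f z * (z * G) - z" by (intro tendsto_intros q_lim)
  then have q0: "(\<lambda>n. f z * q n - z) \<longlonglongrightarrow> 0" using Gnz by (simp add: fG)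
  have g_lim: "g \<longlonglongrightarrow> f z" unfolding g_def[abs_def] by (rule g_tendsto[OF z])
  \<comment> \<open>The displacement was evaluated at g_n rather than at f(z). The hyperbolic gap
    between these points tends to 0, and the bound for the change of a_n is uniform in n.\<close>
  have gap0: "(\<lambda>n. hyp_gap (f z) (g n)) \<longlonglongrightarrow> 0"
  proof -
    have "(\<lambda>n. hyp_gap (f z) (g n)) \<longlonglongrightarrow> norm (f z - f z) / sqrt (Im (f z) * Im (f z))"
      unfolding hyp_gap_def using fz by (intro tendsto_intros g_lim) auto
    then show ?thesis by simp
  qed
  define K where "K = (1 + hyp_gap \<i> (f z))\<^sup>2"
  define M where "M = (1 + hyp_gap \<i> z)\<^sup>2"
  have "(\<lambda>n. norm (f z) * (hyp_gap (f z) (g n) * (1 + hyp_gap (f z) (g n)) * K) + norm (f z * q n - z) * M)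
    \<longlonglongrightarrow> norm (f z) * (0 * (1 + 0) * K) + norm (0::complex) * M"
    by (intro tendsto_intros gap0 q0)
  then have lim0: "(\<lambda>n. norm (f z) * (hyp_gap (f z) (g n) * (1 + hyp_gap (f z) (g n)) * K)
    + norm (f z * q n - z) * M) \<longlonglongrightarrow> 0"
    by simp
  show ?thesis
  proof (rule Lim_null_comparison[OF _ lim0], rule always_eventually, rule allI)
    fix n
    have ag: "a n (g n) = a n z * q n" by (simp add: a_def A)
    have "f z * a n (f z) - z * a n z = f z * (a n (f z) - a n (g n)) + (f z * q n - z) * a n z"
      unfolding ag by (simp add: algebra_simps)
    also have "norm \<dots> \<le> norm (f z) * (hyp_gap (f z) (g n) * (1 + hyp_gap (f z) (g n)) * K)
      + norm (f z * q n - z) * M"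
    proof (rule norm_triangle_mono)
      have "norm (a n (f z) - a n (g n)) = norm (recip_shift (N n) (g n) - recip_shift (N n) (f z)) / \<epsilon> n"
        using \<epsilon>_pos[of n] by (simp add: a_def diff_divide_distrib[symmetric] norm_divide norm_minus_commute)
      also have "\<dots> \<le> hyp_gap (f z) (g n) * (1 + hyp_gap (f z) (g n)) * Im (recip_shift (N n) (f z)) / \<epsilon> n"
        using real_distribution.norm_recip_shift_diff_le'[OF N fz g] \<epsilon>_pos[of n]
          by (intro divide_right_mono) auto
      also have "\<dots> = hyp_gap (f z) (g n) * (1 + hyp_gap (f z) (g n)) * Im (a n (f z))" by (simp add: Im_a)
      also have "\<dots> \<le> hyp_gap (f z) (g n) * (1 + hyp_gap (f z) (g n)) * K"
        using norm_a_le[OF fz, of n] abs_Im_le_cmod[of "a n (f z)"] hyp_gap_nonneg[OF fz g, of n]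
        by (intro mult_left_mono mult_nonneg_nonneg) (auto simp: K_def)
      finally show "norm (f z * (a n (f z) - a n (g n)))
        \<le> norm (f z) * (hyp_gap (f z) (g n) * (1 + hyp_gap (f z) (g n)) * K)"
        unfolding norm_mult by (rule mult_left_mono) simp
      show "norm ((f z * q n - z) * a n z) \<le> norm (f z * q n - z) * M"
        unfolding norm_mult M_def by (intro mult_left_mono norm_a_le z) simp
    qed
    finally show "norm (f z * a n (f z) - z * a n z)
      \<le> norm (f z) * (hyp_gap (f z) (g n) * (1 + hyp_gap (f z) (g n)) * K) + norm (f z * q n - z) * M" .
  qed
qed

section \<open>Comparison of orbits and the limit of the displacement\<close>

lemma f_funpow:
  assumes z: "Im z > 0"
  shows "Im ((f ^^ k) z) > 0" and "((f ^^ k) z)\<^sup>2 = z\<^sup>2 - 2 * of_nat k"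
proof -
  have "Im ((f ^^ k) z) > 0 \<and> ((f ^^ k) z)\<^sup>2 = z\<^sup>2 - 2 * of_nat k"
  proof (induction k)
    case (Suc k)
    then have IH: "Im ((f ^^ k) z) > 0" "((f ^^ k) z)\<^sup>2 = z\<^sup>2 - 2 * of_nat k" by auto
    show ?case using f_props(2)[OF IH(1)] by (simp add: f_props(1)[OF IH(1)] IH(2) algebra_simps)
  qed (use z in simp)
  then show "Im ((f ^^ k) z) > 0" "((f ^^ k) z)\<^sup>2 = z\<^sup>2 - 2 * of_nat k" by auto
qed

lemma commutation_funpow:
  assumes z: "Im z > 0"
  shows "(\<lambda>n. (f ^^ k) z * a n ((f ^^ k) z) - z * a n z) \<longlonglongrightarrow> 0"
proof (induction k)
  case (Suc k)
  from tendsto_add[OF commutation[OF f_funpow(1)[OF z, of k]] Suc] show ?case by simp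
qed simp

text \<open>After k steps the two squares still differ by z^2 + 1, while both points have height at
  least sqrt k. Their distance is therefore O(1/sqrt k) and their hyperbolic gap O(1/k), so the
  two-point inequality makes the values of x a_n(x) at the orbit points agree up to O(1/k),
  uniformly in n.\<close>

lemma orbit_comparison:
  assumes z: "Im z > 0" and k: "real k \<ge> (norm z)\<^sup>2 + 1" and K: "K \<ge> 0"
    and b1: "norm ((f ^^ k) z * a n ((f ^^ k) z)) \<le> K" and b2: "norm ((f ^^ k) \<i> * a n ((f ^^ k) \<i>)) \<le> K"
  shows "norm ((f ^^ k) z * a n ((f ^^ k) z) - (f ^^ k) \<i> * a n ((f ^^ k) \<i>))
    \<le> 3 * (norm (z\<^sup>2 + 1) * K) / real k"
proof -
  define \<zeta> \<eta> where "\<zeta> = (f ^^ k) z" and "\<eta> = (f ^^ k) \<i>"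
  have k1: "real k \<ge> 1" using k by (meson add_increasing order_refl order_trans zero_le_power2)
  define r where "r = sqrt (real k)"
  have r: "r > 0" "r * r = real k" using k1 by (auto simp: r_def)
  have \<zeta>: "Im \<zeta> > 0" "\<zeta>\<^sup>2 = z\<^sup>2 - 2 * of_nat k" using f_funpow[OF z, of k] by (auto simp: \<zeta>_def)
  have \<eta>: "Im \<eta> > 0" "\<eta>\<^sup>2 = - 1 - 2 * of_nat k" using f_funpow[of \<i> k] by (auto simp: \<eta>_def)
  have Im_ge: "Im x \<ge> r" if x: "Im x > 0" "- Re (x\<^sup>2) \<ge> real k" for x
  proof -
    have "real k \<le> (Im x)\<^sup>2" using x(2) by (simp add: power2_eq_square)  (smt (verit) zero_le_square)
    then show ?thesis unfolding r_def using x(1) by (intro real_le_lsqrt) auto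
  qed
  have \<zeta>r: "Im \<zeta> \<ge> r"
  proof (rule Im_ge[OF \<zeta>(1)])
    have "Re (z\<^sup>2) \<le> norm (z\<^sup>2)" by (rule complex_Re_le_cmod)
    also have "\<dots> = (norm z)\<^sup>2" by (rule norm_power)
    finally show "real k \<le> - Re (\<zeta>\<^sup>2)" using k unfolding \<zeta>(2) by simp
  qed
  have \<eta>r: "Im \<eta> \<ge> r" by (rule Im_ge[OF \<eta>(1)]) (unfold \<eta>(2), simp)
  define c where "c = norm (z\<^sup>2 + 1)"
  have sumr: "norm (\<zeta> + \<eta>) \<ge> 2 * r" using abs_Im_le_cmod[of "\<zeta> + \<eta>"] \<zeta>r \<eta>r by simp
  have "(\<zeta> - \<eta>) * (\<zeta> + \<eta>) = \<zeta>\<^sup>2 - \<eta>\<^sup>2"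
    by (simp add: algebra_simps power2_eq_square)
  also have "\<dots> = z\<^sup>2 + 1" unfolding \<zeta>(2) \<eta>(2) by simp
  finally have "(\<zeta> - \<eta>) * (\<zeta> + \<eta>) = z\<^sup>2 + 1" .
  then have prod: "norm (\<zeta> - \<eta>) * norm (\<zeta> + \<eta>) = c" unfolding c_def norm_mult[symmetric] by simp
  have c: "c \<ge> 0" by (simp add: c_def)
  have diff: "norm (\<zeta> - \<eta>) * r \<le> c"
  proof -
    have "norm (\<zeta> - \<eta>) * r \<le> norm (\<zeta> - \<eta>) * norm (\<zeta> + \<eta>)" using sumr r by (intro mult_left_mono) auto
    then show ?thesis by (simp add: prod)
  qed
  \<comment> \<open>The squared norm of \<eta> is 1 + 2k, at most 4k.\<close>
  have \<eta>n: "norm \<eta> \<le> 2 * r"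
  proof (rule power2_le_imp_le)
    have "(norm \<eta>)\<^sup>2 = norm (- 1 - 2 * of_nat k :: complex)" unfolding norm_power[symmetric] \<eta>(2) ..
    also have "\<dots> = 1 + 2 * real k"
    proof -
      have "- 1 - 2 * of_nat k = complex_of_real (- (1 + 2 * real k))" by simp
      then show ?thesis by (simp only: norm_of_real)
    qed
    also have "\<dots> \<le> (2 * r)\<^sup>2" using k1 r by (simp add: power_mult_distrib power2_eq_square)
    finally show "(norm \<eta>)\<^sup>2 \<le> (2 * r)\<^sup>2" .
  qed (use r in simp)
  have ab: "norm (a n x) \<le> K / r" if "Im x \<ge> r" "norm (x * a n x) \<le> K" for x
  proof -
    have "r * norm (a n x) \<le> norm x * norm (a n x)"
      using that(1) abs_Im_le_cmod[of x] r by (intro mult_right_mono) auto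
    also have "\<dots> \<le> K" using that(2) by (simp add: norm_mult)
    finally show ?thesis using r by (simp add: pos_le_divide_eq mult.commute)
  qed
  have a\<zeta>: "norm (a n \<zeta>) \<le> K / r" using b1 by (intro ab \<zeta>r) (simp add: \<zeta>_def)
  have a\<eta>: "norm (a n \<eta>) \<le> K / r" using b2 by (intro ab \<eta>r) (simp add: \<eta>_def)
  have "\<zeta> * a n \<zeta> - \<eta> * a n \<eta> = (\<zeta> - \<eta>) * a n \<zeta> + \<eta> * (a n \<zeta> - a n \<eta>)" by (simp add: algebra_simps)
  also have "norm \<dots> \<le> c * K / real k + 2 * (c * K / real k)"
  proof (rule norm_triangle_mono)
    have d: "norm (\<zeta> - \<eta>) \<le> c / r" using diff r by (simp add: pos_le_divide_eq)
    have "norm ((\<zeta> - \<eta>) * a n \<zeta>) \<le> (c / r) * (K / r)"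
      unfolding norm_mult using d a\<zeta> c r by (intro mult_mono) auto
    also have "\<dots> = c * K / real k" by (simp add: r(2))
    finally show "norm ((\<zeta> - \<eta>) * a n \<zeta>) \<le> c * K / real k" .
    have "norm (a n \<zeta> - a n \<eta>) \<le> hyp_gap \<zeta> \<eta> * sqrt (norm (a n \<zeta>) * norm (a n \<eta>))"
      by (rule norm_a_diff_le[OF \<zeta>(1) \<eta>(1)])
    also have "\<dots> \<le> (c / r / r) * (K / r)"
    proof (rule mult_mono)
      have "hyp_gap \<zeta> \<eta> \<le> norm (\<zeta> - \<eta>) / r" by (rule hyp_gap_le[OF r(1) \<zeta>r \<eta>r])
      also have "\<dots> \<le> c / r / r" using d r by (intro divide_right_mono) auto
      finally show "hyp_gap \<zeta> \<eta> \<le> c / r / r" .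
      have "norm (a n \<zeta>) * norm (a n \<eta>) \<le> (K / r) * (K / r)" using a\<zeta> a\<eta> K r by (intro mult_mono) auto
      then show "sqrt (norm (a n \<zeta>) * norm (a n \<eta>)) \<le> K / r"
        using K r by (intro real_le_lsqrt) (auto simp: power2_eq_square)
    qed (use c r in auto)
    finally have "norm (\<eta> * (a n \<zeta> - a n \<eta>)) \<le> (2 * r) * ((c / r / r) * (K / r))"
      unfolding norm_mult using \<eta>n r by (intro mult_mono) auto
    also have "\<dots> = 2 * (c * K / (r * r))" using r(1) by simp
    finally show "norm (\<eta> * (a n \<zeta> - a n \<eta>)) \<le> 2 * (c * K / real k)" by (simp only: r(2))
  qed
  also have "\<dots> = 3 * (c * K) / real k" by simp
  finally show ?thesis by (simp only: \<zeta>_def \<eta>_def c_def)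
qed

lemma asymptotically_constant:
  assumes z: "Im z > 0"
  shows "(\<lambda>n. z * a n z - \<i> * a n \<i>) \<longlonglongrightarrow> 0"
proof (rule tendstoI)
  fix e :: real assume e: "e > 0"
  \<comment> \<open>The first summand bounds z a_n(z). The added 2 leaves room for the error of less
    than 1 and also covers the orbit of \<i>, where the product has norm 1.\<close>
  define K where "K = norm z * (1 + hyp_gap \<i> z)\<^sup>2 + 2"
  have K: "K \<ge> 2" by (simp add: K_def)
  define c where "c = norm (z\<^sup>2 + 1)"
  \<comment> \<open>The number of steps depends on z and e but not on n: it makes the comparison
    error at most e/2. The two errors d along the orbits add at most e/4.\<close>
  obtain k :: nat where k: "real k \<ge> (norm z)\<^sup>2 + 1 + 6 * (c * K) / e"
    using real_arch_simple by blast
  have cK: "c * K \<ge> 0" using K by (simp add: c_def)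
  have kz: "real k \<ge> (norm z)\<^sup>2 + 1" using k cK e by (smt (verit) divide_nonneg_pos mult_nonneg_nonneg)
  have kpos: "real k > 0" using kz by (smt (verit) zero_le_power2)
  have "6 * (c * K) / e \<le> real k" using k by (smt (verit) zero_le_power2)
  then have small: "3 * (c * K) / real k \<le> e / 2" using e kpos by (simp add: field_simps)
  define d where "d = min 1 (e / 8)"
  have d: "d > 0" "d \<le> 1" "d \<le> e / 8" using e by (auto simp: d_def)
  have "\<forall>\<^sub>F n in sequentially. norm ((f ^^ k) z * a n ((f ^^ k) z) - z * a n z) < d"
    using tendstoD[OF commutation_funpow[OF z, of k] d(1)] by (simp add: dist_norm)
  moreover have "\<forall>\<^sub>F n in sequentially. norm ((f ^^ k) \<i> * a n ((f ^^ k) \<i>) - \<i> * a n \<i>) < d"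
    using tendstoD[OF commutation_funpow[of \<i> k] d(1)] by (simp add: dist_norm)
  ultimately show "\<forall>\<^sub>F n in sequentially. dist (z * a n z - \<i> * a n \<i>) 0 < e"
  proof eventually_elim
    case (elim n)
    define X Y where "X = (f ^^ k) z * a n ((f ^^ k) z)" and "Y = (f ^^ k) \<i> * a n ((f ^^ k) \<i>)"
    have X: "norm (X - z * a n z) < d" and Y: "norm (Y - \<i> * a n \<i>) < d" using elim by (auto simp: X_def Y_def)
    have "norm (z * a n z) \<le> norm z * (1 + hyp_gap \<i> z)\<^sup>2"
      unfolding norm_mult by (intro mult_left_mono norm_a_le z) simp
    then have "norm X \<le> K" using X d(2) norm_triangle_ineq[of "X - z * a n z" "z * a n z"] by (simp add: K_def)
    moreover have "norm (\<i> * a n \<i>) = 1" by (simp add: norm_mult norm_a_i)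
    then have "norm Y \<le> K" using Y d(2) K norm_triangle_ineq[of "Y - \<i> * a n \<i>" "\<i> * a n \<i>"] by simp
    ultimately have "norm (X - Y) \<le> 3 * (norm (z\<^sup>2 + 1) * K) / real k"
      unfolding X_def Y_def using K by (intro orbit_comparison z kz) auto
    then have XY: "norm (X - Y) \<le> e / 2" using small by (simp add: c_def)
    have "z * a n z - \<i> * a n \<i> = (X - Y) - (X - z * a n z) + (Y - \<i> * a n \<i>)" by simp
    also have "norm \<dots> \<le> norm (X - Y) + norm (X - z * a n z) + norm (Y - \<i> * a n \<i>)"
      by (intro order_trans[OF norm_triangle_ineq] add_right_mono norm_triangle_ineq4)
    also have "\<dots> < e" using XY X Y d(3) e by linarith
    finally show ?case by simp
  qed
qed

text \<open>Asymptotically a_n(v) is c_n/v with c_n = i a_n(i) of modulus 1. Nonnegativity of Im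
  a_n(v) at v = X + i for large X of both signs leaves c_n = -1 as the only limit.\<close>

lemma a_tendsto:
  assumes z: "Im z > 0"
  shows "(\<lambda>n. a n z) \<longlonglongrightarrow> - 1 / z"
proof -
  define p q where "p n = Re (\<i> * a n \<i>)" and "q n = Im (\<i> * a n \<i>)" for n
  have pq: "(p n)\<^sup>2 + (q n)\<^sup>2 = 1" for n
    using norm_a_i[of n] cmod_power2[of "\<i> * a n \<i>"] by (simp add: p_def q_def norm_mult)
  have p0: "p n \<le> 0" for n using Im_a_nonneg[of \<i> n] by (simp add: p_def)
  have pabs: "- p n \<le> 1" for n
  proof -
    have "(p n)\<^sup>2 \<le> 1" using pq[of n] zero_le_power2[of "q n"] by linarith
    then have "\<bar>p n\<bar> \<le> 1" by (simp add: abs_square_le_1)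
    then show ?thesis by simp
  qed
  \<comment> \<open>The left-hand side is Im(cnj v c_n), asymptotically |v|^2 Im a_n(v) >= 0; the
    bound -1 is a fixed allowance for the error, which a large X makes harmless.\<close>
  have lower: "\<forall>\<^sub>F n in sequentially. X * q n - p n \<ge> - 1" for X :: real
  proof -
    define v where "v = Complex X 1"
    have v: "Im v > 0" by (simp add: v_def)
    have "(\<lambda>n. Im (cnj v * (v * a n v - \<i> * a n \<i>))) \<longlonglongrightarrow> Im (cnj v * 0)"
      by (intro tendsto_intros asymptotically_constant v)
    then have "\<forall>\<^sub>F n in sequentially. Im (cnj v * (v * a n v - \<i> * a n \<i>)) < 1"
      by (intro order_tendstoD(2)) auto
    then show ?thesis
    proof eventually_elim
      case (elim n)
      have vv: "cnj v * v = of_real ((norm v)\<^sup>2)" using complex_norm_square[of v] by (simp add: mult.commute)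
      have "cnj v * (v * a n v - \<i> * a n \<i>) = (cnj v * v) * a n v - cnj v * (\<i> * a n \<i>)"
        by (simp only: right_diff_distrib mult.assoc)
      also have "\<dots> = of_real ((norm v)\<^sup>2) * a n v - cnj v * (\<i> * a n \<i>)"
        by (simp only: vv)
      finally have "cnj v * (v * a n v - \<i> * a n \<i>) = of_real ((norm v)\<^sup>2) * a n v - cnj v * (\<i> * a n \<i>)" .
      then have "Im (cnj v * (v * a n v - \<i> * a n \<i>)) = (norm v)\<^sup>2 * Im (a n v) - Im (cnj v * (\<i> * a n \<i>))"
        by (simp only: minus_complex.sel Im_of_real_mult)
      moreover have "Im (cnj v * (\<i> * a n \<i>)) = X * q n - p n"
        by (simp add: v_def p_def q_def)
      moreover have "(norm v)\<^sup>2 * Im (a n v) \<ge> 0" using Im_a_nonneg[OF v, of n] by simp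
      ultimately show ?case using elim by linarith
    qed
  qed
  have q0: "q \<longlonglongrightarrow> 0"
  proof (rule tendstoI)
    fix e :: real assume e: "e > 0"
    show "\<forall>\<^sub>F n in sequentially. dist (q n) 0 < e"
      \<comment> \<open>Both signs together give (3/e) |q n| <= 1 - p n <= 2, so |q n| <=
        2e/3.\<close>
      using lower[of "3 / e"] lower[of "- (3 / e)"]
    proof eventually_elim
      case (elim n)
      have "3 / e * \<bar>q n\<bar> \<le> 2" using elim pabs[of n] by (simp add: abs_if split: if_splits)
      then have "\<bar>q n\<bar> < e" using e by (simp add: field_simps)
      then show ?case by simp
    qed
  qed
  have "(\<lambda>n. - sqrt (1 - (q n)\<^sup>2)) \<longlonglongrightarrow> - sqrt (1 - 0\<^sup>2)" by (intro tendsto_intros q0)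
  moreover have "- sqrt (1 - (q n)\<^sup>2) = p n" for n
  proof -
    have "1 - (q n)\<^sup>2 = (p n)\<^sup>2" using pq[of n] by simp
    then show ?thesis using p0[of n] by simp
  qed
  ultimately have p_lim: "p \<longlonglongrightarrow> -1" by simp
  have "(\<lambda>n. Complex (p n) (q n)) \<longlonglongrightarrow> Complex (-1) 0" by (intro tendsto_Complex p_lim q0)
  moreover have "Complex (-1) 0 = -1" by (simp add: complex_eq_iff)
  ultimately have ci: "(\<lambda>n. \<i> * a n \<i>) \<longlonglongrightarrow> -1" by (simp only: p_def q_def complex_surj)
  have "(\<lambda>n. ((z * a n z - \<i> * a n \<i>) + \<i> * a n \<i>) / z) \<longlonglongrightarrow> (0 + -1) / z"
    using z by (intro tendsto_intros asymptotically_constant ci) auto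
  moreover have "z \<noteq> 0" using z by auto
  ultimately show ?thesis by simp
qed

text \<open>Counts steps by height. After j steps from \<i> the square is about -1 - 2 j \<epsilon>,
  while the whole orbit of n steps ends near f(i), whose height squared is 3. Heights never
  decrease, so j \<epsilon> cannot exceed 1 by much; hence the cut-off is inactive and the square
  law at time n gives the limit.\<close>

lemma n_eps_tendsto: "(\<lambda>n. real n * \<epsilon> n) \<longlonglongrightarrow> 1"
proof -
  \<comment> \<open>The cut-off at 2/\<epsilon> keeps j \<epsilon> bounded by 2, as the iteration
    theorem demands; 2 lies well above the expected limit 1.\<close>
  define j where "j n = min n (nat \<lfloor>2 / \<epsilon> n\<rfloor>)" for n
  have fl: "real (nat \<lfloor>2 / \<epsilon> n\<rfloor>) * \<epsilon> n \<le> 2" "real (nat \<lfloor>2 / \<epsilon> n\<rfloor>) * \<epsilon> n > 2 - \<epsilon> n" for n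
  proof -
    have e: "\<epsilon> n > 0" by (rule \<epsilon>_pos)
    then have "2 / \<epsilon> n \<ge> 0" by simp
    then have "real (nat \<lfloor>2 / \<epsilon> n\<rfloor>) = of_int \<lfloor>2 / \<epsilon> n\<rfloor>" by simp
    then have 1: "real (nat \<lfloor>2 / \<epsilon> n\<rfloor>) \<le> 2 / \<epsilon> n" and 2: "2 / \<epsilon> n < real (nat \<lfloor>2 / \<epsilon> n\<rfloor>) + 1" by linarith+
    show "real (nat \<lfloor>2 / \<epsilon> n\<rfloor>) * \<epsilon> n \<le> 2" by (rule iffD1[OF pos_le_divide_eq[OF e] 1])
    from iffD1[OF pos_divide_less_eq[OF e] 2]
    show "real (nat \<lfloor>2 / \<epsilon> n\<rfloor>) * \<epsilon> n > 2 - \<epsilon> n" by (simp only: distrib_right mult_1_left)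
  qed
  have j2: "real (j n) * \<epsilon> n \<le> 2" for n
  proof -
    have "real (j n) * \<epsilon> n \<le> real (nat \<lfloor>2 / \<epsilon> n\<rfloor>) * \<epsilon> n"
    proof (rule mult_right_mono)
      have "j n \<le> nat \<lfloor>2 / \<epsilon> n\<rfloor>" by (simp add: j_def)
      then show "real (j n) \<le> real (nat \<lfloor>2 / \<epsilon> n\<rfloor>)" by (rule of_nat_mono)
    qed (use \<epsilon>_pos[of n] in simp)
    then show ?thesis using fl(1)[of n] by linarith
  qed
  define u where "u i n = (recip_cauchy_transform (N n) ^^ i) \<i>" for i n
  define g where "g n = recip_cauchy_transform (P n) \<i>" for n
  have g_eq: "g n = u n n" for n unfolding g_def u_def by (rule P_eq) simp
  have lim: "(\<lambda>n. recip_shift (N n) w / of_real (\<epsilon> n)) \<longlonglongrightarrow> - 1 / w" if "Im w > 0" for w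
    using a_tendsto[OF that] by (simp add: a_def)
  have W: "(\<lambda>n. (u (j n) n)\<^sup>2 - \<i>\<^sup>2 + of_real (2 * (real (j n) * \<epsilon> n))) \<longlonglongrightarrow> 0"
    unfolding u_def by (rule iterate_square_tendsto[OF N \<epsilon>_pos \<epsilon>_lim lim j2]) auto
  have g_lim: "g \<longlonglongrightarrow> f \<i>" unfolding g_def[abs_def] by (rule g_tendsto) simp
  have fi: "(f \<i>)\<^sup>2 = - 3" "Im (f \<i>) > 0" using f_props[of \<i>] by simp_all
  have Imf: "(Im (f \<i>))\<^sup>2 = 3"
  proof -
    have "Im ((f \<i>)\<^sup>2) = 0" "Re ((f \<i>)\<^sup>2) = - 3" unfolding fi(1) by simp_all
    then have "Re (f \<i>) = 0" and *: "Re (f \<i>) * Re (f \<i>) - Im (f \<i>) * Im (f \<i>) = - 3"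
      using fi(2) by (simp_all add: power2_eq_square)
    then show ?thesis by (simp add: power2_eq_square)
  qed
  have "(\<lambda>n. Re ((u (j n) n)\<^sup>2 - \<i>\<^sup>2 + of_real (2 * (real (j n) * \<epsilon> n)))) \<longlonglongrightarrow> Re 0" by (intro tendsto_Re W)
  then have evW: "\<forall>\<^sub>F n in sequentially. Re ((u (j n) n)\<^sup>2 - \<i>\<^sup>2 + of_real (2 * (real (j n) * \<epsilon> n))) < 1 / 10"
    by (intro order_tendstoD(2)) auto
  have "(\<lambda>n. (Im (g n))\<^sup>2) \<longlonglongrightarrow> (Im (f \<i>))\<^sup>2" by (intro tendsto_intros g_lim)
  then have evg: "\<forall>\<^sub>F n in sequentially. (Im (g n))\<^sup>2 < 3 + 1 / 10" unfolding Imf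
    by (intro order_tendstoD(2)) auto
  have eve: "\<forall>\<^sub>F n in sequentially. \<epsilon> n < 1 / 10" by (rule order_tendstoD(2)[OF \<epsilon>_lim]) simp
  from evW evg eve have jn: "\<forall>\<^sub>F n in sequentially. j n = n"
  proof eventually_elim
    case (elim n)
    interpret real_distribution "N n" by (rule N)
    have "1 \<le> Im (u (j n) n)" "Im (u (j n) n) \<le> Im (u n n)"
      using Im_recip_cauchy_transform_funpow[of \<i> "j n" n] Im_recip_cauchy_transform_funpow(2)[of \<i> "j n" "j n"]
      by (auto simp: u_def j_def)
    then have "(Im (u (j n) n))\<^sup>2 \<le> (Im (g n))\<^sup>2" unfolding g_eq by (intro power_mono) auto
    moreover have "- Re ((u (j n) n)\<^sup>2) \<le> (Im (u (j n) n))\<^sup>2"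
      by (simp add: power2_eq_square)
    moreover have "Re ((u (j n) n)\<^sup>2 - \<i>\<^sup>2 + of_real (2 * (real (j n) * \<epsilon> n)))
      = Re ((u (j n) n)\<^sup>2) + 1 + 2 * (real (j n) * \<epsilon> n)"
      by (simp only: plus_complex.sel minus_complex.sel Re_complex_of_real power2_i) simp
    \<comment> \<open>The estimates give 1 + 2 j \<epsilon> < 3 + 1/10 + 1/10, so j \<epsilon> <
      1.1, whereas the cut-off value would exceed 1.9. The number 1.5 separates the two
      cases.\<close>
    ultimately have "real (j n) * \<epsilon> n < 1.5" using elim by linarith
    moreover have "real (nat \<lfloor>2 / \<epsilon> n\<rfloor>) * \<epsilon> n > 1.5" using fl(2)[of n] elim by linarith
    ultimately have "j n \<noteq> nat \<lfloor>2 / \<epsilon> n\<rfloor>" by auto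
    moreover have "j n = n \<or> j n = nat \<lfloor>2 / \<epsilon> n\<rfloor>" by (auto simp: j_def min_def)
    ultimately show ?case by blast
  qed
  have 1: "(\<lambda>n. Re (((u (j n) n)\<^sup>2 - \<i>\<^sup>2 + of_real (2 * (real (j n) * \<epsilon> n))) - (g n)\<^sup>2) / 2 - 1 / 2)
    \<longlonglongrightarrow> Re (0 - (f \<i>)\<^sup>2) / 2 - 1 / 2"
    by (intro tendsto_intros W g_lim) auto
  have 3: "Re (0 - (f \<i>)\<^sup>2) / 2 - 1 / 2 = 1" unfolding fi(1) by simp
  have 2: "\<forall>\<^sub>F n in sequentially. Re (((u (j n) n)\<^sup>2 - \<i>\<^sup>2
    + of_real (2 * (real (j n) * \<epsilon> n))) - (g n)\<^sup>2) / 2 - 1 / 2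
     = real n * \<epsilon> n"
    using jn
  proof eventually_elim
    case (elim n)
    have "((u (j n) n)\<^sup>2 - \<i>\<^sup>2 + of_real (2 * (real (j n) * \<epsilon> n))) - (g n)\<^sup>2 = of_real (1 + 2 * (real n * \<epsilon> n))"
      unfolding elim g_eq by simp
    then show ?case by (simp only: Re_complex_of_real) (simp add: add_divide_distrib)
  qed
  from Lim_transform_eventually[OF 1 2] show ?thesis unfolding 3 .
qed

lemma n_shift_tendsto:
  assumes z: "Im z > 0"
  shows "(\<lambda>n. of_nat n * recip_shift (N n) z) \<longlonglongrightarrow> - 1 / z"
proof -
  have lim: "(\<lambda>n. of_real (real n * \<epsilon> n) * a n z) \<longlonglongrightarrow> of_real 1 * (- 1 / z)"
    by (intro tendsto_mult tendsto_of_real n_eps_tendsto a_tendsto z)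
  have eq: "of_real (real n * \<epsilon> n) * a n z = of_nat n * recip_shift (N n) z" for n
    using \<epsilon>_pos[of n] by (simp add: a_def)
  show ?thesis using lim unfolding eq by simp
qed

end

text \<open>On the imaginary axis the asymptotics of n A_n determine z^2 G(z) - z. Its imaginary
  part is -y psi(y), which leads to slow variation; its limit is the mean, which is then compared
  with the purely imaginary limit of the scaled quantity.\<close>

theorem arcsine_limit_necessary:
  assumes \<mu>: "real_distribution \<mu>" and nd: "\<not> degenerate \<mu>" and B: "\<And>n. B n > 0"
    and conv: "weak_conv_m (\<lambda>n. dilation (1 / B n) (monotone_conv_power \<mu> n)) arcsine_law"
  shows "slowly_varying (truncated_second_moment \<mu>) \<and> has_mean \<mu> 0"
proof -
  interpret real_distribution \<mu> by fact
  have Btop: "filterlim B at_top sequentially"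
    by (rule normalisation_at_top[OF \<mu> nd B real_distribution_arcsine conv])
  define N where "N n = dilation (1 / B n) \<mu>" for n
  have b: "1 / B n > 0" for n using B[of n] by simp
  have shift_N: "recip_shift (N n) z = recip_shift \<mu> (of_real (B n) * z) / of_real (B n)" for n z
    unfolding N_def by (rule recip_shift_dilation_inverse[OF B])
  have zG: "(\<lambda>n. (\<i> * of_real (l * B n)) * cauchy_transform \<mu> (\<i> * of_real (l * B n))) \<longlonglongrightarrow> 1" if "l > 0" for l
    by (rule filterlim_compose[OF cauchy_transform_at_top filterlim_tendsto_pos_mult_at_top[OF tendsto_const that Btop]])
  interpret arcsine_scaling N "\<lambda>n. dilation (1 / B n) (monotone_conv_power \<mu> n)"
  proof (rule arcsine_scaling.intro)
    show "real_distribution (N n)" for n unfolding N_def by (rule real_distribution_dilation)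
    show "real_distribution (dilation (1 / B n) (monotone_conv_power \<mu> n))" for n
      by (intro real_distribution.real_distribution_dilation real_distribution_monotone_conv_power \<mu>)
    show "recip_cauchy_transform (dilation (1 / B n) (monotone_conv_power \<mu> n)) z
      = (recip_cauchy_transform (N n) ^^ n) z"
      if "Im z > 0" for n z unfolding N_def by (rule recip_cauchy_transform_dilation_power[OF \<mu> b that])
    show "weak_conv_m (\<lambda>n. dilation (1 / B n) (monotone_conv_power \<mu> n)) arcsine_law" by (rule conv)
    show "Im (recip_shift (N n) z) > 0" if "Im z > 0" for n z
      unfolding shift_N using recip_shift_strict[OF _ nd, of "of_real (B n) * z"] that B[of n] by simp
    \<comment> \<open>At \<i> the scaled displacement is i/(z G(z)) - i with z = i B_n, and z G(z)
      tends to 1 because B_n tends to infinity.\<close>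
    have "(\<lambda>n. \<i> / ((\<i> * of_real (1 * B n)) * cauchy_transform \<mu> (\<i> * of_real (1 * B n))) - \<i>) \<longlonglongrightarrow> \<i> / 1 - \<i>"
      by (intro tendsto_intros zG) auto
    moreover have "\<i> / ((\<i> * of_real (1 * B n)) * cauchy_transform \<mu> (\<i> * of_real (1 * B n))) - \<i>
      = recip_shift (N n) \<i>" for n
      unfolding shift_N using B[of n]
      by (simp add: recip_shift_def recip_cauchy_transform_def diff_divide_distrib mult.commute)
    ultimately show "(\<lambda>n. recip_shift (N n) \<i>) \<longlonglongrightarrow> 0" by simp
  qed
  \<comment> \<open>Multiplying F(z) - z by -z G(z), which tends to -1, gives z^2 G(z) - z
    exactly.\<close>
  have key: "(\<lambda>n. of_real (real n / B n) * ((\<i> * of_real (l * B n))\<^sup>2 * cauchy_transform \<mu> (\<i> * of_real (l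
    * B n)) - \<i> * of_real (l * B n)))
    \<longlonglongrightarrow> - \<i> / of_real l" if l: "l > 0" for l
  proof -
    have "(\<lambda>n. - ((\<i> * of_real (l * B n)) * cauchy_transform \<mu> (\<i> * of_real (l * B n))) * (of_nat n
      * recip_shift (N n) (\<i> * of_real l)))
      \<longlonglongrightarrow> - 1 * (- 1 / (\<i> * of_real l))"
      using l by (intro tendsto_intros zG n_shift_tendsto) auto
    moreover have "- 1 * (- 1 / (\<i> * of_real l)) = - \<i> / of_real l" using l by (simp add: field_simps)
    moreover have "- ((\<i> * of_real (l * B n)) * cauchy_transform \<mu> (\<i> * of_real (l * B n))) * (of_nat n
      * recip_shift (N n) (\<i> * of_real l))
       = of_real (real n / B n) * ((\<i> * of_real (l * B n))\<^sup>2 * cauchy_transform \<mu> (\<i> * of_real (l * B n))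
         - \<i> * of_real (l * B n))" for n
    proof -
      define z where "z = \<i> * complex_of_real (l * B n)"
      have z: "Im z > 0" "z = of_real (B n) * (\<i> * of_real l)" using l B[of n] by (auto simp: z_def)
      have G: "cauchy_transform \<mu> z \<noteq> 0" by (rule cauchy_transform_nonzero[OF z(1)])
      have "recip_shift (N n) (\<i> * of_real l) = (1 / cauchy_transform \<mu> z - z) / of_real (B n)"
        unfolding shift_N z(2)[symmetric] by (simp add: recip_shift_def recip_cauchy_transform_def)
      then have "- (z * cauchy_transform \<mu> z) * (of_nat n * recip_shift (N n) (\<i> * of_real l))
        = of_real (real n / B n) * (- (z * cauchy_transform \<mu> z) * (1 / cauchy_transform \<mu> z - z))" by simp
      also have "- (z * cauchy_transform \<mu> z) * (1 / cauchy_transform \<mu> z - z) = z\<^sup>2 * cauchy_transform \<mu> z - z"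
        using G by (simp add: right_diff_distrib power2_eq_square)
      finally show ?thesis by (simp only: z_def)
    qed
    ultimately show ?thesis by simp
  qed
  have Im_key: "Im ((\<i> * of_real y)\<^sup>2 * cauchy_transform \<mu> (\<i> * of_real y) - \<i> * of_real y)
    = - y * smoothed_ratio \<mu> y" if "y > 0" for y
    using smoothed_ratio_eq[OF that] by (simp add: power_mult_distrib algebra_simps power2_eq_square)
  have level: "(\<lambda>n. real n * smoothed_ratio \<mu> (l * B n)) \<longlonglongrightarrow> 1 / l\<^sup>2" if l: "l > 0" for l
  proof -
    have "(\<lambda>n. - Im (of_real (real n / B n) * ((\<i> * of_real (l * B n))\<^sup>2 * cauchy_transform \<mu> (\<i>
      * of_real (l * B n)) - \<i> * of_real (l * B n))) / l)
      \<longlonglongrightarrow> - Im (- \<i> / of_real l) / l"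
      using l by (intro tendsto_intros key) auto
    moreover have "- Im (- \<i> / of_real l) / l = 1 / l\<^sup>2" using l by (simp add: power2_eq_square)
    moreover have "- Im (of_real (real n / B n) * ((\<i> * of_real (l * B n))\<^sup>2 * cauchy_transform \<mu> (\<i>
      * of_real (l * B n)) - \<i> * of_real (l * B n))) / l
      = real n * smoothed_ratio \<mu> (l * B n)" for n
    proof -
      have p: "l * B n > 0" using l B[of n] by simp
      show ?thesis unfolding Im_of_real_mult Im_key[OF p] using l B[of n] by simp
    qed
    ultimately show ?thesis by simp
  qed
  have sv: "slowly_varying (truncated_second_moment \<mu>)"
    by (rule slowly_varying_from_level[OF nd B level])
  have int: "integrable \<mu> (\<lambda>t. t)" by (rule slowly_varying_imp_integrable[OF sv])
  define m where "m = (\<integral>t. t \<partial>\<mu>)"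
  define X where "X n = (\<i> * of_real (B n))\<^sup>2 * cauchy_transform \<mu> (\<i> * of_real (B n))
    - \<i> * of_real (B n)" for n
  define Y where "Y n = of_real (real n / B n) * X n" for n
  have X: "X \<longlonglongrightarrow> of_real m" unfolding X_def m_def by (rule mean_tendsto[OF int B Btop])
  have Y: "Y \<longlonglongrightarrow> - \<i>" using key[of 1] by (simp add: Y_def[abs_def] X_def)
  \<comment> \<open>Y is a real multiple of X, so Re X = Re Y Im X/Im Y. Here Y tends to -i and X to
    the real number m, so the right side tends to 0 and m vanishes; no growth rate of n/B_n
    enters.\<close>
  have 1: "(\<lambda>n. Re (Y n) * Im (X n) / Im (Y n)) \<longlonglongrightarrow> Re (- \<i>) * Im (of_real m) / Im (- \<i>)"
    by (intro tendsto_intros X Y) auto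
  have 2: "(\<lambda>n. Re (X n)) \<longlonglongrightarrow> Re (of_real m)" by (intro tendsto_Re X)
  have 3: "\<forall>\<^sub>F n in sequentially. Re (Y n) * Im (X n) / Im (Y n) = Re (X n)"
  proof -
    have "\<forall>\<^sub>F n in sequentially. Im (Y n) < 0"
      using tendsto_Im[OF Y] by (intro order_tendstoD(2)) auto
    then show ?thesis
    proof eventually_elim
      case (elim n)
      have "Re (Y n) = real n / B n * Re (X n)" "Im (Y n) = real n / B n * Im (X n)"
        unfolding Y_def by (simp_all only: Re_of_real_mult Im_of_real_mult)
      then show ?case using elim by auto
    qed
  qed
  have "Re (- \<i>) * Im (of_real m) / Im (- \<i>) = Re (of_real m)"
    by (rule LIMSEQ_unique[OF Lim_transform_eventually[OF 1 3] 2])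
  then have "m = 0" by simp
  then show ?thesis using sv int by (simp add: has_mean_def m_def)
qed

theorem theorem3p1:
  fixes \<mu> :: "real measure"
  assumes "real_distribution \<mu>"
    and "\<not> degenerate \<mu>"
  shows "(\<exists>B :: nat \<Rightarrow> real. (\<forall>n. B n > 0) \<and>
            weak_conv_m (\<lambda>n. dilation (1 / B n) (monotone_conv_power \<mu> n)) arcsine_law)
         \<longleftrightarrow> slowly_varying (truncated_second_moment \<mu>) \<and> has_mean \<mu> 0"
  using arcsine_limit_sufficient[OF assms] arcsine_limit_necessary[OF assms] by blast

end
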